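(* (Nonpure noncommutative Stokes theorem) Let $\mathcal{A}$ be a noncommutative $C^*$-algebra equipped with a faithful trace $\int$, let $Q$ be an oriented manifold with boundary $\partial Q$, let $F=(\rho,V)$ be a nonpure map from $Q$ to $\mathcal{A}$, and let $\omega$ be a differential form on $\mathcal{A}$. Then $$F^*d\omega=dF^*\omega$$ and $$\int_QF^*d\omega=\int_{\partial Q}F^*\omega ,$$ where in the second formula the degree of $\omega$ is $\dim Q-1$.
   Context: $[a,b]=ab-ba$ in $\mathcal{A}$. Trace: $\mathcal{A}$ is equipped with a trace, denoted by the integration symbol $\int:\mathcal{A}\to[0,\infty]$, which is linear and satisfies $\int[a,b]=0$ for all $a,b\in\mathcal{A}$. It is assumed faithful, i.e. if $\int fg=0$ for all $f$ then $g=0$, and the set of all elements of finite trace is assumed to be an ideal of $\mathcal{A}$ over the real numbers. States: $\mathcal{S}(\mathcal{A})$ is the set of density elements, i.e. self-adjoint positive $\rho\in\mathcal{A}$ with $\int\rho=1$; each induces a state $f\mapsto\int\rho f$. Nonpure maps: a nonpure map (differentiable function) from a manifold $Q$ to $\mathcal{A}$ is a pair $F=(\rho,V)$ of a differentiable map $\rho:Q\to\mathcal{S}(\mathcal{A})$ and a differentiable map $V:TQ\to\mathcal{A}$, linear on each fiber, such that for every coordinate system $(u_1,\dots,u_m)$ on $Q$, with $V_j(u):=V(\frac{\partial}{\partial u_j}(u))$, $$\frac{\partial\rho}{\partial u_j}+[V_j,\rho]=0,\qquad \frac{\partial V_i}{\partial u_j}-\frac{\partial V_j}{\partial u_i}=[V_i,V_j]\qquad\text{for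 all } i,j.$$ Forms on $\mathcal{A}$: a $k$-differential form on $\mathcal{A}$ is a linear map $\omega:\Lambda^k\mathcal{A}\to\mathcal{A}$, where $\Lambda^k\mathcal{A}$ is the $k$-th exterior power; in other words, a $k$-linear alternating map $\omega:\mathcal{A}^{\otimes k}\to\mathcal{A}$. The operator $d$ from $k$-forms to $(k+1)$-forms is the Chevalley–Eilenberg differential of the Lie algebra $(\mathcal{A},[\cdot,\cdot])$ with coefficients in the adjoint module $\mathcal{A}$: $$d\omega(a_1,\dots,a_{k+1})=\sum_{i}(-1)^{i-1}[a_i,\omega(a_1,\dots,\widehat{a_i},\dots,a_{k+1})]+\sum_{i<j}(-1)^{i+j}\omega([a_i,a_j],a_1,\dots,\widehat{a_i},\dots,\widehat{a_j},\dots,a_{k+1}).$$ Pullback: for a $k$-form $\omega$ on $\mathcal{A}$, $F^*\omega$ is the $k$-form on $Q$ given by $$(F^*\omega)(q;w_1,\dots,w_k):=\int\rho(q)\,\omega(V(w_1)\otimes\cdots\otimes V(w_k)),\qquad q\in Q,\ w_i\in T_qQ.$$ On $Q$, $d$ is the usual exterior derivative; $\int_Q$ and $\int_{\partial Q}$ are the usual integrals of differential forms.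
   Formalization: Differential forms on the algebra are assumed bounded (continuous), since for discontinuous ω the pullback F*ω need not be differentiable; the integral formula is stated for F*ω with compact support (automatic for compact Q), since it fails e.g. on Q=(0,1). *)

theory Defs
  imports "HOL-Analysis.Analysis"
begin

section \<open>C*-algebras\<close>

text \<open>Complex C*-algebras, not assumed unital and not assumed commutative.\<close>

class cstar_algebra = real_normed_algebra + banach +
  fixes scaleC :: "complex \<Rightarrow> 'a \<Rightarrow> 'a"  (infixr \<open>*\<^sub>C\<close> 75)
    and star :: "'a \<Rightarrow> 'a"
  assumes scaleC_of_real: "complex_of_real r *\<^sub>C a = r *\<^sub>R a"
    and scaleC_add_right: "z *\<^sub>C (a + b) = z *\<^sub>C a + z *\<^sub>C b"
    and scaleC_add_left: "(z + w) *\<^sub>C a = z *\<^sub>C a + w *\<^sub>C a"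
    and scaleC_scaleC: "z *\<^sub>C (w *\<^sub>C a) = (z * w) *\<^sub>C a"
    and scaleC_mult_left: "(z *\<^sub>C a) * b = z *\<^sub>C (a * b)"
    and scaleC_mult_right: "a * (z *\<^sub>C b) = z *\<^sub>C (a * b)"
    and norm_scaleC: "norm (z *\<^sub>C a) = cmod z * norm a"
    and star_add: "star (a + b) = star a + star b"
    and star_scaleC: "star (z *\<^sub>C a) = cnj z *\<^sub>C star a"
    and star_mult: "star (a * b) = star b * star a"
    and star_star: "star (star a) = a"
    and cstar_identity: "norm (star a * a) = (norm a)\<^sup>2"

definition comm :: "'a::ring \<Rightarrow> 'a \<Rightarrow> 'a" where
  "comm a b = a * b - b * a"

text \<open>The positive cone of a *-algebra: finite sums of elements \<open>c\<^sup>* c\<close>. In a C*-algebra each such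
  sum is again of the form \<open>c\<^sup>* c\<close>.\<close>

inductive positive :: "'a::cstar_algebra \<Rightarrow> bool" where
  square: "positive (star c * c)"
| add: "positive a \<Longrightarrow> positive b \<Longrightarrow> positive (a + b)"


section \<open>Traces and density elements\<close>

text \<open>A trace has its values in \<open>[0,\<infinity>]\<close> on the positive cone (its values elsewhere play no role). The
  elements of finite trace are the combinations \<open>a\<^sub>1 - a\<^sub>2 + i (a\<^sub>3 - a\<^sub>4)\<close> of positive elements with
  finite trace, and the trace extends to them by linearity, with complex values.\<close>

definition trace_decomp ::
  "('a::cstar_algebra \<Rightarrow> ennreal) \<Rightarrow> 'a \<Rightarrow> 'a \<Rightarrow> 'a \<Rightarrow> 'a \<Rightarrow> 'a \<Rightarrow> bool" where
  "trace_decomp \<tau> a a1 a2 a3 a4 \<longleftrightarrow>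
     (\<forall>p\<in>{a1, a2, a3, a4}. positive p \<and> \<tau> p < \<infinity>) \<and> a = a1 - a2 + \<i> *\<^sub>C (a3 - a4)"

definition finite_trace :: "('a::cstar_algebra \<Rightarrow> ennreal) \<Rightarrow> 'a set" where
  "finite_trace \<tau> = {a. \<exists>a1 a2 a3 a4. trace_decomp \<tau> a a1 a2 a3 a4}"

definition trace_int :: "('a::cstar_algebra \<Rightarrow> ennreal) \<Rightarrow> 'a \<Rightarrow> complex" where
  "trace_int \<tau> a = (THE z. \<exists>a1 a2 a3 a4. trace_decomp \<tau> a a1 a2 a3 a4 \<and>
     z = Complex (enn2real (\<tau> a1) - enn2real (\<tau> a2)) (enn2real (\<tau> a3) - enn2real (\<tau> a4)))"

text \<open>The vanishing on commutators is only required of \<open>[a,b]\<close> with \<open>a\<close> of finite trace, so that, for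
  instance, the usual trace on the bounded operators of a Hilbert space is included.\<close>

definition faithful_trace :: "('a::cstar_algebra \<Rightarrow> ennreal) \<Rightarrow> bool" where
  "faithful_trace \<tau> \<longleftrightarrow>
     (\<forall>a b. positive a \<longrightarrow> positive b \<longrightarrow> \<tau> (a + b) = \<tau> a + \<tau> b) \<and>
     (\<forall>r a. 0 \<le> r \<longrightarrow> positive a \<longrightarrow> \<tau> (r *\<^sub>R a) = ennreal r * \<tau> a) \<and>
     subspace (finite_trace \<tau>) \<and>
     (\<forall>a\<in>finite_trace \<tau>. \<forall>b. a * b \<in> finite_trace \<tau> \<and> b * a \<in> finite_trace \<tau>) \<and>
     (\<forall>a\<in>finite_trace \<tau>. \<forall>b. trace_int \<tau> (comm a b) = 0) \<and>
     (\<forall>g. (\<forall>f. f * g \<in> finite_trace \<tau> \<and> trace_int \<tau> (f * g) = 0) \<longrightarrow> g = 0)"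

definition density_elements :: "('a::cstar_algebra \<Rightarrow> ennreal) \<Rightarrow> 'a set" where
  "density_elements \<tau> = {\<rho>. star \<rho> = \<rho> \<and> positive \<rho> \<and> \<tau> \<rho> = 1}"


section \<open>Differential forms on the algebra\<close>

text \<open>A \<open>k\<close>-form is a function on lists; only its values on lists of length \<open>k\<close> matter. Linearity over
  the reals is required, which includes the complex multilinear forms. Forms are bounded, as for an
  unbounded \<open>\<omega>\<close> the pullback need not be differentiable.\<close>

definition algebra_form :: "nat \<Rightarrow> ('a::cstar_algebra list \<Rightarrow> 'a) \<Rightarrow> bool" where
  "algebra_form k \<omega> \<longleftrightarrow>
     (\<forall>as i. length as = k \<longrightarrow> i < k \<longrightarrow> linear (\<lambda>a. \<omega> (as[i := a]))) \<and>
     (\<forall>as i j. length as = k \<longrightarrow> i < j \<longrightarrow> j < k \<longrightarrow> as ! i = as ! j \<longrightarrow> \<omega> as = 0) \<and>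
     (\<exists>K. \<forall>as. length as = k \<longrightarrow> norm (\<omega> as) \<le> K * prod_list (map norm as))"

definition omit :: "nat \<Rightarrow> 'b list \<Rightarrow> 'b list" where
  "omit i xs = take i xs @ drop (Suc i) xs"

text \<open>The Chevalley--Eilenberg differential. Indices start at 0, which leaves \<open>(-1)\<^sup>i\<^sup>+\<^sup>j\<close> unchanged.\<close>

definition ce_diff :: "('a::cstar_algebra list \<Rightarrow> 'a) \<Rightarrow> 'a list \<Rightarrow> 'a" where
  "ce_diff \<omega> as =
     (\<Sum>i<length as. (-1::real) ^ i *\<^sub>R comm (as ! i) (\<omega> (omit i as))) +
     (\<Sum>j<length as. \<Sum>i<j. (-1::real) ^ (i + j) *\<^sub>R
        \<omega> (comm (as ! i) (as ! j) # omit i (omit j as)))"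


section \<open>Smooth manifolds with boundary\<close>

text \<open>The manifold is the whole of a Hausdorff second countable type \<open>'q\<close>; its dimension is
  \<open>CARD('n)\<close>, and the order of \<open>'n\<close> is the order of the coordinates. Charts map to the half-space in
  which the first coordinate is \<open>\<le> 0\<close>, so that the first coordinate direction is the outward one at
  the boundary.\<close>

definition first_coord :: "'n::{finite,linorder}" where
  "first_coord = Min UNIV"

definition half_space :: "(real^'n::{finite,linorder}) set" where
  "half_space = {x. x $ first_coord \<le> 0}"

type_synonym ('q, 'n) chart = "'q set \<times> ('q \<Rightarrow> real^'n)"

definition cdom :: "('q, 'n::finite) chart \<Rightarrow> 'q set" where
  "cdom c = fst c"

definition coords :: "('q, 'n::finite) chart \<Rightarrow> 'q \<Rightarrow> real^'n" where
  "coords c = snd c"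

definition target :: "('q, 'n::finite) chart \<Rightarrow> (real^'n) set" where
  "target c = coords c ` cdom c"

definition param :: "('q, 'n::finite) chart \<Rightarrow> real^'n \<Rightarrow> 'q" where
  "param c = inv_into (cdom c) (coords c)"

text \<open>\<open>C\<^sup>k\<close> functions on a relatively open subset of the half-space, with derivatives taken within
  that subset (they are unique, also at boundary points).\<close>

fun Ck_on :: "nat \<Rightarrow> ('v::real_normed_vector) set \<Rightarrow> ('v \<Rightarrow> 'w::real_normed_vector) \<Rightarrow> bool" where
  "Ck_on 0 S f \<longleftrightarrow> continuous_on S f"
| "Ck_on (Suc k) S f \<longleftrightarrow>
     (\<exists>f'. (\<forall>x\<in>S. (f has_derivative f' x) (at x within S)) \<and> (\<forall>v. Ck_on k S (\<lambda>x. f' x v)))"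

definition manifold_atlas ::
  "('q::{t2_space,second_countable_topology}, 'n::{finite,linorder}) chart set \<Rightarrow> bool" where
  "manifold_atlas \<A> \<longleftrightarrow>
     (\<forall>c\<in>\<A>. open (cdom c) \<and> openin (top_of_set half_space) (target c) \<and>
        homeomorphism (cdom c) (target c) (coords c) (param c)) \<and>
     (\<Union>c\<in>\<A>. cdom c) = UNIV \<and>
     (\<forall>c\<in>\<A>. \<forall>c'\<in>\<A>. \<forall>k. Ck_on k (coords c ` (cdom c \<inter> cdom c')) (coords c' \<circ> param c))"

definition boundary ::
  "('q, 'n::{finite,linorder}) chart set \<Rightarrow> 'q set" where
  "boundary \<A> = {q. \<exists>c\<in>\<A>. q \<in> cdom c \<and> coords c q $ first_coord = 0}"

definition transition_deriv ::
  "('q, 'n::finite) chart \<Rightarrow> ('q, 'n) chart \<Rightarrow> 'q \<Rightarrow> real^'n \<Rightarrow> real^'n" where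
  "transition_deriv c c' q =
     frechet_derivative (coords c' \<circ> param c)
       (at (coords c q) within coords c ` (cdom c \<inter> cdom c'))"

text \<open>A tangent vector at \<open>q\<close> is the family of its coordinate vectors in all the charts around \<open>q\<close>
  (and \<open>0\<close> in the other charts).\<close>

type_synonym ('q, 'n) tvec = "('q, 'n) chart \<Rightarrow> real^'n"

definition tangent_space ::
  "('q, 'n::finite) chart set \<Rightarrow> 'q \<Rightarrow> ('q, 'n) tvec set" where
  "tangent_space \<A> q =
     {w. (\<forall>c\<in>\<A>. \<forall>c'\<in>\<A>. q \<in> cdom c \<longrightarrow> q \<in> cdom c' \<longrightarrow> w c' = transition_deriv c c' q (w c)) \<and>
         (\<forall>c. \<not> (c \<in> \<A> \<and> q \<in> cdom c) \<longrightarrow> w c = 0)}"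

text \<open>The tangent vector at \<open>q\<close> with coordinate vector \<open>v\<close> in the chart \<open>c\<close>, and the vectors
  \<open>\<partial>/\<partial>u\<^sub>j\<close>.\<close>

definition tvec_of ::
  "('q, 'n::finite) chart set \<Rightarrow> ('q, 'n) chart \<Rightarrow> 'q \<Rightarrow> real^'n \<Rightarrow> ('q, 'n) tvec" where
  "tvec_of \<A> c q v = (\<lambda>c'. if c' \<in> \<A> \<and> q \<in> cdom c' then transition_deriv c c' q v else 0)"

definition coord_vec ::
  "('q, 'n::finite) chart set \<Rightarrow> ('q, 'n) chart \<Rightarrow> 'q \<Rightarrow> 'n \<Rightarrow> ('q, 'n) tvec" where
  "coord_vec \<A> c q j = tvec_of \<A> c q (axis j 1)"

text \<open>The partial derivative \<open>\<partial>f/\<partial>u\<^sub>j\<close> at the point with coordinates \<open>u\<close>, for \<open>f\<close> given as a function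
  of the coordinates of \<open>c\<close>.\<close>

definition partial ::
  "('q, 'n::finite) chart \<Rightarrow> (real^'n \<Rightarrow> 'w::real_normed_vector) \<Rightarrow> real^'n \<Rightarrow> 'n \<Rightarrow> 'w" where
  "partial c f u j = frechet_derivative f (at u within target c) (axis j 1)"

text \<open>An orientation is given by the sign \<open>\<sigma> c q\<close> of the basis \<open>(\<partial>/\<partial>u\<^sub>j)\<^sub>j\<close> of the tangent space at \<open>q\<close>.
  Charts need not be positively oriented; in dimension 1 some boundary points have no positively
  oriented chart into the half-space.\<close>

definition orientation ::
  "('q::topological_space, 'n::finite) chart set \<Rightarrow> (('q, 'n) chart \<Rightarrow> 'q \<Rightarrow> real) \<Rightarrow> bool" where
  "orientation \<A> \<sigma> \<longleftrightarrow>
     (\<forall>c\<in>\<A>. continuous_on (cdom c) (\<sigma> c) \<and> (\<forall>q\<in>cdom c. \<sigma> c q = 1 \<or> \<sigma> c q = -1)) \<and>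
     (\<forall>c\<in>\<A>. \<forall>c'\<in>\<A>. \<forall>q\<in>cdom c \<inter> cdom c'.
        \<sigma> c q = sgn (det (matrix (transition_deriv c c' q))) * \<sigma> c' q)"


section \<open>Differential forms on the manifold\<close>

text \<open>A \<open>k\<close>-form assigns to each point \<open>q\<close> a function of lists of \<open>k\<close> tangent vectors at \<open>q\<close>.\<close>

type_synonym ('q, 'n) mform = "'q \<Rightarrow> ('q, 'n) tvec list \<Rightarrow> complex"

text \<open>The form in the coordinates of \<open>c\<close>, on tangent vectors with constant coordinates \<open>vs\<close>.\<close>

definition local_form ::
  "('q, 'n::finite) chart set \<Rightarrow> ('q, 'n) chart \<Rightarrow> ('q, 'n) mform \<Rightarrow> (real^'n) list \<Rightarrow>
     real^'n \<Rightarrow> complex" where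
  "local_form \<A> c \<eta> vs u = \<eta> (param c u) (map (tvec_of \<A> c (param c u)) vs)"

definition form_differentiable ::
  "('q, 'n::finite) chart set \<Rightarrow> nat \<Rightarrow> ('q, 'n) mform \<Rightarrow> bool" where
  "form_differentiable \<A> k \<eta> \<longleftrightarrow>
     (\<forall>c\<in>\<A>. \<forall>vs. length vs = k \<longrightarrow> local_form \<A> c \<eta> vs differentiable_on target c)"

definition ext_deriv_in ::
  "('q, 'n::finite) chart set \<Rightarrow> ('q, 'n) chart \<Rightarrow> ('q, 'n) mform \<Rightarrow> ('q, 'n) mform" where
  "ext_deriv_in \<A> c \<eta> q ws =
     (\<Sum>i<length ws. (-1) ^ i *
        frechet_derivative (local_form \<A> c \<eta> (map (\<lambda>w. w c) (omit i ws)))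
          (at (coords c q) within target c) ((ws ! i) c))"

text \<open>The exterior derivative is the common value of the coordinate expressions in all charts.\<close>

definition ext_deriv ::
  "('q, 'n::finite) chart set \<Rightarrow> ('q, 'n) mform \<Rightarrow> ('q, 'n) mform" where
  "ext_deriv \<A> \<eta> q ws = (THE z. \<forall>c\<in>\<A>. q \<in> cdom c \<longrightarrow> z = ext_deriv_in \<A> c \<eta> q ws)"

definition form_support ::
  "('q::topological_space, 'n::finite) chart set \<Rightarrow> nat \<Rightarrow> ('q, 'n) mform \<Rightarrow> 'q set" where
  "form_support \<A> k \<eta> =
     closure {q. \<exists>ws. length ws = k \<and> set ws \<subseteq> tangent_space \<A> q \<and> \<eta> q ws \<noteq> 0}"


section \<open>Integration of forms\<close>

text \<open>Integration over the manifold and over its boundary is treated simultaneously: \<open>M\<close> is the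
  domain of integration (the manifold or its boundary), \<open>js\<close> lists the coordinates on \<open>M\<close>, in order,
  and \<open>\<mu>\<close> is the Lebesgue measure in these coordinates. On the boundary the sign of the remaining
  coordinates is again \<open>\<sigma>\<close>, because the omitted first coordinate vector points outward.\<close>

text \<open>Finite families of charts \<open>c i\<close> and continuous functions \<open>p i\<close> on \<open>M\<close>, compactly supported in the
  chart domains, that sum to \<open>1\<close> on the set \<open>K\<close>.\<close>

definition chart_partition ::
  "('q::topological_space, 'n::finite) chart set \<Rightarrow> 'q set \<Rightarrow> 'q set \<Rightarrow> nat \<Rightarrow>
     (nat \<Rightarrow> ('q, 'n) chart) \<Rightarrow> (nat \<Rightarrow> 'q \<Rightarrow> real) \<Rightarrow> bool" where
  "chart_partition \<A> M K N c p \<longleftrightarrow>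
     (\<forall>i<N. c i \<in> \<A> \<and> continuous_on M (p i) \<and> (\<forall>q\<in>M. 0 \<le> p i q) \<and>
        compact (closure {q\<in>M. p i q \<noteq> 0}) \<and> closure {q\<in>M. p i q \<noteq> 0} \<subseteq> cdom (c i)) \<and>
     (\<forall>q\<in>K. (\<Sum>i<N. p i q) = 1)"

definition chart_integrand ::
  "('q, 'n::finite) chart set \<Rightarrow> (('q, 'n) chart \<Rightarrow> 'q \<Rightarrow> real) \<Rightarrow> 'n list \<Rightarrow>
     ('q, 'n) chart \<Rightarrow> ('q \<Rightarrow> real) \<Rightarrow> ('q, 'n) mform \<Rightarrow> real^'n \<Rightarrow> complex" where
  "chart_integrand \<A> \<sigma> js c p \<eta> u = (let q = param c u in
     complex_of_real (\<sigma> c q * p q) * \<eta> q (map (coord_vec \<A> c q) js))"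

definition has_form_integral_over ::
  "('q::topological_space, 'n::finite) chart set \<Rightarrow> (('q, 'n) chart \<Rightarrow> 'q \<Rightarrow> real) \<Rightarrow>
     'q set \<Rightarrow> (real^'n) measure \<Rightarrow> 'n list \<Rightarrow> ('q, 'n) mform \<Rightarrow> complex \<Rightarrow> bool" where
  "has_form_integral_over \<A> \<sigma> M \<mu> js \<eta> I \<longleftrightarrow>
     (let K = M \<inter> form_support \<A> (length js) \<eta> in
       (\<exists>N c p. chart_partition \<A> M K N c p) \<and>
       (\<forall>N c p. chart_partition \<A> M K N c p \<longrightarrow>
          (\<forall>i<N. set_integrable \<mu> (coords (c i) ` (cdom (c i) \<inter> M))
                   (chart_integrand \<A> \<sigma> js (c i) (p i) \<eta>)) \<and>
          I = (\<Sum>i<N. LINT u:coords (c i) ` (cdom (c i) \<inter> M)|\<mu>.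
                   chart_integrand \<A> \<sigma> js (c i) (p i) \<eta> u)))"

text \<open>The \<open>(n - 1)\<close>-dimensional Lebesgue measure on the hyperplane where the first coordinate
  vanishes; for \<open>n = 1\<close> it is the point mass at the origin.\<close>

definition hyperplane_lborel :: "(real^'n::{finite,linorder}) measure" where
  "hyperplane_lborel =
     distr (PiM (UNIV - {first_coord}) (\<lambda>_. lborel)) borel
       (\<lambda>f. \<chi> j. if j = first_coord then 0 else f j)"

definition has_form_integral ::
  "('q::topological_space, 'n::{finite,linorder}) chart set \<Rightarrow>
     (('q, 'n) chart \<Rightarrow> 'q \<Rightarrow> real) \<Rightarrow> ('q, 'n) mform \<Rightarrow> complex \<Rightarrow> bool" where
  "has_form_integral \<A> \<sigma> = has_form_integral_over \<A> \<sigma> UNIV lborel (sorted_list_of_set UNIV)"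

definition has_boundary_integral ::
  "('q::topological_space, 'n::{finite,linorder}) chart set \<Rightarrow>
     (('q, 'n) chart \<Rightarrow> 'q \<Rightarrow> real) \<Rightarrow> ('q, 'n) mform \<Rightarrow> complex \<Rightarrow> bool" where
  "has_boundary_integral \<A> \<sigma> =
     has_form_integral_over \<A> \<sigma> (boundary \<A>) hyperplane_lborel
       (sorted_list_of_set (UNIV - {first_coord}))"

definition form_integral ::
  "('q::topological_space, 'n::{finite,linorder}) chart set \<Rightarrow>
     (('q, 'n) chart \<Rightarrow> 'q \<Rightarrow> real) \<Rightarrow> ('q, 'n) mform \<Rightarrow> complex" where
  "form_integral \<A> \<sigma> \<eta> = (THE I. has_form_integral \<A> \<sigma> \<eta> I)"

definition boundary_integral ::
  "('q::topological_space, 'n::{finite,linorder}) chart set \<Rightarrow>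
     (('q, 'n) chart \<Rightarrow> 'q \<Rightarrow> real) \<Rightarrow> ('q, 'n) mform \<Rightarrow> complex" where
  "boundary_integral \<A> \<sigma> \<eta> = (THE I. has_boundary_integral \<A> \<sigma> \<eta> I)"


section \<open>Nonpure maps and pullback\<close>

definition nonpure_map ::
  "('a::cstar_algebra \<Rightarrow> ennreal) \<Rightarrow> ('q, 'n::finite) chart set \<Rightarrow>
     ('q \<Rightarrow> 'a) \<Rightarrow> ('q \<Rightarrow> ('q, 'n) tvec \<Rightarrow> 'a) \<Rightarrow> bool" where
  "nonpure_map \<tau> \<A> \<rho> V \<longleftrightarrow>
     (\<forall>q. \<rho> q \<in> density_elements \<tau>) \<and>
     (\<forall>c\<in>\<A>. (\<lambda>u. \<rho> (param c u)) differentiable_on target c) \<and>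
     (\<forall>q. \<forall>w\<in>tangent_space \<A> q. \<forall>w'\<in>tangent_space \<A> q. \<forall>r.
        V q (\<lambda>c. r *\<^sub>R w c + w' c) = r *\<^sub>R V q w + V q w') \<and>
     (\<forall>c\<in>\<A>. (\<lambda>(u, v). V (param c u) (tvec_of \<A> c (param c u) v))
        differentiable_on target c \<times> UNIV) \<and>
     (\<forall>c\<in>\<A>.
        let \<rho>c = (\<lambda>u. \<rho> (param c u));
            Vc = (\<lambda>j u. V (param c u) (coord_vec \<A> c (param c u) j))
        in \<forall>u\<in>target c. \<forall>i j.
             partial c \<rho>c u j + comm (Vc j u) (\<rho>c u) = 0 \<and>
             partial c (Vc i) u j - partial c (Vc j) u i = comm (Vc i u) (Vc j u))"

definition pullback ::
  "('a::cstar_algebra \<Rightarrow> ennreal) \<Rightarrow> ('q \<Rightarrow> 'a) \<Rightarrow> ('q \<Rightarrow> ('q, 'n::finite) tvec \<Rightarrow> 'a) \<Rightarrow>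
     ('a list \<Rightarrow> 'a) \<Rightarrow> ('q, 'n) mform" where
  "pullback \<tau> \<rho> V \<omega> q ws = trace_int \<tau> (\<rho> q * \<omega> (map (V q) ws))"

end

theory Submission
  imports Defs
begin

text \<open>The equation for \<open>\<rho>\<close> says that, along a path, \<open>\<rho>\<close> is conjugated by the solution of a linear
  differential equation in the unitization. The trace need not be continuous, but for a density
  element \<open>\<rho>\<close> the functional \<open>a \<mapsto> \<integral>\<rho> a\<close> is positive and hence bounded, uniformly in \<open>\<rho>\<close>; the
  conjugation moves onto \<open>a\<close>, so that \<open>\<integral>\<rho> a\<close> may be differentiated along \<open>Q\<close> with derivative
  \<open>\<integral>\<rho> (da + [V, a])\<close>. The bracket yields the first sum of the Chevalley--Eilenberg differential, and
  flatness of \<open>V\<close> turns the derivatives of the arguments of \<open>\<omega>\<close> into the second one.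

  The pullback is only differentiable, with continuous exterior derivative. Stokes' theorem for
  such forms follows from the divergence theorem on boxes, proved by bisection as for Goursat's
  theorem, and a continuously differentiable partition of unity.\<close>

section \<open>Alternating forms on lists\<close>

text \<open>An expansion of \<open>\<rho>\<close> with a remainder that is small in norm would be of
  no use, since the trace of that remainder need not be small. What is needed is an exact formula
  \<open>(1 + y) r (1 + z)\<close> for a neighbouring state, with \<open>y\<close> and
  \<open>z\<close> small: next to \<open>a\<close> they are measured in norm, and a single fixed
  state occurs. The resulting estimate is uniform in \<open>a\<close>, which is what allows
  \<open>a\<close> to vary with the point.

  The continuity of the exterior derivative of the pullback does not come from second derivatives of
  \<open>V\<close>, which need not exist: that exterior derivative is itself a pullback, and so it
  is again differentiable.

  Form integrals are defined through all continuous partitions of unity at once, whereas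
  \<open>p \<eta>\<close> can be differentiated only if \<open>p\<close> can. One differentiable
  partition yields Stokes' theorem; invariance under changes of charts, inside and along the
  boundary, carries the values over to all other partitions. Boundary integrals are rewritten as
  integrals over slabs of full dimension, so that one change of variables formula covers both
  cases.\<close>

definition alt_form :: "nat \<Rightarrow> ('v::real_vector list \<Rightarrow> 'w::real_vector) \<Rightarrow> bool" where
  "alt_form k f \<longleftrightarrow>
     (\<forall>as i. length as = k \<longrightarrow> i < k \<longrightarrow> linear (\<lambda>a. f (as[i := a]))) \<and>
     (\<forall>as i j. length as = k \<longrightarrow> i < j \<longrightarrow> j < k \<longrightarrow> as ! i = as ! j \<longrightarrow> f as = 0)"

lemma algebra_form_alt_form: "algebra_form k \<omega> \<Longrightarrow> alt_form k \<omega>"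
  by (simp add: algebra_form_def alt_form_def)

lemma alt_form_linear:
  assumes "alt_form k f" "length xs + length ys + 1 = k"
  shows "linear (\<lambda>a. f (xs @ a # ys))"
proof -
  have "linear (\<lambda>a. f ((xs @ 0 # ys)[length xs := a]))"
    using assms(1)[unfolded alt_form_def, THEN conjunct1, rule_format, of "xs @ 0 # ys" "length xs"] assms(2) by simp
  then show ?thesis by simp
qed

lemma alt_form_repeated:
  assumes "alt_form k f" "length as = k" "\<not> distinct as"
  shows "f as = 0"
proof -
  obtain i j where "i < j" "j < k" "as ! i = as ! j"
    using assms(2,3) by (metis distinct_conv_nth linorder_neqE_nat)
  then show ?thesis using assms unfolding alt_form_def by blast
qed

lemma alt_form_swap:
  assumes "alt_form k f" "length xs + length ys + length zs + 2 = k"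
  shows "f (xs @ a # ys @ b # zs) = - f (xs @ b # ys @ a # zs)"
proof -
  have l1: "linear (\<lambda>a. f (xs @ a # ys @ c # zs))" for c
    using alt_form_linear[OF assms(1), of xs "ys @ c # zs"] assms(2) by simp
  have l2: "linear (\<lambda>a. f (xs @ c # ys @ a # zs))" for c
    using alt_form_linear[OF assms(1), of "xs @ c # ys" zs] assms(2) by simp
  have z: "f (xs @ c # ys @ c # zs) = 0" for c
    by (rule alt_form_repeated[OF assms(1)]) (use assms(2) in auto)
  have "0 = f (xs @ (a + b) # ys @ (a + b) # zs)" using z by simp
  also have "\<dots> = f (xs @ a # ys @ a # zs) + f (xs @ a # ys @ b # zs)
      + (f (xs @ b # ys @ a # zs) + f (xs @ b # ys @ b # zs))"
    by (simp add: linear_add[OF l1] linear_add[OF l2])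
  also have "\<dots> = f (xs @ a # ys @ b # zs) + f (xs @ b # ys @ a # zs)" using z by simp
  finally show ?thesis by (metis eq_neg_iff_add_eq_0)
qed

lemma alt_form_move:
  assumes "alt_form k f" "length us + length xs + length ys + 1 = k"
  shows "f (us @ xs @ a # ys) = (-1::real) ^ length xs *\<^sub>R f (us @ a # xs @ ys)"
  using assms(2)
proof (induction xs arbitrary: us)
  case (Cons x xs)
  have "f (us @ (x # xs) @ a # ys) = (-1::real) ^ length xs *\<^sub>R f ((us @ [x]) @ a # xs @ ys)"
    using Cons.IH[of "us @ [x]"] Cons.prems by simp
  also have "f ((us @ [x]) @ a # xs @ ys) = - f (us @ a # x # xs @ ys)"
    using alt_form_swap[OF assms(1), of us "[]" "xs @ ys" x a] Cons.prems by simp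
  finally show ?case by simp
qed simp

text \<open>Only the value 0 is transported along a permutation, so signs of permutations never have
  to be tracked. Each step moves the head of \<open>ys\<close> to its place behind
  \<open>us\<close>; the prefix \<open>us\<close> is there for the induction.\<close>

lemma alt_form_eq_0_mset:
  assumes "alt_form k f" "mset xs = mset ys" "length us + length xs = k" "f (us @ xs) = 0"
  shows "f (us @ ys) = 0"
  using assms(2-)
proof (induction ys arbitrary: us xs)
  case (Cons y ys)
  have "y \<in> set xs" using Cons.prems(1) by (metis list.set_intros(1) set_mset_mset)
  then obtain xs1 xs2 where xs: "xs = xs1 @ y # xs2" by (meson split_list)
  have "f (us @ y # xs1 @ xs2) = 0"
    using alt_form_move[OF assms(1), of us xs1 xs2 y] Cons.prems xs by simp
  then show ?case
    using Cons.IH[of "xs1 @ xs2" "us @ [y]"] Cons.prems xs by auto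
qed simp

text \<open>Multilinearity replaces vectors by axes one at a time from the right: the list consists
  of vectors \<open>ws\<close> not yet expanded followed by axes \<open>js\<close>, and the last
  entry of \<open>ws\<close> is expanded next.\<close>

lemma alt_form_eq_0_axes:
  fixes f :: "(real^'n::finite) list \<Rightarrow> 'w::real_vector"
  assumes f: "alt_form k f" and z: "\<And>js. length js = k \<Longrightarrow> f (map (\<lambda>j. axis j 1) js) = 0"
    and "length vs = k"
  shows "f vs = 0"
proof -
  have "f (ws @ map (\<lambda>j. axis j 1) js) = 0" if "length ws + length js = k" for ws and js :: "'n list"
    using that
  proof (induction ws arbitrary: js rule: rev_induct)
    case Nil
    then show ?case using z by simp
  next
    case (snoc w ws)
    have lin: "linear (\<lambda>a. f (ws @ a # map (\<lambda>j. axis j 1) js))"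
      using snoc.prems by (intro alt_form_linear[OF f]) simp
    have w: "w = (\<Sum>j\<in>UNIV. (w $ j) *\<^sub>R axis j 1)"
      using basis_expansion[of w] by (simp add: scalar_mult_eq_scaleR)
    have "f (ws @ w # map (\<lambda>j. axis j 1) js)
        = f (ws @ (\<Sum>j\<in>UNIV. (w $ j) *\<^sub>R axis j 1) # map (\<lambda>j. axis j 1) js)"
      using w by (rule arg_cong)
    also have "\<dots> = (\<Sum>j\<in>UNIV. (w $ j) *\<^sub>R f (ws @ map (\<lambda>j. axis j 1) (j # js)))"
      by (simp add: linear_sum[OF lin] linear_scale[OF lin])
    also have "\<dots> = 0" using snoc.IH[of "j # js" for j] snoc.prems by (intro sum.neutral) simp
    finally show ?case by simp
  qed
  from this[of vs "[]"] assms(3) show ?thesis by simp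
qed

text \<open>The map \<open>R\<close> and the positions \<open>pos\<close> leave the index type of
  the matrix free, which lets \<open>det_ordered\<close> compute a determinant over another index
  type.\<close>

lemma alt_form_det_rows:
  fixes pos :: "'m::finite \<Rightarrow> nat" and R :: "'v::real_vector \<Rightarrow> real^'m"
  assumes pos: "bij_betw pos UNIV {..<k}" and R: "linear R"
  shows "alt_form k (\<lambda>vs. det (\<chi> s. R (vs ! pos s)))"
  unfolding alt_form_def
proof (intro conjI allI impI)
  have ex: "\<exists>s. pos s = i" if "i < k" for i
    using bij_betw_imp_surj_on[OF pos] that by (metis imageE lessThan_iff)
  have inj: "pos s = pos s' \<longleftrightarrow> s = s'" for s s'
    using bij_betw_imp_inj_on[OF pos] by (auto simp: inj_on_def)
  fix as :: "'v list" and i assume i: "length as = k" "i < k"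
  obtain s0 where s0: "pos s0 = i" using ex[OF i(2)] by blast
  have eq: "det (\<chi> s. R (as[i := a] ! pos s)) = det (\<chi> s. if s = s0 then R a else R (as ! pos s))" for a
    by (rule arg_cong[of _ _ det], subst vec_eq_iff) (use i s0 inj in \<open>auto simp: nth_list_update\<close>)
  show "linear (\<lambda>a. det (\<chi> s. R (as[i := a] ! pos s)))"
    unfolding eq
  proof (rule linearI)
    fix a b :: 'v and r :: real
    show "det (\<chi> s. if s = s0 then R (a + b) else R (as ! pos s))
      = det (\<chi> s. if s = s0 then R a else R (as ! pos s)) + det (\<chi> s. if s = s0 then R b else R (as ! pos s))"
      unfolding linear_add[OF R] by (rule det_row_add)
    show "det (\<chi> s. if s = s0 then R (r *\<^sub>R a) else R (as ! pos s))
      = r *\<^sub>R det (\<chi> s. if s = s0 then R a else R (as ! pos s))"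
      unfolding linear_scale[OF R]
      using det_row_mul[of s0 r "\<lambda>_. R a" "\<lambda>s. R (as ! pos s)", unfolded scalar_mult_eq_scaleR] by simp
  qed
next
  have ex: "\<exists>s. pos s = i" if "i < k" for i
    using bij_betw_imp_surj_on[OF pos] that by (metis imageE lessThan_iff)
  fix as :: "'v list" and i j
  assume *: "length as = k" "i < j" "j < k" "as ! i = as ! j"
  obtain s s' where s: "pos s = i" "pos s' = j" using ex * by (metis less_trans)
  show "det (\<chi> s. R (as ! pos s)) = 0"
    by (rule det_identical_rows[of s s']) (use * s in \<open>auto simp: row_def vec_eq_iff\<close>)
qed

lemma enumeration_position:
  assumes "distinct js" "set js = (UNIV :: 'n::finite set)"
  obtains pos where "bij_betw pos (UNIV :: 'n set) {..<CARD('n)}" "\<And>s. pos s < CARD('n)" "\<And>s. js ! pos s = s"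
    "\<And>i. i < CARD('n) \<Longrightarrow> pos (js ! i) = i"
proof -
  have len: "length js = CARD('n)" using assms by (metis distinct_card)
  have b: "bij_betw ((!) js) {..<CARD('n)} UNIV"
    using bij_betw_nth[OF assms(1), of "{..<CARD('n)}" UNIV] assms(2) len by simp
  define pos where "pos = inv_into {..<CARD('n)} ((!) js)"
  have bp: "bij_betw pos UNIV {..<CARD('n)}" unfolding pos_def by (rule bij_betw_inv_into[OF b])
  show ?thesis
  proof (rule that[OF bp])
    show "pos s < CARD('n)" for s using bij_betwE[OF bp] by auto
    show "js ! pos s = s" for s unfolding pos_def by (rule bij_betw_inv_into_right[OF b]) simp
    show "pos (js ! i) = i" if "i < CARD('n)" for i
      unfolding pos_def by (rule bij_betw_inv_into_left[OF b]) (use that in simp)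
  qed
qed

text \<open>A top form is fixed by its value on one enumeration of the axes: the difference
  \<open>h\<close> between \<open>f\<close> and a multiple of the determinant vanishes there, hence
  on all lists of axes, since a list with a repetition gives 0 and any other one is a
  permutation.\<close>

lemma alt_form_det:
  fixes f :: "(real^'n::finite) list \<Rightarrow> 'w::real_vector" and A :: "real^'n \<Rightarrow> real^'n"
  assumes f: "alt_form CARD('n) f" and js: "distinct js" "set js = (UNIV :: 'n set)" and A: "linear A"
  shows "f (map (\<lambda>j. A (axis j 1)) js) = det (matrix A) *\<^sub>R f (map (\<lambda>j. axis j 1) js)"
proof -
  let ?n = "CARD('n)" and ?e = "\<lambda>j. axis j (1::real) :: real^'n"
  have len: "length js = ?n" using js by (metis distinct_card)
  obtain pos where bij: "bij_betw pos UNIV {..<?n}" and pos: "\<And>s. pos s < ?n" "\<And>s. js ! pos s = s"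
    using enumeration_position[OF js] by metis
  define D where "D vs = det (\<chi> s. vs ! pos s)" for vs :: "(real^'n) list"
  have D: "alt_form ?n D"
    unfolding D_def by (rule alt_form_det_rows[OF bij linear_id[unfolded id_def]])
  define h where "h vs = f vs - D vs *\<^sub>R f (map ?e js)" for vs
  have h: "alt_form ?n h"
    using f D unfolding alt_form_def h_def
    by (auto intro!: linear_compose_sub linear_scale_left simp: linear_iff scaleR_left_distrib scaleR_right_diff_distrib)
  have "D (map ?e js) = det (mat 1 :: real^'n^'n)"
    unfolding D_def using pos len by (intro arg_cong[of _ _ det]) (auto simp: vec_eq_iff mat_def axis_def)
  then have h0: "h (map ?e js) = 0" by (simp add: h_def)
  have "h vs = 0" if "length vs = ?n" for vs
  proof (rule alt_form_eq_0_axes[OF h _ that])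
    fix ks :: "'n list" assume ks: "length ks = ?n"
    show "h (map ?e ks) = 0"
    proof (cases "distinct ks")
      case True
      then have "set ks = UNIV" using ks by (metis card_eq_UNIV_imp_eq_UNIV distinct_card finite_class.finite_UNIV)
      then have "mset js = mset ks" using True js by (metis set_eq_iff_mset_eq_distinct)
      then show ?thesis using alt_form_eq_0_mset[OF h, of "map ?e js" "map ?e ks" "[]"] h0 len by simp
    next
      case False
      then show ?thesis using alt_form_repeated[OF h] ks by (simp add: distinct_map)
    qed
  qed
  from this[of "map (\<lambda>j. A (?e j)) js"] have "f (map (\<lambda>j. A (?e j)) js) = D (map (\<lambda>j. A (?e j)) js) *\<^sub>R f (map ?e js)"
    using len by (simp add: h_def)
  \<comment> \<open>The images of the axes are rows here but columns of
    \<open>matrix A\<close>.\<close>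
  also have "D (map (\<lambda>j. A (?e j)) js) = det (transpose (matrix A))"
    unfolding D_def using pos len
    by (intro arg_cong[of _ _ det]) (auto simp: vec_eq_iff matrix_def transpose_def)
  finally show ?thesis by (simp add: det_transpose)
qed

section \<open>Omitting entries of a list\<close>

lemma length_omit: "i < length xs \<Longrightarrow> length (omit i xs) = length xs - 1"
  by (simp add: omit_def)

lemma map_omit: "map f (omit i xs) = omit i (map f xs)"
  by (simp add: omit_def take_map drop_map)

text \<open>All omissions are read off from one decomposition of the list, which turns index and
  sign bookkeeping into statements about the lengths of \<open>us\<close>, \<open>ms\<close> and
  \<open>ws\<close>.\<close>

lemma omit_pair_decomp:
  assumes "i < j" "j < length xs"
  obtains us ms ws where "xs = us @ (xs ! i) # ms @ (xs ! j) # ws" "length us = i" "length us + length ms + 1 = j"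
    "omit i xs = us @ ms @ (xs ! j) # ws" "omit j xs = us @ (xs ! i) # ms @ ws" "omit i (omit j xs) = us @ ms @ ws"
proof -
  define us ms ws where "us = take i xs" "ms = take (j - i - 1) (drop (Suc i) xs)" "ws = drop (Suc j) xs"
  have 1: "xs = us @ (xs ! i) # drop (Suc i) xs" using assms by (simp add: us_ms_ws_def id_take_nth_drop[symmetric])
  have "drop (Suc i) xs = ms @ drop (Suc i) xs ! (j - i - 1) # drop (Suc (j - i - 1)) (drop (Suc i) xs)"
    unfolding us_ms_ws_def using assms by (intro id_take_nth_drop) simp
  then have "drop (Suc i) xs = ms @ (xs ! j) # ws" using assms by (simp add: us_ms_ws_def)
  with 1 have xs: "xs = us @ (xs ! i) # ms @ (xs ! j) # ws" by simp
  have l: "length us = i" "length us + length ms + 1 = j" using assms by (auto simp: us_ms_ws_def)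
  define a b where "a = xs ! i" "b = xs ! j"
  have xs': "xs = us @ a # ms @ b # ws" using xs by (simp add: a_b_def)
  have "omit i xs = us @ ms @ b # ws" "omit j xs = us @ a # ms @ ws"
    unfolding omit_def xs' using l by auto
  moreover from this have "omit i (omit j xs) = us @ ms @ ws" unfolding omit_def using l by auto
  ultimately show ?thesis using that[OF xs l] by (simp add: a_b_def)
qed

text \<open>If \<open>L w vs\<close> is the product of a one-form at \<open>w\<close> and a form at
  \<open>vs\<close>, this is their wedge product; if it is a derivative in direction
  \<open>w\<close>, this is the exterior derivative. When two arguments agree, only the two terms
  that remove one of them survive. They differ by moving the common entry past \<open>ms\<close>,
  whose length is one less than the distance of the two positions, so they cancel.\<close>

lemma alt_form_wedge:
  fixes L :: "'v::real_vector \<Rightarrow> 'v list \<Rightarrow> 'w::real_vector"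
  assumes L: "\<And>w. alt_form k (L w)" and lin: "\<And>vs. length vs = k \<Longrightarrow> linear (\<lambda>w. L w vs)"
  shows "alt_form (Suc k) (\<lambda>ws. \<Sum>i<length ws. (-1::real) ^ i *\<^sub>R L (ws ! i) (omit i ws))"
  unfolding alt_form_def
proof (intro conjI allI impI)
  fix as :: "'v list" and m assume m: "length as = Suc k" "m < Suc k"
  have 1: "linear (\<lambda>a. L (as[m := a] ! i) (omit i (as[m := a])))" if i: "i < Suc k" for i
  proof (cases "i = m")
    case True
    have "omit m (as[m := a]) = omit m as" for a by (simp add: omit_def)
    then show ?thesis using True m lin[of "omit m as"] by (simp add: length_omit)
  next
    case False
    \<comment> \<open>The position of the entry \<open>m\<close> after the entry \<open>i\<close>
      has been deleted.\<close>
    define m' where "m' = (if m < i then m else m - 1)"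
    have *: "omit i (as[m := a]) = (omit i as)[m' := a]" for a
      using False m i by (auto simp: omit_def m'_def list_update_append drop_update_swap take_update_swap not_less min_def Suc_diff_le list_update_beyond)
    have "linear (\<lambda>a. L (as ! i) ((omit i as)[m' := a]))"
      using L[of "as ! i"] m i False unfolding alt_form_def by (auto simp: length_omit m'_def)
    then show ?thesis using False by (simp add: *)
  qed
  show "linear (\<lambda>a. \<Sum>i<length (as[m := a]). (-1::real) ^ i *\<^sub>R L (as[m := a] ! i) (omit i (as[m := a])))"
    unfolding length_list_update m(1) using 1 by (intro linear_compose_sum ballI linear_compose_scale_right) simp
next
  fix as :: "'v list" and a b assume *: "length as = Suc k" "a < b" "b < Suc k" "as ! a = as ! b"
  let ?t = "\<lambda>i. (-1::real) ^ i *\<^sub>R L (as ! i) (omit i as)"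
  obtain us ms ws where d: "as = us @ (as ! a) # ms @ (as ! b) # ws" "length us = a" "length us + length ms + 1 = b"
    "omit a as = us @ ms @ (as ! b) # ws" "omit b as = us @ (as ! a) # ms @ ws"
    using omit_pair_decomp[of a b as] *(1-3) by metis
  have z: "?t i = 0" if "i < Suc k" "i \<noteq> a" "i \<noteq> b" for i
  proof -
    define a' b' where "a' = (if a < i then a else a - 1)" "b' = (if b < i then b else b - 1)"
    have "a' < b'" "b' < k" "omit i as ! a' = as ! a" "omit i as ! b' = as ! b"
      using that * by (auto simp: a'_b'_def omit_def nth_append)
    then have "L (as ! i) (omit i as) = 0"
      using L[of "as ! i"] * that unfolding alt_form_def by (metis length_omit diff_Suc_1)
    then show ?thesis by simp
  qed
  have len: "length us + length ms + length ws + 1 = k" using arg_cong[OF d(1), of length] *(1) by simp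
  have "(\<Sum>i<length as. ?t i) = (\<Sum>i\<in>{a, b}. ?t i)"
    using * z by (intro sum.mono_neutral_right) auto
  also have "\<dots> = ?t a + ?t b" using * by simp
  also have "L (as ! a) (omit a as) = (-1::real) ^ length ms *\<^sub>R L (as ! b) (us @ as ! b # ms @ ws)"
    using alt_form_move[OF L, of us ms ws "as ! a" "as ! b"] len d *(4) by simp
  finally show "(\<Sum>i<length as. ?t i) = 0"
    unfolding d(5) using *(4) d(2,3)[symmetric] by (simp add: power_add)
qed

section \<open>The state of a density element is bounded\<close>

lemma star_scaleR: "star (r *\<^sub>R a) = r *\<^sub>R star (a :: 'a::cstar_algebra)"
  by (metis complex_cnj_complex_of_real scaleC_of_real star_scaleC)

lemma star_zero [simp]: "star 0 = (0 :: 'a::cstar_algebra)"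
  using star_scaleR[of 0 "0 :: 'a"] by simp

lemma star_minus: "star (- a) = - star (a :: 'a::cstar_algebra)"
  using star_scaleR[of "-1" a] by simp

lemma star_diff: "star (a - b) = star a - star (b :: 'a::cstar_algebra)"
  using star_add[of a "- b"] by (simp add: star_minus)

lemma scaleC_i_scaleC: "(- \<i>) *\<^sub>C (\<i> *\<^sub>C a) = a"
  using scaleC_of_real[of 1 a] by (simp add: scaleC_scaleC)

lemma scaleC_zero: "z *\<^sub>C 0 = 0"
  by (metis add_cancel_right_right scaleC_add_right)

lemma scaleC_diff_right: "z *\<^sub>C (a - b) = z *\<^sub>C a - z *\<^sub>C b"
  by (metis add_diff_cancel diff_add_cancel scaleC_add_right)

lemma scaleC_minus_left: "(- z) *\<^sub>C a = - (z *\<^sub>C a)"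
  using scaleC_scaleC[of "complex_of_real (-1)" z a] scaleC_of_real[of "-1" "z *\<^sub>C a"] by simp

lemma scaleC_scaleR: "z *\<^sub>C (r *\<^sub>R a) = r *\<^sub>R (z *\<^sub>C a)"
  by (simp add: scaleC_of_real[symmetric] scaleC_scaleC mult.commute)

lemma norm_star: "norm (star a) = norm (a :: 'a::cstar_algebra)"
proof -
  have le: "norm b \<le> norm (star b)" for b :: 'a
  proof (cases "b = 0")
    case False
    have "norm b * norm b \<le> norm (star b) * norm b"
      using norm_mult_ineq[of "star b" b] by (simp add: cstar_identity power2_eq_square)
    then show ?thesis using False by simp
  qed simp
  from le[of a] le[of "star a"] show ?thesis by (simp add: star_star)
qed

lemma bounded_linear_star: "bounded_linear star"
  by (rule bounded_linear_intro[of _ 1]) (simp_all add: star_add star_scaleR norm_star)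

lemma positive_star: "positive a \<Longrightarrow> star a = a"
  by (induction rule: positive.induct) (simp_all add: star_mult star_star star_add)

lemma positive_zero: "positive 0"
  using positive.square[of 0] by simp

lemma positive_scaleR:
  assumes "0 \<le> r" "positive a"
  shows "positive (r *\<^sub>R a)"
  using assms(2)
proof (induction rule: positive.induct)
  case (square c)
  have "r *\<^sub>R (star c * c) = star (sqrt r *\<^sub>R c) * (sqrt r *\<^sub>R c)"
    using assms(1) by (simp add: star_scaleR)
  then show ?case using positive.square by metis
qed (simp add: scaleR_add_right positive.add)

text \<open>This is \<open>(1 - y)\<^sup>* a (1 - y)\<close> computed in the unitization.\<close>

lemma positive_conj_one_minus:
  assumes "positive a" shows "positive (a - star y * a - a * y + star y * a * y)"
  using assms
proof (induction rule: positive.induct)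
  case (square c)
  have "star c * c - star y * (star c * c) - star c * c * y + star y * (star c * c) * y
     = star (c - c * y) * (c - c * y)"
    by (simp add: star_mult star_diff algebra_simps)
  then show ?case using positive.square by metis
next
  case (add a b)
  have "(a + b) - star y * (a + b) - (a + b) * y + star y * (a + b) * y
    = (a - star y * a - a * y + star y * a * y) + (b - star y * b - b * y + star y * b * y)"
    by (simp add: algebra_simps)
  then show ?case using add.IH positive.add by metis
qed

text \<open>Makes \<open>trace_int\<close> well defined: taking adjoints changes the sign of the
  \<open>\<i>\<close> part only, which separates the two parts.\<close>

lemma selfadjoint_parts:
  assumes "a1 + \<i> *\<^sub>C b1 = a2 + \<i> *\<^sub>C b2" "star a1 = a1" "star b1 = b1" "star a2 = a2" "star b2 = b2"
  shows "a1 = a2" "b1 = b2"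
proof -
  have "star (a1 + \<i> *\<^sub>C b1) = star (a2 + \<i> *\<^sub>C b2)" using assms(1) by simp
  then have "a1 - \<i> *\<^sub>C b1 = a2 - \<i> *\<^sub>C b2"
    using assms(2-) by (simp add: star_add star_scaleC scaleC_minus_left)
  with assms(1) have "2 *\<^sub>R a1 = 2 *\<^sub>R a2" unfolding scaleR_2 by (metis add.assoc add_diff_cancel_right' diff_add_cancel add.commute)
  then show "a1 = a2" by simp
  with assms(1) have "\<i> *\<^sub>C b1 = \<i> *\<^sub>C b2" by simp
  then show "b1 = b2" by (metis scaleC_i_scaleC)
qed

section \<open>The trace as a linear functional on the elements of finite trace\<close>

locale traced =
  fixes \<tau> :: "'a::cstar_algebra \<Rightarrow> ennreal"
  assumes faithful: "faithful_trace \<tau>"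
begin

abbreviation "tr \<equiv> trace_int \<tau>"
abbreviation "fin \<equiv> finite_trace \<tau>"

lemma tau_add: "positive a \<Longrightarrow> positive b \<Longrightarrow> \<tau> (a + b) = \<tau> a + \<tau> b"
  using faithful by (simp add: faithful_trace_def)

lemma tau_scale: "0 \<le> r \<Longrightarrow> positive a \<Longrightarrow> \<tau> (r *\<^sub>R a) = ennreal r * \<tau> a"
  using faithful by (simp add: faithful_trace_def)

lemma tau_zero: "\<tau> 0 = 0"
  using tau_scale[of 0 0] positive_zero by simp

lemma fin_subspace: "subspace fin"
  using faithful by (simp add: faithful_trace_def)

lemma fin_mult: "a \<in> fin \<Longrightarrow> a * b \<in> fin" "a \<in> fin \<Longrightarrow> b * a \<in> fin"
  using faithful by (auto simp add: faithful_trace_def)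

lemma tr_comm: "a \<in> fin \<Longrightarrow> tr (comm a b) = 0"
  using faithful by (simp add: faithful_trace_def)

lemma fin_add: "a \<in> fin \<Longrightarrow> b \<in> fin \<Longrightarrow> a + b \<in> fin"
  and fin_diff: "a \<in> fin \<Longrightarrow> b \<in> fin \<Longrightarrow> a - b \<in> fin"
  and fin_minus: "a \<in> fin \<Longrightarrow> - a \<in> fin"
  and fin_scale: "a \<in> fin \<Longrightarrow> r *\<^sub>R a \<in> fin"
  using fin_subspace by (auto simp: subspace_add subspace_diff subspace_neg subspace_scale)

lemma tr_decomp:
  assumes "trace_decomp \<tau> a a1 a2 a3 a4"
  shows "tr a = Complex (enn2real (\<tau> a1) - enn2real (\<tau> a2)) (enn2real (\<tau> a3) - enn2real (\<tau> a4))"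
  unfolding trace_int_def
proof (rule the_equality)
  show "\<exists>b1 b2 b3 b4. trace_decomp \<tau> a b1 b2 b3 b4 \<and>
     Complex (enn2real (\<tau> a1) - enn2real (\<tau> a2)) (enn2real (\<tau> a3) - enn2real (\<tau> a4)) =
     Complex (enn2real (\<tau> b1) - enn2real (\<tau> b2)) (enn2real (\<tau> b3) - enn2real (\<tau> b4))"
    using assms by blast
next
  fix z assume "\<exists>b1 b2 b3 b4. trace_decomp \<tau> a b1 b2 b3 b4 \<and>
     z = Complex (enn2real (\<tau> b1) - enn2real (\<tau> b2)) (enn2real (\<tau> b3) - enn2real (\<tau> b4))"
  then obtain b1 b2 b3 b4 where b: "trace_decomp \<tau> a b1 b2 b3 b4"
    "z = Complex (enn2real (\<tau> b1) - enn2real (\<tau> b2)) (enn2real (\<tau> b3) - enn2real (\<tau> b4))" by blast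
  note d = assms[unfolded trace_decomp_def] b(1)[unfolded trace_decomp_def]
  have "a1 - a2 + \<i> *\<^sub>C (a3 - a4) = b1 - b2 + \<i> *\<^sub>C (b3 - b4)" using d by metis
  from selfadjoint_parts[OF this] d have e: "a1 - a2 = b1 - b2" "a3 - a4 = b3 - b4"
    by (simp_all add: star_diff positive_star)
  have *: "enn2real (\<tau> x1) - enn2real (\<tau> x2) = enn2real (\<tau> y1) - enn2real (\<tau> y2)"
    if "\<forall>p\<in>{x1, x2, y1, y2}. positive p \<and> \<tau> p < \<infinity>" "x1 - x2 = y1 - y2" for x1 x2 y1 y2
  proof -
    \<comment> \<open>Additivity of \<open>\<tau>\<close> is available for positive elements only,
      so the subtracted terms are first carried over to the other side.\<close>
    have "x1 + y2 = y1 + x2" using that(2) by (simp add: algebra_simps)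
    then have "\<tau> x1 + \<tau> y2 = \<tau> y1 + \<tau> x2" using that(1) tau_add by (metis insertCI)
    then have "enn2real (\<tau> x1 + \<tau> y2) = enn2real (\<tau> y1 + \<tau> x2)" by simp
    then show ?thesis using that(1) by (simp add: enn2real_plus)
  qed
  show "z = Complex (enn2real (\<tau> a1) - enn2real (\<tau> a2)) (enn2real (\<tau> a3) - enn2real (\<tau> a4))"
    unfolding b(2) using *[OF _ e(1)] *[OF _ e(2)] d by auto
qed

lemma tr_add:
  assumes "a \<in> fin" "b \<in> fin" shows "tr (a + b) = tr a + tr b"
proof -
  obtain a1 a2 a3 a4 where a: "trace_decomp \<tau> a a1 a2 a3 a4" using assms by (auto simp: finite_trace_def)
  obtain b1 b2 b3 b4 where b: "trace_decomp \<tau> b b1 b2 b3 b4" using assms by (auto simp: finite_trace_def)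
  have "trace_decomp \<tau> (a + b) (a1 + b1) (a2 + b2) (a3 + b3) (a4 + b4)"
    using a b unfolding trace_decomp_def
    by (auto simp: tau_add positive.add scaleC_add_right scaleC_diff_right)
  from tr_decomp[OF this] show ?thesis
    using a b unfolding tr_decomp[OF a] tr_decomp[OF b]
    by (simp add: trace_decomp_def tau_add enn2real_plus complex_eq_iff)
qed

lemma tr_minus:
  assumes "a \<in> fin" shows "tr (- a) = - tr a"
proof -
  obtain a1 a2 a3 a4 where a: "trace_decomp \<tau> a a1 a2 a3 a4" using assms by (auto simp: finite_trace_def)
  have "trace_decomp \<tau> (- a) a2 a1 a4 a3"
    using a unfolding trace_decomp_def by (auto simp: scaleC_diff_right)
  from tr_decomp[OF this] show ?thesis unfolding tr_decomp[OF a] by (simp add: complex_eq_iff)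
qed

lemma tr_diff: "a \<in> fin \<Longrightarrow> b \<in> fin \<Longrightarrow> tr (a - b) = tr a - tr b"
  using tr_add[of a "- b"] by (simp add: tr_minus fin_minus)

lemma tr_scale:
  assumes "a \<in> fin" shows "tr (r *\<^sub>R a) = r *\<^sub>R tr a"
proof -
  have *: "tr (r *\<^sub>R a) = r *\<^sub>R tr a" if "0 \<le> r" for r
  proof -
    obtain a1 a2 a3 a4 where a: "trace_decomp \<tau> a a1 a2 a3 a4" using assms by (auto simp: finite_trace_def)
    have "trace_decomp \<tau> (r *\<^sub>R a) (r *\<^sub>R a1) (r *\<^sub>R a2) (r *\<^sub>R a3) (r *\<^sub>R a4)"
      using a that unfolding trace_decomp_def
      by (auto simp: tau_scale positive_scaleR ennreal_mult_less_top scaleR_add_right scaleR_diff_right scaleC_diff_right scaleC_scaleR)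
    from tr_decomp[OF this] show ?thesis
      using a that unfolding tr_decomp[OF a] by (simp add: trace_decomp_def tau_scale enn2real_mult complex_eq_iff algebra_simps)
  qed
  show ?thesis
  proof (cases "0 \<le> r")
    case False
    then have "tr (- ((- r) *\<^sub>R a)) = - ((- r) *\<^sub>R tr a)"
      using * tr_minus[OF fin_scale[OF assms]] by (metis le_minus_iff minus_zero linear)
    then show ?thesis by simp
  qed (rule *)
qed

lemma tr_sum: "(\<And>i. i \<in> I \<Longrightarrow> f i \<in> fin) \<Longrightarrow> tr (sum f I) = (\<Sum>i\<in>I. tr (f i))"
proof -
  have z: "0 \<in> fin" using fin_subspace subspace_0 by auto
  have z': "tr 0 = 0" using tr_scale[OF z, of 0] by simp
  assume "\<And>i. i \<in> I \<Longrightarrow> f i \<in> fin"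
  then show ?thesis
  proof (induction I rule: infinite_finite_induct)
    case (insert x F)
    then have "sum f F \<in> fin" by (intro subspace_sum[OF fin_subspace]) auto
    then show ?case using insert by (simp add: tr_add)
  qed (use z' in auto)
qed

lemma tr_i:
  assumes "a \<in> fin" shows "\<i> *\<^sub>C a \<in> fin" "tr (\<i> *\<^sub>C a) = \<i> * tr a"
proof -
  obtain a1 a2 a3 a4 where a: "trace_decomp \<tau> a a1 a2 a3 a4" using assms by (auto simp: finite_trace_def)
  have "\<i> *\<^sub>C (\<i> *\<^sub>C b) = - b" for b :: 'a
    using scaleC_of_real[of "-1" b] by (simp add: scaleC_scaleC)
  then have d: "trace_decomp \<tau> (\<i> *\<^sub>C a) a4 a3 a1 a2"
    using a unfolding trace_decomp_def by (auto simp: scaleC_add_right)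
  then show "\<i> *\<^sub>C a \<in> fin" by (auto simp: finite_trace_def)
  show "tr (\<i> *\<^sub>C a) = \<i> * tr a" unfolding tr_decomp[OF d] tr_decomp[OF a] by (simp add: complex_eq_iff)
qed

text \<open>The decomposition of \<open>p\<close> provided by \<open>fin\<close> need not be
  \<open>p\<close> itself. Its \<open>\<i>\<close> part vanishes, and \<open>a1 = p + a2\<close>
  bounds \<open>\<tau> a2\<close> by \<open>\<tau> a1\<close>.\<close>

lemma tr_positive:
  assumes "positive p" "p \<in> fin" shows "Im (tr p) = 0" "Re (tr p) \<ge> 0"
proof -
  obtain a1 a2 a3 a4 where a: "trace_decomp \<tau> p a1 a2 a3 a4" using assms by (auto simp: finite_trace_def)
  note d = a[unfolded trace_decomp_def]
  have "p + \<i> *\<^sub>C 0 = a1 - a2 + \<i> *\<^sub>C (a3 - a4)" using d by (simp add: scaleC_zero)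
  from selfadjoint_parts[OF this] d assms have e: "p = a1 - a2" "a3 - a4 = 0"
    by (simp_all add: star_diff positive_star)
  show "Im (tr p) = 0" using e(2) unfolding tr_decomp[OF a] by simp
  have "p + a2 = a1" using e by simp
  then have "\<tau> a1 = \<tau> p + \<tau> a2" using d assms tau_add by (metis insertCI)
  then have "enn2real (\<tau> a2) \<le> enn2real (\<tau> a1)" using d by (intro enn2real_mono) auto
  then show "Re (tr p) \<ge> 0" unfolding tr_decomp[OF a] by simp
qed

lemma tr_commute: "a \<in> fin \<Longrightarrow> tr (a * b) = tr (b * a)"
  using tr_comm[of a b] tr_diff[of "a * b" "b * a"] fin_mult by (simp add: comm_def)

lemma density_fin: "r \<in> density_elements \<tau> \<Longrightarrow> r \<in> fin \<and> tr r = 1 \<and> positive r"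
proof -
  assume "r \<in> density_elements \<tau>"
  then have "trace_decomp \<tau> r r 0 0 0" "positive r" "\<tau> r = 1"
    by (auto simp: density_elements_def trace_decomp_def positive_zero tau_zero scaleC_zero)
  then show ?thesis using tr_decomp[of r r 0 0 0]
    by (auto simp: finite_trace_def tau_zero complex_eq_iff)
qed

end

text \<open>A square root of \<open>1 - a\<close> in the unitization, written as \<open>1 - y\<close>.\<close>

lemma one_minus_root:
  fixes a :: "'a::cstar_algebra"
  assumes "norm a \<le> 1/2" "star a = a"
  obtains y where "star y = y" "a = 2 *\<^sub>R y - y * y"
proof -
  define S where "S = {y::'a. star y = y \<and> norm y \<le> 1/2}"
  have "closed {y::'a. star y = y}"
    by (intro closed_Collect_eq continuous_intros bounded_linear.continuous_on[OF bounded_linear_star])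
  moreover have "S = {y. star y = y} \<inter> cball 0 (1/2)" by (auto simp: S_def)
  ultimately have "closed S" by (simp add: closed_Int)
  then have comp: "complete S" by (simp add: complete_eq_closed)
  \<comment> \<open>A fixed point satisfies \<open>a = 2 y - y^2\<close>. With \<open>norm a\<close>
    and \<open>norm y\<close> at most \<open>1/2\<close> the image has norm at most
    \<open>(1/2 + 1/4) / 2\<close>, and the contraction factor is
    \<open>(1/2 + 1/2) / 2\<close>.\<close>
  let ?f = "\<lambda>y. (1/2) *\<^sub>R (a + y * y)"
  have n2: "norm (y * y) \<le> 1/4" if "y \<in> S" for y
  proof -
    have "norm (y * y) \<le> norm y * norm y" by (rule norm_mult_ineq)
    also have "\<dots> \<le> (1/2) * (1/2)" using that by (intro mult_mono) (auto simp: S_def)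
    finally show ?thesis by simp
  qed
  have "\<exists>!y\<in>S. ?f y = y"
  proof (rule Banach_fix[OF comp, of "1/2"])
    show "S \<noteq> {}" by (auto simp: S_def intro!: exI[of _ 0])
    show "?f ` S \<subseteq> S"
    proof clarify
      fix y assume y: "y \<in> S"
      have "norm (a + y * y) \<le> 1" using norm_triangle_ineq[of a "y * y"] n2[OF y] assms(1) by simp
      then show "?f y \<in> S" using y assms(2) by (auto simp: S_def star_scaleR star_add star_mult)
    qed
    fix x y assume xy: "x \<in> S" "y \<in> S"
    have "?f x - ?f y = (1/2) *\<^sub>R (x * (x - y) + (x - y) * y)" by (simp add: algebra_simps)
    then have "dist (?f x) (?f y) = 1/2 * norm (x * (x - y) + (x - y) * y)" by (simp add: dist_norm)
    also have "norm (x * (x - y) + (x - y) * y) \<le> norm x * norm (x - y) + norm (x - y) * norm y"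
      by (intro norm_triangle_le add_mono norm_mult_ineq)
    also have "\<dots> \<le> (1/2) * norm (x - y) + norm (x - y) * (1/2)"
      using xy by (intro add_mono mult_mono) (auto simp: S_def)
    finally show "dist (?f x) (?f y) \<le> 1/2 * dist x y" by (simp add: dist_norm)
  qed auto
  then obtain y where y: "y \<in> S" "?f y = y" by blast
  have "2 *\<^sub>R ?f y = 2 *\<^sub>R y" using y(2) by simp
  then have "a = 2 *\<^sub>R y - y * y" by (simp add: algebra_simps)
  moreover have "star y = y" using y(1) by (simp add: S_def)
  ultimately show ?thesis using that by blast
qed

context traced
begin

text \<open>For selfadjoint \<open>b\<close> of norm at most \<open>1/2\<close>, write
  \<open>1 - b\<close> as the square of \<open>1 - y\<close> in the unitization. Then
  \<open>(1 - y) r (1 - y)\<close> is positive with trace \<open>1 - tr (r * b)\<close>, so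
  \<open>tr (r * b)\<close> is real and at most 1. The factor 2 arises from scaling \<open>a\<close>
  and \<open>- a\<close> to norm \<open>1/2\<close>.\<close>

lemma state_bound_selfadjoint:
  assumes r: "r \<in> density_elements \<tau>" and a: "star a = a"
  shows "cmod (tr (r * a)) \<le> 2 * norm a"
proof -
  note rr = density_fin[OF r]
  have 1: "Im (tr (r * b)) = 0 \<and> Re (tr (r * b)) \<le> 1" if b: "norm b \<le> 1/2" "star b = b" for b
  proof -
    obtain y where y: "star y = y" "b = 2 *\<^sub>R y - y * y" using one_minus_root[OF b] by blast
    let ?p = "r - star y * r - r * y + star y * r * y"
    have ry: "r * y \<in> fin" "y * r \<in> fin" "y * r * y \<in> fin" "r * y * y \<in> fin"
      using rr fin_mult by blast+
    have p: "positive ?p" using rr positive_conj_one_minus by blast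
    have pf: "?p \<in> fin" using rr y(1) ry by (auto intro!: fin_add fin_diff)
    have c: "tr (y * r) = tr (r * y)" "tr (y * r * y) = tr (r * y * y)"
      using tr_commute[of r y] tr_commute[of "y * r" y] tr_commute[OF ry(1), of y] rr ry by (simp_all add: mult.assoc)
    have "tr ?p = 1 - tr (r * y) - tr (r * y) + tr (r * y * y)"
      using rr ry c y(1) by (simp add: tr_add tr_diff fin_diff)
    also have "\<dots> = 1 - tr (r * b)"
    proof -
      have "r * b = r * y + r * y - r * y * y"
        unfolding y(2) by (simp add: right_diff_distrib distrib_left scaleR_2 mult.assoc)
      then show ?thesis using ry by (simp add: tr_add tr_diff fin_add)
    qed
    finally have "tr ?p = 1 - tr (r * b)" .
    then show ?thesis using tr_positive[OF p pf] by simp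
  qed
  show ?thesis
  proof (cases "a = 0")
    case False
    define c where "c = 1 / (2 * norm a)"
    have c: "c > 0" using False by (simp add: c_def)
    have n: "norm (c *\<^sub>R a) \<le> 1/2" "norm ((-c) *\<^sub>R a) \<le> 1/2" using False by (auto simp: c_def)
    have f: "r * a \<in> fin" using rr fin_mult by blast
    have "Im (tr (r * a)) = 0 \<and> c * Re (tr (r * a)) \<le> 1 \<and> - c * Re (tr (r * a)) \<le> 1"
      using 1[OF n(1)] 1[OF n(2)] a c f by (auto simp: star_scaleR star_minus tr_scale tr_minus fin_scale)
    then have "Im (tr (r * a)) = 0 \<and> c * \<bar>Re (tr (r * a))\<bar> \<le> 1" using c by (auto simp: abs_if)
    then have "c * cmod (tr (r * a)) \<le> 1" by (simp add: cmod_def)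
    then show ?thesis using False by (simp add: c_def field_simps)
  next
    case True
    then show ?thesis using tr_scale[of r 0] rr by simp
  qed
qed

text \<open>The selfadjoint bound is used once for the real and once for the imaginary part of
  \<open>a\<close>. What counts is that the constant is the same for all density elements.\<close>

lemma state_bound:
  assumes r: "r \<in> density_elements \<tau>"
  shows "cmod (tr (r * a)) \<le> 4 * norm a"
proof -
  define x y where "x = (1/2) *\<^sub>R (a + star a)" and "y = (1/2) *\<^sub>R ((- \<i>) *\<^sub>C (a - star a))"
  have "\<i> *\<^sub>C (- \<i>) *\<^sub>C b = b" for b :: 'a using scaleC_of_real[of 1 b] by (simp add: scaleC_scaleC)
  then have "\<i> *\<^sub>C y = (1/2) *\<^sub>R (a - star a)"
    unfolding y_def by (metis (no_types, lifting) scaleC_of_real scaleC_scaleC mult.commute)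
  then have "x + \<i> *\<^sub>C y = (1/2 + 1/2) *\<^sub>R a"
    unfolding x_def by (simp only: scaleR_add_right scaleR_diff_right scaleR_add_left) simp
  then have a: "a = x + \<i> *\<^sub>C y" by simp
  have x: "star x = x" by (simp add: x_def star_scaleR star_add star_star add.commute)
  have y: "star y = y"
    by (simp add: y_def star_scaleR star_diff star_scaleC star_star scaleC_minus_left scaleC_diff_right)
  have nx: "norm x \<le> norm a" using norm_triangle_ineq[of a "star a"] by (simp add: x_def norm_star)
  have ny: "norm y \<le> norm a" using norm_triangle_ineq4[of a "star a"] by (simp add: y_def norm_star norm_scaleC)
  have f: "r * x \<in> fin" "r * y \<in> fin" using density_fin[OF r] fin_mult by blast+
  have "r * a = r * x + \<i> *\<^sub>C (r * y)" unfolding a by (simp add: distrib_left scaleC_mult_right)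
  then have "tr (r * a) = tr (r * x) + \<i> * tr (r * y)" using f tr_i by (simp add: tr_add)
  then have "cmod (tr (r * a)) \<le> cmod (tr (r * x)) + cmod (tr (r * y))"
    by (metis norm_triangle_ineq norm_mult norm_ii mult_1)
  then show ?thesis using state_bound_selfadjoint[OF r x] state_bound_selfadjoint[OF r y] nx ny by simp
qed

end

section \<open>Differentiating a state along a nonpure map\<close>

text \<open>The Picard iteration is a contraction because of the bound \<open>1/2\<close> on the coefficient.\<close>

lemma linear_ode:
  fixes v :: "real \<Rightarrow> 'a::banach" and B :: "'a \<Rightarrow> 'a \<Rightarrow> 'a"
  assumes B: "bounded_bilinear B" "\<And>x y. norm (B x y) \<le> norm x * norm y"
    and v: "continuous_on {0..1} v" "\<And>t. t \<in> {0..1} \<Longrightarrow> norm (v t) \<le> m" and m: "m \<le> 1/2"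
  obtains Y where "Y 0 = 0"
    "\<And>t. t \<in> {0..1} \<Longrightarrow> (Y has_vector_derivative (v t + B (Y t) (v t))) (at t within {0..1})"
    "\<And>t. t \<in> {0..1} \<Longrightarrow> norm (Y t) \<le> 2 * m"
proof -
  interpret B: bounded_bilinear B by (rule B)
  \<comment> \<open>The iteration acts on bounded continuous functions on the whole line;
    \<open>clamp\<close> freezes the values outside \<open>{0..1}\<close>, which makes
    \<open>G\<close> below a self-map of a complete space.\<close>
  define F where "F Y t = integral {0..t} (\<lambda>s. v s + B (apply_bcontfun Y s) (v s))" for Y :: "real \<Rightarrow>\<^sub>C 'a" and t
  have cont: "continuous_on {0..1} (\<lambda>s. v s + B (apply_bcontfun Y s) (v s))" for Y
    by (intro continuous_intros v B.continuous_on) auto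
  have F': "(F Y has_vector_derivative (v t + B (apply_bcontfun Y t) (v t))) (at t within {0..1})"
    if "t \<in> {0..1}" for Y t
    unfolding F_def by (rule integral_has_vector_derivative[OF cont that])
  then have "continuous_on (cbox 0 1) (F Y)" for Y
    using continuous_on_vector_derivative[OF F'] by (metis box_real(2))
  then have "\<exists>G :: real \<Rightarrow>\<^sub>C 'a. \<forall>t. apply_bcontfun G t = F Y (clamp 0 1 t)" for Y
    by (rule continuous_on_cbox_bcontfunE) blast
  then obtain G :: "(real \<Rightarrow>\<^sub>C 'a) \<Rightarrow> real \<Rightarrow>\<^sub>C 'a" where G: "apply_bcontfun (G Y) t = F Y (clamp 0 1 t)" for Y t
    by metis
  have cl: "clamp 0 1 t \<in> {0..1}" for t :: real using clamp_in_interval[of "0::real" 1 t] by simp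
  have m0: "0 \<le> m" using order_trans[OF norm_ge_zero v(2)[of 0]] by simp
  have lip: "dist (G Y) (G Z) \<le> 1/2 * dist Y Z" for Y Z
  proof (rule dist_bound)
    fix t' :: real
    define t where "t = clamp 0 1 t'"
    have t: "t \<in> {0..1}" unfolding t_def by (rule cl)
    have sub: "{0..t} \<subseteq> {0..1}" using t by auto
    have c: "continuous_on {0..t} (\<lambda>s. v s + B (apply_bcontfun Y s) (v s))" for Y
      using cont sub continuous_on_subset by blast
    have "F Y t - F Z t = integral {0..t} (\<lambda>s. (v s + B (apply_bcontfun Y s) (v s)) - (v s + B (apply_bcontfun Z s) (v s)))"
      unfolding F_def by (intro integral_diff[symmetric] integrable_continuous_real c)
    also have "\<dots> = integral {0..t} (\<lambda>s. B (apply_bcontfun Y s - apply_bcontfun Z s) (v s))"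
      by (simp add: B.diff_left)
    also have "norm \<dots> \<le> (1/2 * dist Y Z) * (t - 0)"
    proof (rule integral_bound)
      show "continuous_on {0..t} (\<lambda>s. B (apply_bcontfun Y s - apply_bcontfun Z s) (v s))"
        by (intro B.continuous_on continuous_intros continuous_on_subset[OF v(1) sub]) auto
      fix s assume s: "s \<in> {0..t}"
      have "norm (B (apply_bcontfun Y s - apply_bcontfun Z s) (v s)) \<le> dist Y Z * (1/2)"
        using s sub v(2)[of s] m dist_bounded[of Y s Z]
        by (intro order_trans[OF B(2)] mult_mono) (auto simp: dist_norm)
      then show "norm (B (apply_bcontfun Y s - apply_bcontfun Z s) (v s)) \<le> 1/2 * dist Y Z" by simp
    qed (use t in auto)
    also have "\<dots> \<le> 1/2 * dist Y Z" using t by (intro mult_left_le) auto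
    finally show "dist (apply_bcontfun (G Y) t') (apply_bcontfun (G Z) t') \<le> 1/2 * dist Y Z"
      by (simp add: G dist_norm t_def)
  qed
  obtain Y where Y: "G Y = Y" using banach_fix_type[of "1/2" G] lip by auto
  have FY: "apply_bcontfun Y t = F Y t" if "t \<in> {0..1}" for t
    using G[of Y t] that Y by simp
  \<comment> \<open>Together with \<open>lip\<close>, \<open>dist Y 0\<close> is at most
    \<open>m\<close> plus half of itself, whence the bound \<open>2 * m\<close> on the
    solution.\<close>
  have "dist (G 0) 0 \<le> m"
  proof (rule dist_bound)
    fix t' :: real
    define t where "t = clamp 0 1 t'"
    have t: "t \<in> {0..1}" unfolding t_def by (rule cl)
    have sub: "{0..t} \<subseteq> {0..1}" using t by auto
    have "norm (F 0 t) \<le> m * (t - 0)"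
      unfolding F_def using t sub by (intro integral_bound continuous_on_subset[OF cont sub]) (auto simp: B.zero_left v(2))
    also have "\<dots> \<le> m" using t m0 by (simp add: mult_left_le)
    finally show "dist (apply_bcontfun (G 0) t') (apply_bcontfun 0 t') \<le> m" by (simp add: G t_def)
  qed
  then have "dist Y 0 \<le> 2 * m"
    using lip[of Y 0] dist_triangle[of Y 0 "G 0"] by (simp add: Y)
  then have "norm (apply_bcontfun Y t) \<le> 2 * m" for t
    using dist_bounded[of Y t 0] by simp
  moreover have "apply_bcontfun Y 0 = 0" using FY[of 0] by (simp add: F_def)
  moreover have "(apply_bcontfun Y has_vector_derivative (v t + B (apply_bcontfun Y t) (v t))) (at t within {0..1})"
    if "t \<in> {0..1}" for t
    by (rule has_vector_derivative_transform[OF that _ F'[OF that]]) (simp add: FY)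
  ultimately show ?thesis using that by blast
qed

lemma increment_near_constant_velocity:
  fixes W :: "real \<Rightarrow> 'a::banach"
  assumes "\<And>t. t \<in> {0..1} \<Longrightarrow> (W has_vector_derivative W' t) (at t within {0..1})"
    and "\<And>t. t \<in> {0..1} \<Longrightarrow> norm (W' t - w) \<le> c"
  shows "norm (W 1 - W 0 - w) \<le> c"
proof -
  have "((\<lambda>t. W' t - w) has_integral ((W 1 - 1 *\<^sub>R w) - (W 0 - 0 *\<^sub>R w))) {0..1}"
    using assms(1) by (intro fundamental_theorem_of_calculus) (auto intro!: derivative_eq_intros)
  moreover have "0 \<le> c" using assms(2)[of 0] order_trans[OF norm_ge_zero] by auto
  ultimately have "norm ((W 1 - 1 *\<^sub>R w) - (W 0 - 0 *\<^sub>R w)) \<le> c * measure lborel {0..1::real}"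
    using assms(2) has_integral_bound[of c "\<lambda>t. W' t - w" _ 0 1] by (metis box_real(2))
  then show ?thesis by (simp add: algebra_simps)
qed

text \<open>In the unitization, \<open>1 + Y\<close> and \<open>1 + Z\<close> solve
  \<open>(1 + Y)' = - (1 + Y) w\<close> and \<open>(1 + Z)' = w (1 + Z)\<close>; then
  \<open>(1 + Y) r (1 + Z)\<close> is constant, because the derivative of \<open>r\<close> is the
  commutator \<open>w r - r w\<close>. The term \<open>2 * m\<^sup>2\<close> bounds the products
  \<open>Y w\<close> and \<open>w Z\<close>, in which \<open>Y\<close> and \<open>Z\<close> have
  norm at most \<open>2 * m\<close>.\<close>

lemma commutator_flow_conjugation:
  fixes r w :: "real \<Rightarrow> 'a::{real_normed_algebra,banach}"
  assumes r: "\<And>t. t \<in> {0..1} \<Longrightarrow> (r has_vector_derivative (w t * r t - r t * w t)) (at t within {0..1})"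
    and w: "continuous_on {0..1} w" "\<And>t. t \<in> {0..1} \<Longrightarrow> norm (w t) \<le> m" "\<And>t. t \<in> {0..1} \<Longrightarrow> norm (w t - w0) \<le> e"
    and m: "m \<le> 1/2"
  obtains y z where "r 0 = r 1 + y * r 1 + r 1 * z + y * r 1 * z"
    "norm (y + w0) \<le> e + 2 * m\<^sup>2" "norm (z - w0) \<le> e + 2 * m\<^sup>2" "norm y \<le> 2 * m" "norm z \<le> 2 * m"
proof -
  have m0: "0 \<le> m" using w(2)[of 0] order_trans[OF norm_ge_zero] by auto
  obtain Y where Y: "Y 0 = 0"
    "\<And>t. t \<in> {0..1} \<Longrightarrow> (Y has_vector_derivative (- w t + Y t * (- w t))) (at t within {0..1})"
    "\<And>t. t \<in> {0..1} \<Longrightarrow> norm (Y t) \<le> 2 * m"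
    using linear_ode[OF bounded_bilinear_mult norm_mult_ineq, of "\<lambda>t. - w t" m] w m
    by (auto intro: continuous_on_minus)
  obtain Z where Z: "Z 0 = 0"
    "\<And>t. t \<in> {0..1} \<Longrightarrow> (Z has_vector_derivative (w t + w t * Z t)) (at t within {0..1})"
    "\<And>t. t \<in> {0..1} \<Longrightarrow> norm (Z t) \<le> 2 * m"
  proof (rule linear_ode[of "\<lambda>x y. y * x" w m])
    show "bounded_bilinear (\<lambda>x y. y * x :: 'a)" by (rule bounded_bilinear.flip[OF bounded_bilinear_mult])
    show "norm (y * x) \<le> norm x * norm y" for x y :: 'a by (metis norm_mult_ineq mult.commute)
  qed (use w m in auto)
  define P where "P t = r t + Y t * r t + r t * Z t + Y t * r t * Z t" for t
  have "(P has_vector_derivative 0) (at t within {0..1})" if t: "t \<in> {0..1}" for t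
  proof -
    note [derivative_intros] = r[OF t] Y(2)[OF t] Z(2)[OF t]
    show ?thesis
      unfolding P_def by (rule derivative_eq_intros refl)+ (simp add: algebra_simps)
  qed
  then have "P 1 = P 0"
    using has_vector_derivative_zero_constant[of "{0..1}" P] by (metis atLeastAtMost_iff convex_real_interval(5) order_refl zero_le_one)
  then have eq: "r 0 = r 1 + Y 1 * r 1 + r 1 * Z 1 + Y 1 * r 1 * Z 1" by (simp add: P_def Y(1) Z(1))
  have prod: "norm (a * b) \<le> 2 * m\<^sup>2" if "norm a \<le> m \<and> norm b \<le> 2 * m \<or> norm a \<le> 2 * m \<and> norm b \<le> m" for a b :: 'a
  proof -
    have "norm a * norm b \<le> 2 * m\<^sup>2"
      using that mult_mono[of "norm a" m "norm b" "2 * m"] mult_mono[of "norm a" "2 * m" "norm b" m] m0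
      by (auto simp: power2_eq_square)
    then show ?thesis using norm_mult_ineq order_trans by blast
  qed
  have "norm (Y 1 - Y 0 - (- w0)) \<le> e + 2 * m\<^sup>2"
  proof (rule increment_near_constant_velocity[OF Y(2)])
    fix t :: real assume t: "t \<in> {0..1}"
    have "norm (- w t + Y t * (- w t) - (- w0)) = norm ((w t - w0) + Y t * w t)"
      by (subst norm_minus_cancel[symmetric]) (simp add: algebra_simps)
    also have "\<dots> \<le> e + 2 * m\<^sup>2"
      using w(2,3)[OF t] Y(3)[OF t] by (intro norm_triangle_le add_mono prod) auto
    finally show "norm (- w t + Y t * (- w t) - (- w0)) \<le> e + 2 * m\<^sup>2" .
  qed
  moreover have "norm (Z 1 - Z 0 - w0) \<le> e + 2 * m\<^sup>2"
  proof (rule increment_near_constant_velocity[OF Z(2)])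
    fix t :: real assume t: "t \<in> {0..1}"
    have "norm (w t + w t * Z t - w0) = norm ((w t - w0) + w t * Z t)" by (simp add: algebra_simps)
    also have "\<dots> \<le> e + 2 * m\<^sup>2"
      using w(2,3)[OF t] Z(3)[OF t] by (intro norm_triangle_le add_mono prod) auto
    finally show "norm (w t + w t * Z t - w0) \<le> e + 2 * m\<^sup>2" .
  qed
  ultimately show ?thesis using that[OF eq] Y(1,3) Z(1,3) by simp
qed

context traced
begin

text \<open>Since \<open>y\<close> is close to \<open>- w0\<close> and \<open>z\<close> to
  \<open>w0\<close>, the first-order terms \<open>z b + b y\<close> amount to the commutator of
  \<open>w0\<close> and \<open>b\<close>. After cyclic permutation only the state \<open>r 1\<close>
  occurs in the error. The \<open>8 * m\<^sup>2\<close> consists of \<open>2 * m\<^sup>2\<close> for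
  each of these two approximations and \<open>4 * m\<^sup>2\<close> for the product
  \<open>z b y\<close>.\<close>

lemma state_increment:
  assumes r: "\<And>t. t \<in> {0..1} \<Longrightarrow> (r has_vector_derivative (w t * r t - r t * w t)) (at t within {0..1})"
    and w: "continuous_on {0..1} w" "\<And>t. t \<in> {0..1} \<Longrightarrow> norm (w t) \<le> m" "\<And>t. t \<in> {0..1} \<Longrightarrow> norm (w t - w0) \<le> e"
    and m: "m \<le> 1/2" and d: "r 1 \<in> density_elements \<tau>"
  shows "cmod (tr (r 0 * b) - tr (r 1 * b) - tr (r 1 * comm w0 b)) \<le> 4 * norm b * (2 * e + 8 * m\<^sup>2)"
proof -
  obtain y z where eq: "r 0 = r 1 + y * r 1 + r 1 * z + y * r 1 * z"
    and b: "norm (y + w0) \<le> e + 2 * m\<^sup>2" "norm (z - w0) \<le> e + 2 * m\<^sup>2" "norm y \<le> 2 * m" "norm z \<le> 2 * m"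
    by (rule commutator_flow_conjugation[OF r w m])
  have f: "r 1 \<in> fin" using density_fin[OF d] by blast
  then have ff: "r 1 * c \<in> fin" "c * r 1 * c' \<in> fin" "c * r 1 \<in> fin" "r 1 * c * c' \<in> fin" for c c' using fin_mult by blast+
  have t1: "tr (y * r 1 * b) = tr (r 1 * (b * y))" using tr_commute[of "r 1 * b" y] ff by (simp add: mult.assoc)
  have t2: "tr (y * r 1 * z * b) = tr (r 1 * (z * b * y))" using tr_commute[of "r 1 * (z * b)" y] ff by (simp add: mult.assoc)
  have "tr (r 0 * b) = tr (r 1 * b) + tr (y * r 1 * b) + tr (r 1 * z * b) + tr (y * r 1 * z * b)"
    unfolding eq using f by (simp add: distrib_right tr_add fin_add fin_mult)
  also have "\<dots> = tr (r 1 * b) + tr (r 1 * (b * y)) + tr (r 1 * (z * b)) + tr (r 1 * (z * b * y))"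
    by (simp only: t1 t2) (simp add: mult.assoc)
  finally have "tr (r 0 * b) - tr (r 1 * b) - tr (r 1 * comm w0 b)
    = tr (r 1 * ((z - w0) * b + b * (y + w0) + z * b * y))"
    using ff by (simp add: comm_def algebra_simps tr_add tr_diff fin_add fin_diff)
  also have "cmod \<dots> \<le> 4 * norm ((z - w0) * b + b * (y + w0) + z * b * y)" by (rule state_bound[OF d])
  also have "norm ((z - w0) * b + b * (y + w0) + z * b * y)
     \<le> (e + 2 * m\<^sup>2) * norm b + norm b * (e + 2 * m\<^sup>2) + (2 * m * norm b) * (2 * m)"
  proof (intro norm_triangle_le add_mono)
    show "norm ((z - w0) * b) \<le> (e + 2 * m\<^sup>2) * norm b"
      by (rule order_trans[OF norm_mult_ineq]) (intro mult_right_mono b norm_ge_zero)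
    show "norm (b * (y + w0)) \<le> norm b * (e + 2 * m\<^sup>2)"
      by (rule order_trans[OF norm_mult_ineq]) (intro mult_left_mono b norm_ge_zero)
    have m0: "0 \<le> 2 * m" using b(3) norm_ge_zero order_trans by blast
    have "norm (z * b) \<le> 2 * m * norm b"
      by (rule order_trans[OF norm_mult_ineq]) (intro mult_right_mono b norm_ge_zero)
    then show "norm (z * b * y) \<le> 2 * m * norm b * (2 * m)"
      using m0 by (intro order_trans[OF norm_mult_ineq] mult_mono b) auto
  qed
  finally show ?thesis by (simp add: algebra_simps power2_eq_square)
qed

text \<open>The radius does not depend on \<open>b\<close> and the error is proportional to
  \<open>norm b\<close>; \<open>tr_has_derivative\<close> relies on this to insert a
  \<open>b\<close> that moves with \<open>u\<close>.\<close>

lemma state_increment_along: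
  fixes r :: "'e::euclidean_space \<Rightarrow> 'a" and L :: "'e \<Rightarrow> 'e \<Rightarrow> 'a"
  assumes S: "convex S" "x \<in> S"
    and dens: "\<And>u. u \<in> S \<Longrightarrow> r u \<in> density_elements \<tau>"
    and lin: "\<And>u. u \<in> S \<Longrightarrow> linear (L u)" and cont: "\<And>h. continuous_on S (\<lambda>u. L u h)"
    and der: "\<And>u. u \<in> S \<Longrightarrow> (r has_derivative (\<lambda>h. r u * L u h - L u h * r u)) (at u within S)"
    and e: "e > 0"
  shows "\<exists>d>0. \<forall>u\<in>S. norm (u - x) < d \<longrightarrow>
    (\<forall>b. cmod (tr (r u * b) - tr (r x * b) - tr (r x * comm (L x (u - x)) b)) \<le> e * norm (u - x) * norm b)"
proof -
  \<comment> \<open>The variation of \<open>L\<close> along the segment contributes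
    \<open>8 * c\<close>, and so does the quadratic term once \<open>K\<^sup>2 * norm h\<close> is
    at most \<open>c / 4\<close>.\<close>
  define c where "c = e / 16"
  have c: "c > 0" using e by (simp add: c_def)
  \<comment> \<open>The extra \<open>c\<close> makes the bound valid not only at \<open>x\<close>
    but for all nearby \<open>u\<close>, and keeps \<open>K\<close> positive.\<close>
  define K where "K = (\<Sum>i\<in>Basis. norm (L x i)) + c"
  have K: "K > 0" unfolding K_def using c by (intro add_nonneg_pos sum_nonneg) auto
  have Leq: "L u h = (\<Sum>i\<in>Basis. (h \<bullet> i) *\<^sub>R L u i)" if "u \<in> S" for u h
    using linear_sum[OF lin[OF that], of "\<lambda>i. (h \<bullet> i) *\<^sub>R i" Basis] linear_scale[OF lin[OF that]]
    by (simp add: euclidean_representation)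
  have "((\<lambda>u. \<Sum>i\<in>Basis. norm (L u i - L x i)) \<longlongrightarrow> (\<Sum>i\<in>Basis. norm (L x i - L x i))) (at x within S)"
    by (intro tendsto_intros) (use cont S in \<open>auto simp: continuous_on_def\<close>)
  then have "eventually (\<lambda>u. (\<Sum>i\<in>Basis. norm (L u i - L x i)) < c) (at x within S)"
    using c by (elim order_tendstoD(2)) simp
  then obtain d1 where d1: "d1 > 0" "\<And>u. u \<in> S \<Longrightarrow> norm (u - x) < d1 \<Longrightarrow> (\<Sum>i\<in>Basis. norm (L u i - L x i)) < c"
  proof -
    assume a: "\<And>d1. 0 < d1 \<Longrightarrow> (\<And>u. u \<in> S \<Longrightarrow> norm (u - x) < d1 \<Longrightarrow> (\<Sum>i\<in>Basis. norm (L u i - L x i)) < c) \<Longrightarrow> thesis"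
    from \<open>eventually _ _\<close> obtain d1 where "d1 > 0"
      "\<And>u. u \<in> S \<Longrightarrow> u \<noteq> x \<Longrightarrow> dist u x < d1 \<Longrightarrow> (\<Sum>i\<in>Basis. norm (L u i - L x i)) < c"
      unfolding eventually_at by blast
    then show thesis
      using c by (intro a[of d1]) (simp, case_tac "u = x", auto simp: dist_norm)
  qed
  \<comment> \<open>In turn, this ensures that \<open>L\<close> varies by at most \<open>c\<close>,
    that the velocity bound \<open>K * norm h\<close> is at most \<open>1/2\<close>, and that the
    quadratic term is small.\<close>
  define d where "d = min d1 (min (1 / (2 * K)) (c / (4 * K\<^sup>2)))"
  have d: "d > 0" using d1 K c by (simp add: d_def)
  have coord: "norm (L u h - L x h) \<le> c * norm h" if "u \<in> S" "norm (u - x) < d" for u h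
  proof -
    have "L u h - L x h = (\<Sum>i\<in>Basis. (h \<bullet> i) *\<^sub>R (L u i - L x i))"
      by (subst (1 2) Leq) (use S that in \<open>auto simp: scaleR_diff_right sum_subtractf\<close>)
    also have "norm \<dots> \<le> (\<Sum>i\<in>Basis. norm h * norm (L u i - L x i))"
      by (intro order_trans[OF norm_sum] sum_mono) (simp add: Basis_le_norm mult_right_mono)
    also have "\<dots> = norm h * (\<Sum>i\<in>Basis. norm (L u i - L x i))" by (simp add: sum_distrib_left)
    also have "\<dots> \<le> norm h * c" using d1(2)[OF that(1)] that(2) by (intro mult_left_mono) (auto simp: d_def)
    finally show ?thesis by (simp add: mult.commute)
  qed
  have bound: "norm (L u h) \<le> K * norm h" if "u \<in> S" "norm (u - x) < d" for u h
  proof -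
    have "norm (L x h) \<le> (\<Sum>i\<in>Basis. norm h * norm (L x i))"
      by (subst Leq[OF S(2)]) (intro order_trans[OF norm_sum] sum_mono, simp add: Basis_le_norm mult_right_mono)
    also have "\<dots> = norm h * (\<Sum>i\<in>Basis. norm (L x i))" by (simp add: sum_distrib_left)
    finally have "norm (L x h) \<le> (\<Sum>i\<in>Basis. norm (L x i)) * norm h" by (simp add: mult.commute)
    moreover have "norm (L u h) \<le> norm (L u h - L x h) + norm (L x h)" by (metis diff_add_cancel norm_triangle_ineq)
    ultimately show ?thesis using coord[OF that, of h] by (simp add: K_def distrib_right)
  qed
  have "cmod (tr (r u * b) - tr (r x * b) - tr (r x * comm (L x (u - x)) b)) \<le> e * norm (u - x) * norm b"
    if u: "u \<in> S" "norm (u - x) < d" for u b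
  proof -
    define h where "h = u - x"
    \<comment> \<open>The segment runs from \<open>u\<close> at time 0 back to \<open>x\<close> at
      time 1, so that the state left in the estimate is the fixed one at \<open>x\<close>. The
      reversal also gives the equation the sign required by \<open>state_increment\<close>.\<close>
    define p where "p t = x + (1 - t) *\<^sub>R h" for t :: real
    have p: "p t \<in> S \<and> norm (p t - x) < d" if "t \<in> {0..1}" for t
    proof
      have "p t = (1 - t) *\<^sub>R u + t *\<^sub>R x" by (simp add: p_def h_def algebra_simps)
      then show "p t \<in> S" using S u(1) that by (simp add: convexD_alt)
      have "norm (p t - x) = (1 - t) * norm h" using that by (simp add: p_def)
      also have "\<dots> \<le> 1 * norm h" using that by (intro mult_right_mono) auto
      finally show "norm (p t - x) < d" using u by (simp add: h_def)
    qed
    have "cmod (tr (r (p 0) * b) - tr (r (p 1) * b) - tr (r (p 1) * comm (L x h) b))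
       \<le> 4 * norm b * (2 * (c * norm h) + 8 * (K * norm h)\<^sup>2)"
    proof (rule state_increment[where w = "\<lambda>t. L (p t) h" and r = "\<lambda>t. r (p t)"])
      fix t :: real assume t: "t \<in> {0..1}"
      have "(p has_derivative (\<lambda>s. (- s) *\<^sub>R h)) (at t within {0..1})"
        unfolding p_def by (rule derivative_eq_intros refl)+ simp
      moreover have "p ` {0..1} \<subseteq> S" using p by auto
      ultimately have "(r \<circ> p has_derivative (\<lambda>h. r (p t) * L (p t) h - L (p t) h * r (p t)) \<circ> (\<lambda>s. (- s) *\<^sub>R h)) (at t within {0..1})"
        using p[OF t] by (intro diff_chain_within) (auto intro: has_derivative_subset[OF der])
      moreover have "L (p t) ((- s) *\<^sub>R h) = (- s) *\<^sub>R L (p t) h" for s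
        using linear_scale[OF lin] p[OF t] by blast
      ultimately show "((\<lambda>t. r (p t)) has_vector_derivative L (p t) h * r (p t) - r (p t) * L (p t) h) (at t within {0..1})"
        by (simp add: has_vector_derivative_def o_def algebra_simps)
      show "norm (L (p t) h) \<le> K * norm h" using bound p[OF t] by blast
      show "norm (L (p t) h - L x h) \<le> c * norm h" using coord p[OF t] by blast
    next
      show "continuous_on {0..1} (\<lambda>t. L (p t) h)"
        by (rule continuous_on_compose2[OF cont]) (use p in \<open>auto simp: p_def intro!: continuous_intros\<close>)
      have "K * norm h \<le> K * (1 / (2 * K))"
        using u K by (intro mult_left_mono) (auto simp: h_def d_def)
      then show "K * norm h \<le> 1/2" using K by simp
      show "r (p 1) \<in> density_elements \<tau>" using dens p by auto
    qed
    also have "\<dots> = norm b * norm h * (8 * c + 32 * (K\<^sup>2 * norm h))" by (simp add: algebra_simps power2_eq_square)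
    also have "\<dots> \<le> norm b * norm h * (8 * c + 32 * (K\<^sup>2 * (c / (4 * K\<^sup>2))))"
      using u by (intro mult_left_mono add_left_mono mult_nonneg_nonneg) (auto simp: h_def d_def)
    also have "\<dots> = e * norm h * norm b" using K by (simp add: c_def)
    finally show ?thesis by (simp add: p_def h_def)
  qed
  then show ?thesis using d by blast
qed

text \<open>A product rule without continuity of the trace. The error splits into the increment of
  the state at the element \<open>b u\<close>, the linearization error of \<open>b\<close> in the
  state at \<open>x\<close>, and the replacement of \<open>b u\<close> by \<open>b x\<close> inside
  the commutator; \<open>state_bound\<close> controls the last two.\<close>

lemma tr_has_derivative:
  fixes r :: "'e::euclidean_space \<Rightarrow> 'a" and L :: "'e \<Rightarrow> 'e \<Rightarrow> 'a"
  assumes S: "convex S" "x \<in> S"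
    and dens: "\<And>u. u \<in> S \<Longrightarrow> r u \<in> density_elements \<tau>"
    and lin: "\<And>u. u \<in> S \<Longrightarrow> linear (L u)" and cont: "\<And>h. continuous_on S (\<lambda>u. L u h)"
    and der: "\<And>u. u \<in> S \<Longrightarrow> (r has_derivative (\<lambda>h. r u * L u h - L u h * r u)) (at u within S)"
    and b: "(b has_derivative b') (at x within S)"
  shows "((\<lambda>u. tr (r u * b u)) has_derivative (\<lambda>h. tr (r x * (b' h + comm (L x h) (b x))))) (at x within S)"
  unfolding has_derivative_within_alt
proof (intro conjI allI impI)
  note dx = dens[OF S(2)]
  have f: "r x * c \<in> fin" for c using density_fin[OF dx] fin_mult by blast
  have lb: "linear b'" using b has_derivative_linear by blast
  have "linear (\<lambda>h. tr (r x * (b' h + comm (L x h) (b x))))"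
  proof (rule linearI)
    show "tr (r x * (b' (h + k) + comm (L x (h + k)) (b x))) =
       tr (r x * (b' h + comm (L x h) (b x))) + tr (r x * (b' k + comm (L x k) (b x)))" for h k
      unfolding tr_add[OF f f, symmetric]
      by (intro arg_cong[of _ _ tr]) (simp add: linear_add[OF lb] linear_add[OF lin[OF S(2)]] comm_def algebra_simps)
    show "tr (r x * (b' (c *\<^sub>R h) + comm (L x (c *\<^sub>R h)) (b x))) = c *\<^sub>R tr (r x * (b' h + comm (L x h) (b x)))" for c h
      unfolding tr_scale[OF f, symmetric]
      by (intro arg_cong[of _ _ tr]) (simp add: linear_scale[OF lb] linear_scale[OF lin[OF S(2)]] comm_def algebra_simps)
  qed
  then show "bounded_linear (\<lambda>h. tr (r x * (b' h + comm (L x h) (b x))))"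
    by (simp add: linear_conv_bounded_linear)
next
  note dx = dens[OF S(2)]
  have f: "r x * c \<in> fin" for c using density_fin[OF dx] fin_mult by blast
  fix e :: real assume e: "e > 0"
  obtain K where K: "K > 0" "\<And>h. norm (L x h) \<le> K * norm h"
    using linear_bounded_pos[OF lin[OF S(2)]] by (metis mult.commute)
  \<comment> \<open>The three errors are \<open>norm (b x) + 1\<close>, \<open>4\<close> and
    \<open>8 * K\<close> times \<open>c * norm (u - x)\<close>.\<close>
  define c where "c = e / (norm (b x) + 5 + 8 * K)"
  have pos: "norm (b x) + 5 + 8 * K > 0" using K by (simp add: add_nonneg_pos)
  have c: "c > 0" using e pos by (simp add: c_def)
  obtain d1 where d1: "d1 > 0" "\<And>u a. u \<in> S \<Longrightarrow> norm (u - x) < d1 \<Longrightarrow>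
      cmod (tr (r u * a) - tr (r x * a) - tr (r x * comm (L x (u - x)) a)) \<le> c * norm (u - x) * norm a"
    using state_increment_along[OF S dens lin cont der c] by blast
  obtain d2 where d2: "d2 > 0" "\<And>u. u \<in> S \<Longrightarrow> norm (u - x) < d2 \<Longrightarrow> norm (b u - b x - b' (u - x)) \<le> c * norm (u - x)"
    using b c unfolding has_derivative_within_alt by blast
  have "continuous (at x within S) b" using b has_derivative_continuous by blast
  then obtain d3 where d3: "d3 > 0" "\<And>u. u \<in> S \<Longrightarrow> norm (u - x) < d3 \<Longrightarrow> norm (b u - b x) < min 1 c"
    using c unfolding continuous_within_eps_delta by (metis dist_norm min_less_iff_conj zero_less_one)
  define d where "d = min d1 (min d2 d3)"
  have "cmod (tr (r u * b u) - tr (r x * b x) - tr (r x * (b' (u - x) + comm (L x (u - x)) (b x)))) \<le> e * norm (u - x)"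
    if u: "u \<in> S" "norm (u - x) < d" for u
  proof -
    let ?h = "u - x"
    have "r x * (b u - b x - b' ?h) = r x * b u - r x * b x - r x * b' ?h" by (simp add: algebra_simps)
    then have e1: "tr (r x * (b u - b x - b' ?h)) = tr (r x * b u) - tr (r x * b x) - tr (r x * b' ?h)"
      using f by (simp add: tr_diff fin_diff)
    have "r x * comm (L x ?h) (b u - b x) = r x * comm (L x ?h) (b u) - r x * comm (L x ?h) (b x)"
      by (simp add: comm_def algebra_simps)
    then have e2: "tr (r x * comm (L x ?h) (b u - b x)) = tr (r x * comm (L x ?h) (b u)) - tr (r x * comm (L x ?h) (b x))"
      using f by (simp add: tr_diff)
    have e3: "tr (r x * (b' ?h + comm (L x ?h) (b x))) = tr (r x * b' ?h) + tr (r x * comm (L x ?h) (b x))"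
      using f by (simp add: distrib_left tr_add)
    have "tr (r u * b u) - tr (r x * b x) - tr (r x * (b' ?h + comm (L x ?h) (b x)))
      = (tr (r u * b u) - tr (r x * b u) - tr (r x * comm (L x ?h) (b u)))
        + tr (r x * (b u - b x - b' ?h)) + tr (r x * comm (L x ?h) (b u - b x))"
      unfolding e1 e2 e3 by simp
    also have "cmod \<dots> \<le> c * norm ?h * (norm (b x) + 1) + 4 * (c * norm ?h) + 4 * (2 * (K * norm ?h * c))"
    proof (intro norm_triangle_le add_mono)
      have "norm (b u) \<le> norm (b x) + norm (b u - b x)" by (metis norm_triangle_sub)
      also have "norm (b u - b x) \<le> 1" using d3(2)[OF u(1)] u(2) by (simp add: d_def)
      finally have "norm (b u) \<le> norm (b x) + 1" by simp
      then have "c * norm ?h * norm (b u) \<le> c * norm ?h * (norm (b x) + 1)"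
        using c by (intro mult_left_mono) auto
      moreover have "cmod (tr (r u * b u) - tr (r x * b u) - tr (r x * comm (L x ?h) (b u))) \<le> c * norm ?h * norm (b u)"
        using d1(2)[OF u(1)] u(2) by (simp add: d_def)
      ultimately show "cmod (tr (r u * b u) - tr (r x * b u) - tr (r x * comm (L x ?h) (b u))) \<le> c * norm ?h * (norm (b x) + 1)"
        by (rule order_trans[rotated])
      show "cmod (tr (r x * (b u - b x - b' ?h))) \<le> 4 * (c * norm ?h)"
        by (rule order_trans[OF state_bound[OF dx]]) (use d2(2)[OF u(1)] u(2) in \<open>simp add: d_def\<close>)
      have *: "norm (L x ?h) * norm (b u - b x) \<le> K * norm ?h * c"
        using K d3(2)[OF u(1)] u(2) by (intro mult_mono) (auto simp: d_def)
      have "norm (comm (L x ?h) (b u - b x)) \<le> norm (L x ?h * (b u - b x)) + norm ((b u - b x) * L x ?h)"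
        unfolding comm_def by (rule norm_triangle_ineq4)
      also have "\<dots> \<le> K * norm ?h * c + K * norm ?h * c"
        using * by (intro add_mono order_trans[OF norm_mult_ineq]) (auto simp: mult.commute)
      finally show "cmod (tr (r x * comm (L x ?h) (b u - b x))) \<le> 4 * (2 * (K * norm ?h * c))"
        using state_bound[OF dx, of "comm (L x ?h) (b u - b x)"] by (simp add: mult_ac)
    qed
    also have "\<dots> = c * (norm (b x) + 5 + 8 * K) * norm ?h" by (simp add: algebra_simps)
    also have "\<dots> = e * norm ?h" using pos by (simp add: c_def)
    finally show ?thesis .
  qed
  then show "\<exists>d>0. \<forall>u\<in>S. norm (u - x) < d \<longrightarrow>
     cmod (tr (r u * b u) - tr (r x * b x) - tr (r x * (b' (u - x) + comm (L x (u - x)) (b x)))) \<le> e * norm (u - x)"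
    using d1(1) d2(1) d3(1) by (intro exI[of _ d]) (auto simp: d_def)
qed

end

section \<open>Derivatives of bounded forms on lists\<close>

lemma has_derivative_zero_comparison:
  assumes "(R has_derivative (\<lambda>_. 0)) (at x within S)" "R x = 0"
    and "eventually (\<lambda>u. norm (g u) \<le> C * norm (R u)) (at x within S)" "g x = 0"
  shows "(g has_derivative (\<lambda>_. 0)) (at x within S)"
  unfolding has_derivative_within
proof
  have "((\<lambda>y. (1 / norm (y - x)) *\<^sub>R (R y - (R x + 0))) \<longlongrightarrow> 0) (at x within S)"
    using assms(1) unfolding has_derivative_within by blast
  then have "((\<lambda>y. C * norm ((1 / norm (y - x)) *\<^sub>R R y)) \<longlongrightarrow> C * 0) (at x within S)"
    using assms(2) by (intro tendsto_mult_left tendsto_norm_zero) simp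
  then have l: "((\<lambda>y. C * norm ((1 / norm (y - x)) *\<^sub>R R y)) \<longlongrightarrow> 0) (at x within S)" by simp
  show "((\<lambda>y. (1 / norm (y - x)) *\<^sub>R (g y - (g x + 0))) \<longlongrightarrow> 0) (at x within S)"
    by (rule Lim_null_comparison[OF _ l], rule eventually_mono[OF assms(3)])
       (simp add: assms(4) divide_simps mult.commute)
qed simp

text \<open>Induction on the number of varying arguments, the fixed ones being kept in
  \<open>cs\<close>. The last varying argument is split into its value at \<open>x\<close>, its
  linear part and a remainder \<open>R\<close>. As the domain has finite dimension, the linear part
  is a combination of finitely many constant vectors, so the induction hypothesis applies to each
  term.\<close>

lemma algebra_form_has_derivative:
  fixes fs :: "('e::euclidean_space \<Rightarrow> 'a::cstar_algebra) list"
  assumes w: "algebra_form k \<omega>"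
  shows "length fs + length cs = k \<Longrightarrow> (\<And>i. i < length fs \<Longrightarrow> (fs ! i has_derivative f' i) (at x within S)) \<Longrightarrow>
    ((\<lambda>u. \<omega> (map (\<lambda>f. f u) fs @ cs)) has_derivative
      (\<lambda>h. \<Sum>i<length fs. \<omega> ((map (\<lambda>f. f x) fs @ cs)[i := f' i h]))) (at x within S)"
proof (induction fs arbitrary: cs rule: rev_induct)
  case (snoc f fs)
  note alt = algebra_form_alt_form[OF w]
  let ?A = "\<lambda>u. map (\<lambda>f. f u) fs" and ?n = "length fs"
  have fs: "(fs ! i has_derivative f' i) (at x within S)" if "i < ?n" for i
    using snoc.prems(2)[of i] that by (simp add: nth_append)
  have IH: "((\<lambda>u. \<omega> (?A u @ a # cs)) has_derivative
      (\<lambda>h. \<Sum>i<?n. \<omega> ((?A x @ a # cs)[i := f' i h]))) (at x within S)" for a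
    using snoc.prems(1) by (intro snoc.IH fs) auto
  have f: "(f has_derivative f' ?n) (at x within S)" using snoc.prems(2)[of ?n] by simp
  have lf: "linear (f' ?n)" using f has_derivative_linear by blast
  have lin: "linear (\<lambda>a. \<omega> (?A u @ a # cs))" for u
    using snoc.prems by (intro alt_form_linear[OF alt]) simp
  define R where "R u = f u - f x - f' ?n (u - x)" for u
  have R: "(R has_derivative (\<lambda>_. 0)) (at x within S)"
    unfolding R_def by (rule derivative_eq_intros f has_derivative_linear refl | (rule bounded_linear.has_derivative[OF has_derivative_bounded_linear[OF f]]))+ simp
  obtain K where K: "\<And>as. length as = k \<Longrightarrow> norm (\<omega> as) \<le> K * prod_list (map norm as)"
    using w unfolding algebra_form_def by blast
  have "((\<lambda>u. prod_list (map norm (?A u))) \<longlongrightarrow> prod_list (map norm (?A x))) (at x within S)"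
    using fs
  proof (induction fs rule: rev_induct)
    case (snoc g gs)
    have "(g \<longlongrightarrow> g x) (at x within S)"
      using snoc.prems[of "length gs"] has_derivative_continuous[of g] by (simp add: continuous_within)
    moreover have "((\<lambda>u. prod_list (map norm (map (\<lambda>f. f u) gs))) \<longlongrightarrow> prod_list (map norm (map (\<lambda>f. f x) gs))) (at x within S)"
    proof (rule snoc.IH)
      show "(gs ! i has_derivative f' i) (at x within S)" if "i < length gs" for i
        using snoc.prems[of i] that by (simp add: nth_append)
    qed
    ultimately show ?case by (auto intro!: tendsto_intros)
  qed simp
  then have ev: "eventually (\<lambda>u. prod_list (map norm (?A u)) < prod_list (map norm (?A x)) + 1) (at x within S)"
    by (rule order_tendstoD) simp
  define C where "C = \<bar>K\<bar> * (prod_list (map norm (?A x)) + 1) * prod_list (map norm cs)"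
  have nn: "0 \<le> prod_list (map norm as)" for as :: "'a list" by (induction as) auto
  have g3: "((\<lambda>u. \<omega> (?A u @ R u # cs)) has_derivative (\<lambda>_. 0)) (at x within S)"
  proof (rule has_derivative_zero_comparison[OF R, of _ C])
    show R0: "R x = 0" by (simp add: R_def linear_0[OF lf])
    show "\<omega> (?A x @ R x # cs) = 0" unfolding R0 using linear_0[OF lin] .
    show "eventually (\<lambda>u. norm (\<omega> (?A u @ R u # cs)) \<le> C * norm (R u)) (at x within S)"
      using ev
    proof eventually_elim
      case (elim u)
      have "norm (\<omega> (?A u @ R u # cs)) \<le> K * prod_list (map norm (?A u @ R u # cs))"
        using snoc.prems by (intro K) simp
      also have "\<dots> \<le> \<bar>K\<bar> * prod_list (map norm (?A u @ R u # cs))"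
        by (intro mult_right_mono nn) simp
      also have "\<dots> = \<bar>K\<bar> * prod_list (map norm (?A u)) * (norm (R u) * prod_list (map norm cs))" by simp
      also have "\<dots> \<le> \<bar>K\<bar> * (prod_list (map norm (?A x)) + 1) * (norm (R u) * prod_list (map norm cs))"
        using elim by (intro mult_right_mono mult_left_mono mult_nonneg_nonneg nn) auto
      finally show ?case by (simp add: C_def mult_ac)
    qed
  qed
  \<comment> \<open>The coefficients \<open>(u - x) \<bullet> i\<close> vanish at \<open>x\<close>,
    so the derivatives of the other arguments drop out of the product rule.\<close>
  have g2: "((\<lambda>u. \<Sum>i\<in>Basis. ((u - x) \<bullet> i) *\<^sub>R \<omega> (?A u @ f' ?n i # cs)) has_derivative
      (\<lambda>h. \<omega> (?A x @ f' ?n h # cs))) (at x within S)"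
  proof -
    have "((\<lambda>u. \<Sum>i\<in>Basis. ((u - x) \<bullet> i) *\<^sub>R \<omega> (?A u @ f' ?n i # cs)) has_derivative
      (\<lambda>h. \<Sum>i\<in>Basis. ((x - x) \<bullet> i) *\<^sub>R (\<Sum>j<?n. \<omega> ((?A x @ f' ?n i # cs)[j := f' j h])) + ((h - 0) \<bullet> i) *\<^sub>R \<omega> (?A x @ f' ?n i # cs))) (at x within S)"
      by (intro has_derivative_sum has_derivative_scaleR IH has_derivative_inner_left has_derivative_diff has_derivative_ident has_derivative_const)
    moreover have "(\<Sum>i\<in>Basis. ((x - x) \<bullet> i) *\<^sub>R (\<Sum>j<?n. \<omega> ((?A x @ f' ?n i # cs)[j := f' j h])) + ((h - 0) \<bullet> i) *\<^sub>R \<omega> (?A x @ f' ?n i # cs))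
      = \<omega> (?A x @ f' ?n h # cs)" for h
    proof -
      have "f' ?n h = (\<Sum>i\<in>Basis. (h \<bullet> i) *\<^sub>R f' ?n i)"
        using linear_sum[OF lf, of "\<lambda>i. (h \<bullet> i) *\<^sub>R i" Basis] linear_scale[OF lf] by (simp add: euclidean_representation)
      then show ?thesis by (simp add: linear_sum[OF lin] linear_scale[OF lin])
    qed
    ultimately show ?thesis by simp
  qed
  have dec: "\<omega> (?A u @ f u # cs) = \<omega> (?A u @ f x # cs)
     + (\<Sum>i\<in>Basis. ((u - x) \<bullet> i) *\<^sub>R \<omega> (?A u @ f' ?n i # cs)) + \<omega> (?A u @ R u # cs)" for u
  proof -
    have "f' ?n (u - x) = (\<Sum>i\<in>Basis. ((u - x) \<bullet> i) *\<^sub>R f' ?n i)"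
      using linear_sum[OF lf, of "\<lambda>i. ((u - x) \<bullet> i) *\<^sub>R i" Basis] linear_scale[OF lf] by (simp add: euclidean_representation)
    then have "(\<Sum>i\<in>Basis. ((u - x) \<bullet> i) *\<^sub>R \<omega> (?A u @ f' ?n i # cs)) = \<omega> (?A u @ f' ?n (u - x) # cs)"
      by (simp add: linear_sum[OF lin] linear_scale[OF lin])
    moreover have "f u = f x + f' ?n (u - x) + R u" by (simp add: R_def)
    ultimately show ?thesis by (simp add: linear_add[OF lin])
  qed
  have "((\<lambda>u. \<omega> (?A u @ f u # cs)) has_derivative
     (\<lambda>h. (\<Sum>i<?n. \<omega> ((?A x @ f x # cs)[i := f' i h])) + \<omega> (?A x @ f' ?n h # cs) + 0)) (at x within S)"
    unfolding dec by (intro has_derivative_add IH g2 g3)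
  moreover have "(?A x @ f x # cs)[?n := a] = ?A x @ a # cs" for a
    by (simp add: list_update_append)
  ultimately show ?case by simp
qed simp

section \<open>Calculus in charts\<close>

text \<open>Chart targets and overlaps are relatively open in the half-space, so all derivatives can
  be taken within the half-space and compared across charts.\<close>

lemma at_within_openin:
  assumes "openin (top_of_set H) S" "x \<in> S"
  shows "at x within S = at x within H"
proof -
  obtain T where T: "open T" "S = H \<inter> T" using assms(1) by (auto simp: openin_open)
  then show ?thesis using assms(2) by (intro at_within_nhd[of x T]) auto
qed

lemma convex_half_space: "convex half_space"
  unfolding half_space_def by (auto simp: convex_def algebra_simps intro: add_nonpos_nonpos mult_nonneg_nonpos)

lemma closed_half_space: "closed half_space"
  unfolding half_space_def by (intro closed_Collect_le continuous_intros)

text \<open>A point of the half-space stays in it under small negative multiples of every axis,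
  which suffices for uniqueness even at the boundary.\<close>

lemma half_space_derivative_unique:
  assumes "x \<in> half_space" "(f has_derivative f') (at x within half_space)" "(f has_derivative f'') (at x within half_space)"
  shows "f' = f''"
proof (rule frechet_derivative_unique_within[OF assms(2,3)])
  fix i :: "real^'a::_" and e :: real assume "i \<in> Basis" "0 < e"
  then obtain j where "i = axis j 1" by (auto simp: Basis_vec_def)
  then show "\<exists>d. 0 < \<bar>d\<bar> \<and> \<bar>d\<bar> < e \<and> x + d *\<^sub>R i \<in> half_space"
    using assms(1) \<open>0 < e\<close> by (intro exI[of _ "- (e / 2)"]) (auto simp: half_space_def axis_def)
qed

lemma half_space_frechet_derivative:
  assumes "x \<in> half_space" "(f has_derivative f') (at x within half_space)"
  shows "frechet_derivative f (at x within half_space) = f'"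
  using half_space_derivative_unique[OF assms(1) _ assms(2)] assms(2)
  by (metis differentiableI frechet_derivative_works)

section \<open>Charts, transition maps and tangent vectors\<close>

locale manifold =
  fixes \<A> :: "('q::{t2_space,second_countable_topology}, 'n::{finite,linorder}) chart set"
  assumes atlas: "manifold_atlas \<A>"
begin

abbreviation "T \<equiv> transition_deriv"
abbreviation "tv \<equiv> tvec_of \<A>"

lemma open_cdom: "c \<in> \<A> \<Longrightarrow> open (cdom c)"
  and openin_target: "c \<in> \<A> \<Longrightarrow> openin (top_of_set half_space) (target c)"
  and chart_homeo: "c \<in> \<A> \<Longrightarrow> homeomorphism (cdom c) (target c) (coords c) (param c)"
  using atlas by (auto simp: manifold_atlas_def)

lemma chart_at: obtains c where "c \<in> \<A>" "q \<in> cdom c"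
proof -
  have "q \<in> (\<Union>c\<in>\<A>. cdom c)" using atlas unfolding manifold_atlas_def by simp
  then show thesis using that by blast
qed

lemma target_half_space: "c \<in> \<A> \<Longrightarrow> target c \<subseteq> half_space"
  by (rule openin_imp_subset[OF openin_target])

lemma coords_target [simp]: "q \<in> cdom c \<Longrightarrow> coords c q \<in> target c"
  by (simp add: target_def)

lemma param_coords [simp]: "c \<in> \<A> \<Longrightarrow> q \<in> cdom c \<Longrightarrow> param c (coords c q) = q"
  using chart_homeo by (auto simp: homeomorphism_def)

lemma coords_param [simp]: "c \<in> \<A> \<Longrightarrow> u \<in> target c \<Longrightarrow> coords c (param c u) = u"
  using chart_homeo by (auto simp: homeomorphism_def)

lemma param_cdom [simp]: "c \<in> \<A> \<Longrightarrow> u \<in> target c \<Longrightarrow> param c u \<in> cdom c"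
  using chart_homeo by (fastforce simp: homeomorphism_def)

lemma continuous_coords: "c \<in> \<A> \<Longrightarrow> continuous_on (cdom c) (coords c)"
  and continuous_param: "c \<in> \<A> \<Longrightarrow> continuous_on (target c) (param c)"
  using chart_homeo by (auto simp: homeomorphism_def)

lemma openin_coords_image:
  assumes "c \<in> \<A>" "open U" "U \<subseteq> cdom c"
  shows "openin (top_of_set half_space) (coords c ` U)"
proof -
  have "openin (top_of_set (cdom c)) U" using assms by (metis open_openin openin_subtopology_self inf.absorb_iff2 openin_open)
  then have "openin (top_of_set (target c)) (coords c ` U)"
    by (rule homeomorphism_imp_open_map[OF chart_homeo[OF assms(1)]])
  then show ?thesis using openin_target[OF assms(1)] openin_trans by blast
qed

lemma within_target: "c \<in> \<A> \<Longrightarrow> u \<in> target c \<Longrightarrow> at u within target c = at u within half_space"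
  using at_within_openin openin_target by blast

lemma openin_overlap:
  "c \<in> \<A> \<Longrightarrow> c' \<in> \<A> \<Longrightarrow> openin (top_of_set half_space) (coords c ` (cdom c \<inter> cdom c'))"
  by (intro openin_coords_image) (auto simp: open_cdom)

text \<open>The derivative in \<open>Ck_on\<close> is existentially quantified; uniqueness in the
  half-space identifies it with \<open>transition_deriv\<close> and transfers its
  continuity.\<close>

lemma transition_works:
  assumes c: "c \<in> \<A>" "c' \<in> \<A>"
  shows "q \<in> cdom c \<Longrightarrow> q \<in> cdom c' \<Longrightarrow>
      ((coords c' \<circ> param c) has_derivative T c c' q) (at (coords c q) within half_space)"
    and "continuous_on (coords c ` (cdom c \<inter> cdom c')) (\<lambda>u. T c c' (param c u) v)"
proof -
  let ?O = "coords c ` (cdom c \<inter> cdom c')"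
  have "Ck_on (Suc 0) ?O (coords c' \<circ> param c)" using atlas c unfolding manifold_atlas_def by blast
  then obtain f' where f': "\<And>x. x \<in> ?O \<Longrightarrow> ((coords c' \<circ> param c) has_derivative f' x) (at x within ?O)"
    "\<And>v. continuous_on ?O (\<lambda>x. f' x v)" by auto
  have O: "at x within ?O = at x within half_space" if "x \<in> ?O" for x
    using at_within_openin[OF openin_overlap[OF c] that] .
  have hs: "?O \<subseteq> half_space" using openin_imp_subset[OF openin_overlap[OF c]] .
  have eq: "T c c' (param c x) = f' x" if "x \<in> ?O" for x
  proof -
    have "coords c (param c x) = x" using that c by auto
    moreover have "frechet_derivative (coords c' \<circ> param c) (at x within half_space) = f' x"
      by (rule half_space_frechet_derivative) (use f'(1)[OF that] O[OF that] hs that in auto)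
    ultimately show ?thesis
      unfolding transition_deriv_def using O[OF that] by simp
  qed
  show "((coords c' \<circ> param c) has_derivative T c c' q) (at (coords c q) within half_space)"
    if "q \<in> cdom c" "q \<in> cdom c'"
    using f'(1)[of "coords c q"] eq[of "coords c q"] O[of "coords c q"] that c by auto
  show "continuous_on ?O (\<lambda>u. T c c' (param c u) v)"
    using f'(2)[of v] by (simp add: eq cong: continuous_on_cong)
qed

lemma transition_linear: "c \<in> \<A> \<Longrightarrow> c' \<in> \<A> \<Longrightarrow> q \<in> cdom c \<Longrightarrow> q \<in> cdom c' \<Longrightarrow> linear (T c c' q)"
  using transition_works(1) has_derivative_linear by blast

lemma coords_half_space: "c \<in> \<A> \<Longrightarrow> q \<in> cdom c \<Longrightarrow> coords c q \<in> half_space"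
  using target_half_space[of c] coords_target[of q c] by blast

lemma transition_id:
  assumes "c \<in> \<A>" "q \<in> cdom c" shows "T c c q = (\<lambda>v. v)"
proof (rule half_space_derivative_unique)
  show "((coords c \<circ> param c) has_derivative T c c q) (at (coords c q) within half_space)"
    using transition_works assms by blast
  have "((\<lambda>x. x) has_derivative (\<lambda>v. v)) (at (coords c q) within target c)" by (rule has_derivative_ident)
  then have "((coords c \<circ> param c) has_derivative (\<lambda>v. v)) (at (coords c q) within target c)"
    by (rule has_derivative_transform[rotated 2]) (use assms in auto)
  then show "((coords c \<circ> param c) has_derivative (\<lambda>v. v)) (at (coords c q) within half_space)"
    using within_target assms by auto
qed (use assms coords_half_space in auto)

lemma transition_cocycle:
  assumes c: "c \<in> \<A>" "c' \<in> \<A>" "c'' \<in> \<A>" and q: "q \<in> cdom c" "q \<in> cdom c'" "q \<in> cdom c''"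
  shows "T c' c'' q (T c c' q v) = T c c'' q v"
proof -
  let ?O = "coords c ` (cdom c \<inter> cdom c' \<inter> cdom c'')"
  have op: "openin (top_of_set half_space) ?O" using c by (intro openin_coords_image open_Int open_cdom) auto
  have x: "coords c q \<in> ?O" using q by auto
  have d1: "((coords c' \<circ> param c) has_derivative T c c' q) (at (coords c q) within ?O)"
    using transition_works(1)[OF c(1,2) q(1,2)] at_within_openin[OF op x] by simp
  have d2: "((coords c'' \<circ> param c') has_derivative T c' c'' q) (at ((coords c' \<circ> param c) (coords c q)) within (coords c' \<circ> param c) ` ?O)"
  proof (rule has_derivative_subset)
    show "(coords c' \<circ> param c) ` ?O \<subseteq> half_space"
      using param_coords[OF c(1)] coords_half_space[OF c(2)] by auto
    show "((coords c'' \<circ> param c') has_derivative T c' c'' q) (at ((coords c' \<circ> param c) (coords c q)) within half_space)"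
      using transition_works(1)[OF c(2,3) q(2,3)] c q by simp
  qed
  have "(((coords c'' \<circ> param c') \<circ> (coords c' \<circ> param c)) has_derivative (T c' c'' q \<circ> T c c' q)) (at (coords c q) within ?O)"
    by (rule diff_chain_within[OF d1 d2])
  then have "((coords c'' \<circ> param c) has_derivative (T c' c'' q \<circ> T c c' q)) (at (coords c q) within ?O)"
    by (rule has_derivative_transform[OF x, rotated]) (use c in auto)
  then have "((coords c'' \<circ> param c) has_derivative (T c' c'' q \<circ> T c c' q)) (at (coords c q) within half_space)"
    unfolding at_within_openin[OF op x] .
  from half_space_derivative_unique[OF _ this transition_works(1)[OF c(1,3) q(1,3)]]
  have "T c' c'' q \<circ> T c c' q = T c c'' q" using c q coords_half_space by blast
  then show ?thesis by (metis comp_apply)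
qed

lemma tv_change:
  assumes "c \<in> \<A>" "c' \<in> \<A>" "q \<in> cdom c" "q \<in> cdom c'"
  shows "tv c q v = tv c' q (T c c' q v)"
  using assms by (auto simp: tvec_of_def transition_cocycle)

lemma tv_tangent: "c \<in> \<A> \<Longrightarrow> q \<in> cdom c \<Longrightarrow> tv c q v \<in> tangent_space \<A> q"
  by (auto simp: tangent_space_def tvec_of_def transition_cocycle)

lemma tangent_eq_tv: "c \<in> \<A> \<Longrightarrow> q \<in> cdom c \<Longrightarrow> w \<in> tangent_space \<A> q \<Longrightarrow> tv c q (w c) = w"
proof (rule ext)
  fix c' assume w: "c \<in> \<A>" "q \<in> cdom c" "w \<in> tangent_space \<A> q"
  show "tv c q (w c) c' = w c'"
  proof (cases "c' \<in> \<A> \<and> q \<in> cdom c'")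
    case True
    then have "w c' = T c c' q (w c)" using w unfolding tangent_space_def by blast
    then show ?thesis unfolding tvec_of_def using True by simp
  next
    case False
    then have "w c' = 0" using w(3) unfolding tangent_space_def by blast
    then show ?thesis unfolding tvec_of_def if_not_P[OF False] ..
  qed
qed

lemma tv_linear:
  assumes "c \<in> \<A>" "q \<in> cdom c"
  shows "tv c q (r *\<^sub>R v + w) = (\<lambda>c'. r *\<^sub>R tv c q v c' + tv c q w c')"
  using transition_linear[OF assms(1) _ assms(2)]
  by (auto simp: tvec_of_def linear_add linear_scale)

text \<open>\<open>tr_has_derivative\<close> joins points by segments and therefore asks for a
  convex set.\<close>

lemma convex_nbhd:
  assumes "c \<in> \<A>" "u \<in> target c"
  obtains S where "convex S" "u \<in> S" "S \<subseteq> target c" "\<And>x. x \<in> S \<Longrightarrow> at x within S = at x within half_space"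
proof -
  obtain d where d: "d > 0" "half_space \<inter> ball u d \<subseteq> target c"
    using openin_target[OF assms(1)] assms(2) unfolding openin_contains_ball by (auto simp: Int_commute)
  show ?thesis
  proof (rule that[of "half_space \<inter> ball u d"])
    show "convex (half_space \<inter> ball u d)" by (intro convex_Int convex_half_space convex_ball)
    show "u \<in> half_space \<inter> ball u d" using assms(2) target_half_space[OF assms(1)] d(1) by auto
    show "at x within half_space \<inter> ball u d = at x within half_space" if "x \<in> half_space \<inter> ball u d" for x
      using that by (intro at_within_openin) auto
  qed (rule d)
qed

end

section \<open>The exterior derivative of the pullback\<close>

lemma sum_omit_index:
  fixes F :: "nat \<Rightarrow> 'a::comm_monoid_add"
  assumes "i \<le> k"
  shows "(\<Sum>m<k. F m) = (\<Sum>j<i. F j) + (\<Sum>j\<in>{Suc i..<Suc k}. F (j - 1))"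
proof -
  have "(\<Sum>m<k. F m) = (\<Sum>m\<in>{..<i} \<union> {i..<k}. F m)" using assms by (intro sum.cong) auto
  also have "\<dots> = (\<Sum>j<i. F j) + (\<Sum>m\<in>{i..<k}. F m)" by (intro sum.union_disjoint) auto
  also have "(\<Sum>m\<in>{i..<k}. F m) = (\<Sum>j\<in>{Suc i..<Suc k}. F (j - 1))"
    by (rule sum.reindex_bij_witness[of _ "\<lambda>j. j - 1" Suc]) auto
  finally show ?thesis .
qed

lemma sum_triangle_swap:
  fixes F :: "nat \<Rightarrow> nat \<Rightarrow> 'a::comm_monoid_add"
  shows "(\<Sum>i<n. \<Sum>j\<in>{Suc i..<n}. F i j) = (\<Sum>j<n. \<Sum>i<j. F i j)"
proof -
  have "(\<Sum>i<n. \<Sum>j\<in>{Suc i..<n}. F i j) = (\<Sum>(i, j)\<in>(SIGMA i:{..<n}. {Suc i..<n}). F i j)" by (rule sum.Sigma) auto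
  also have "\<dots> = (\<Sum>(j, i)\<in>(SIGMA j:{..<n}. {..<j}). F i j)"
    by (rule sum.reindex_bij_witness[of _ prod.swap prod.swap]) auto
  also have "\<dots> = (\<Sum>j<n. \<Sum>i<j. F i j)" by (rule sum.Sigma[symmetric]) auto
  finally show ?thesis .
qed

text \<open>Here \<open>d j i\<close> is the derivative of the \<open>j\<close>-th argument in the \<open>i\<close>-th direction; flatness turns
  the antisymmetrized derivatives of the arguments into the second sum of the
  Chevalley--Eilenberg differential.\<close>

lemma sum_derivatives_flat:
  assumes f: "alt_form k f" and X: "length X = Suc k"
    and flat: "\<And>i j. i < Suc k \<Longrightarrow> j < Suc k \<Longrightarrow> d j i - d i j = comm (X ! j) (X ! i)"
  shows "(\<Sum>i<Suc k. (-1::real) ^ i *\<^sub>R (\<Sum>m<k. f ((omit i X)[m := d (if m < i then m else Suc m) i])))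
     = (\<Sum>j<Suc k. \<Sum>i<j. (-1::real) ^ (i + j) *\<^sub>R f (comm (X ! i) (X ! j) # omit i (omit j X)))"
proof -
  let ?p = "\<lambda>i. (-1::real) ^ i"
  have inner: "(\<Sum>m<k. f ((omit i X)[m := d (if m < i then m else Suc m) i]))
    = (\<Sum>j<i. f ((omit i X)[j := d j i])) + (\<Sum>j\<in>{Suc i..<Suc k}. f ((omit i X)[j - 1 := d j i]))" if "i \<le> k" for i
    unfolding sum_omit_index[OF that] by (intro arg_cong2[where f = "(+)"] sum.cong) auto
  have "(\<Sum>i<Suc k. ?p i *\<^sub>R (\<Sum>m<k. f ((omit i X)[m := d (if m < i then m else Suc m) i])))
    = (\<Sum>i<Suc k. (\<Sum>j<i. ?p i *\<^sub>R f ((omit i X)[j := d j i]))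
        + (\<Sum>j\<in>{Suc i..<Suc k}. ?p i *\<^sub>R f ((omit i X)[j - 1 := d j i])))"
  proof (rule sum.cong[OF refl])
    fix i assume "i \<in> {..<Suc k}"
    then have "i \<le> k" by simp
    from inner[OF this] show "?p i *\<^sub>R (\<Sum>m<k. f ((omit i X)[m := d (if m < i then m else Suc m) i]))
      = (\<Sum>j<i. ?p i *\<^sub>R f ((omit i X)[j := d j i])) + (\<Sum>j\<in>{Suc i..<Suc k}. ?p i *\<^sub>R f ((omit i X)[j - 1 := d j i]))"
      by (simp only: scaleR_add_right scaleR_sum_right)
  qed
  also have "\<dots> = (\<Sum>j<Suc k. \<Sum>i<j. ?p j *\<^sub>R f ((omit j X)[i := d i j]))
      + (\<Sum>j<Suc k. \<Sum>i<j. ?p i *\<^sub>R f ((omit i X)[j - 1 := d j i]))"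
    unfolding sum.distrib sum_triangle_swap ..
  also have "\<dots> = (\<Sum>j<Suc k. \<Sum>i<j. ?p j *\<^sub>R f ((omit j X)[i := d i j]) + ?p i *\<^sub>R f ((omit i X)[j - 1 := d j i]))"
    by (simp only: sum.distrib)
  also have "\<dots> = (\<Sum>j<Suc k. \<Sum>i<j. ?p (i + j) *\<^sub>R f (comm (X ! i) (X ! j) # omit i (omit j X)))"
  proof (intro sum.cong refl)
    fix j i assume "j \<in> {..<Suc k}" "i \<in> {..<j}"
    then have ij: "i < j" "j < Suc k" by auto
    obtain us ms ws where X': "X = us @ (X ! i) # ms @ (X ! j) # ws" "length us = i" "length us + length ms + 1 = j"
      "omit i X = us @ ms @ (X ! j) # ws" "omit j X = us @ (X ! i) # ms @ ws" "omit i (omit j X) = us @ ms @ ws"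
      using omit_pair_decomp[of i j X] ij X by metis
    have len: "length us + length ms + length ws + 1 = k"
      using arg_cong[OF X'(1), of length] X by simp
    have lin: "linear (\<lambda>a. f (a # us @ ms @ ws))"
      using alt_form_linear[OF f, of "[]" "us @ ms @ ws"] len by simp
    have "(omit j X)[i := d i j] = [] @ us @ d i j # ms @ ws" unfolding X'(5) using X'(2) by (simp add: list_update_append)
    then have 1: "f ((omit j X)[i := d i j]) = ?p i *\<^sub>R f (d i j # us @ ms @ ws)"
      using alt_form_move[OF f, of "[]" us "ms @ ws" "d i j"] len X'(2) by simp
    \<comment> \<open>Once the entry \<open>i\<close> is gone, the entry \<open>j\<close> sits at
      \<open>j - 1\<close>. This shift yields the relative sign that combines the two derivatives
      into \<open>d i j - d j i\<close>.\<close>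
    have "j - 1 = length (us @ ms)" using X'(3) by simp
    then have "(omit i X)[j - 1 := d j i] = ((us @ ms) @ X ! j # ws)[length (us @ ms) := d j i]" unfolding X'(4) by simp
    then have "(omit i X)[j - 1 := d j i] = [] @ (us @ ms) @ d j i # ws" unfolding list_update_length by simp
    then have 2: "f ((omit i X)[j - 1 := d j i]) = ?p (j - 1) *\<^sub>R f (d j i # us @ ms @ ws)"
      using alt_form_move[OF f, of "[]" "us @ ms" ws "d j i"] len unfolding \<open>j - 1 = length (us @ ms)\<close> by simp
    have pj: "?p j = - ?p (j - 1)" using ij by (cases j) auto
    have 3: "f (comm (X ! i) (X ! j) # us @ ms @ ws) = f (d i j # us @ ms @ ws) - f (d j i # us @ ms @ ws)"
      using flat[of j i] ij linear_diff[OF lin] by (metis less_trans)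
    show "?p j *\<^sub>R f ((omit j X)[i := d i j]) + ?p i *\<^sub>R f ((omit i X)[j - 1 := d j i])
      = ?p (i + j) *\<^sub>R f (comm (X ! i) (X ! j) # omit i (omit j X))"
      unfolding 1 2 3 X'(6) by (simp add: power_add pj scaleR_diff_right mult.commute)
  qed
  finally show ?thesis .
qed

lemma algebra_form_differentiable:
  fixes fs :: "('e::euclidean_space \<Rightarrow> 'a::cstar_algebra) list"
  assumes "algebra_form k \<omega>" "length fs = k" "\<And>f. f \<in> set fs \<Longrightarrow> f differentiable (at x within S)"
  shows "(\<lambda>u. \<omega> (map (\<lambda>f. f u) fs)) differentiable (at x within S)"
proof -
  have "(fs ! i has_derivative frechet_derivative (fs ! i) (at x within S)) (at x within S)" if "i < length fs" for i
    using assms(3)[of "fs ! i"] that frechet_derivative_works by auto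
  from algebra_form_has_derivative[OF assms(1), of fs "[]" _ x S, OF _ this] assms(2) show ?thesis
    unfolding differentiable_def by auto
qed

section \<open>Nonpure maps in the coordinates of a chart\<close>

locale nonpure = manifold \<A> + traced \<tau>
  for \<A> :: "('q::{t2_space,second_countable_topology}, 'n::{finite,linorder}) chart set"
    and \<tau> :: "'a::cstar_algebra \<Rightarrow> ennreal" +
  fixes \<rho> :: "'q \<Rightarrow> 'a" and V :: "'q \<Rightarrow> ('q, 'n) tvec \<Rightarrow> 'a"
  assumes nonpure: "nonpure_map \<tau> \<A> \<rho> V"
begin

definition V_local where "V_local c u v = V (param c u) (tv c (param c u) v)"
text \<open>Here \<open>h\<close> is the direction of differentiation and \<open>v\<close> the
  constant argument of \<open>V\<close>; building it from the axes makes linearity in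
  \<open>v\<close> immediate.\<close>

definition V_deriv where
  "V_deriv c u v h = (\<Sum>i\<in>UNIV. (v $ i) *\<^sub>R frechet_derivative (\<lambda>u. V_local c u (axis i 1)) (at u within half_space) h)"

lemma density: "\<rho> q \<in> density_elements \<tau>"
  using nonpure by (simp add: nonpure_map_def)

lemma V_local_linear:
  assumes "c \<in> \<A>" "u \<in> target c" shows "linear (V_local c u)"
proof -
  have *: "V_local c u (r *\<^sub>R v + w) = r *\<^sub>R V_local c u v + V_local c u w" for r v w
    using nonpure tv_tangent[OF assms(1) param_cdom[OF assms]] unfolding nonpure_map_def V_local_def
    by (subst tv_linear) (use assms in auto)
  have 0: "V_local c u 0 = 0" using *[of 1 0 0] by simp
  show ?thesis
  proof (rule linearI)
    show "V_local c u (v + w) = V_local c u v + V_local c u w" for v w using *[of 1 v w] by simp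
    show "V_local c u (r *\<^sub>R v) = r *\<^sub>R V_local c u v" for r v using *[of r v 0] 0 by simp
  qed
qed

lemma V_local_expand:
  assumes "c \<in> \<A>" "u \<in> target c" shows "V_local c u v = (\<Sum>i\<in>UNIV. (v $ i) *\<^sub>R V_local c u (axis i 1))"
proof -
  have "V_local c u v = V_local c u (\<Sum>i\<in>UNIV. (v $ i) *\<^sub>R axis i 1)"
    using basis_expansion[of v] by (simp add: scalar_mult_eq_scaleR)
  then show ?thesis using V_local_linear[OF assms] by (simp add: linear_sum linear_scale)
qed

lemma V_local_differentiable:
  assumes "c \<in> \<A>" "u \<in> target c" shows "(\<lambda>u. V_local c u v) differentiable (at u within half_space)"
proof -
  have "(\<lambda>(u, v). V_local c u v) differentiable_on target c \<times> UNIV"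
    using nonpure assms unfolding nonpure_map_def V_local_def by auto
  then obtain D where "((\<lambda>(u, v). V_local c u v) has_derivative D) (at (u, v) within target c \<times> UNIV)"
    using assms unfolding differentiable_on_def differentiable_def by auto
  then have "((\<lambda>(u, v). V_local c u v) has_derivative D) (at (u, v) within (\<lambda>u. (u, v)) ` target c)"
    by (rule has_derivative_subset) auto
  moreover have "((\<lambda>u. (u, v)) has_derivative (\<lambda>h. (h, 0))) (at u within target c)"
    by (intro has_derivative_Pair has_derivative_ident has_derivative_const)
  ultimately have "(((\<lambda>(u, v). V_local c u v) \<circ> (\<lambda>u. (u, v))) has_derivative (D \<circ> (\<lambda>h. (h, 0)))) (at u within target c)"
    by (intro diff_chain_within)
  then show ?thesis using within_target[OF assms] by (auto simp: o_def differentiable_def)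
qed

lemma V_local_has_derivative:
  assumes "c \<in> \<A>" "u \<in> target c"
  shows "((\<lambda>u. V_local c u v) has_derivative V_deriv c u v) (at u within half_space)"
proof -
  have "((\<lambda>u. V_local c u (axis i 1)) has_derivative frechet_derivative (\<lambda>u. V_local c u (axis i 1)) (at u within half_space)) (at u within half_space)" for i
    using V_local_differentiable[OF assms] frechet_derivative_works by blast
  then have "((\<lambda>u. \<Sum>i\<in>UNIV. (v $ i) *\<^sub>R V_local c u (axis i 1)) has_derivative V_deriv c u v) (at u within half_space)"
    unfolding V_deriv_def by (intro has_derivative_sum has_derivative_scaleR_right)
  then have "((\<lambda>u. \<Sum>i\<in>UNIV. (v $ i) *\<^sub>R V_local c u (axis i 1)) has_derivative V_deriv c u v) (at u within target c)"
    using within_target[OF assms] by simp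
  then have "((\<lambda>u. V_local c u v) has_derivative V_deriv c u v) (at u within target c)"
    by (rule has_derivative_transform[OF assms(2), rotated]) (use V_local_expand assms in auto)
  then show ?thesis using within_target[OF assms] by simp
qed

lemma continuous_V_local: "c \<in> \<A> \<Longrightarrow> continuous_on (target c) (\<lambda>u. V_local c u v)"
  by (metis V_local_differentiable continuous_on_eq_continuous_within differentiable_imp_continuous_within within_target)

lemma V_local_axis: "V_local c u (axis j 1) = V (param c u) (coord_vec \<A> c (param c u) j)"
  by (simp add: V_local_def coord_vec_def)

lemma density_equation:
  assumes "c \<in> \<A>" "u \<in> target c"
  shows "((\<lambda>u. \<rho> (param c u)) has_derivative (\<lambda>h. \<rho> (param c u) * V_local c u h - V_local c u h * \<rho> (param c u))) (at u within half_space)"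
proof -
  let ?r = "\<lambda>u. \<rho> (param c u)"
  define D where "D = frechet_derivative ?r (at u within target c)"
  have "?r differentiable (at u within target c)"
    using nonpure assms unfolding nonpure_map_def differentiable_on_def by blast
  then have D: "(?r has_derivative D) (at u within target c)" unfolding D_def frechet_derivative_works .
  then have lD: "linear D" by (rule has_derivative_linear)
  have "D (axis j 1) + comm (V_local c u (axis j 1)) (?r u) = 0" for j
    using nonpure assms unfolding nonpure_map_def Let_def partial_def D_def V_local_axis by auto
  then have Dj: "D (axis j 1) = ?r u * V_local c u (axis j 1) - V_local c u (axis j 1) * ?r u" for j
    by (simp add: comm_def algebra_simps add_eq_0_iff2)
  have "D h = ?r u * V_local c u h - V_local c u h * ?r u" for h
  proof -
    have "D h = D (\<Sum>i\<in>UNIV. (h $ i) *\<^sub>R axis i 1)"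
      using basis_expansion[of h] by (simp add: scalar_mult_eq_scaleR)
    also have "\<dots> = (\<Sum>i\<in>UNIV. (h $ i) *\<^sub>R D (axis i 1))" using lD by (simp add: linear_sum linear_scale)
    also have "\<dots> = ?r u * V_local c u h - V_local c u h * ?r u"
      unfolding Dj V_local_expand[OF assms, of h] by (simp add: sum_distrib_left sum_distrib_right sum_subtractf scaleR_diff_right)
    finally show ?thesis .
  qed
  then show ?thesis using D within_target[OF assms] by (metis (no_types, lifting) ext)
qed

text \<open>Both sides are bilinear in \<open>v\<close> and \<open>w\<close>, and on the axes this
  is the curvature equation of a nonpure map.\<close>

lemma flatness:
  assumes "c \<in> \<A>" "u \<in> target c"
  shows "V_deriv c u v w - V_deriv c u w v = comm (V_local c u v) (V_local c u w)"
proof -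
  let ?d = "\<lambda>i. frechet_derivative (\<lambda>u. V_local c u (axis i 1)) (at u within half_space)"
  have f: "?d i (axis j 1) - ?d j (axis i 1) = comm (V_local c u (axis i 1)) (V_local c u (axis j 1))" for i j
    using nonpure[unfolded nonpure_map_def Let_def partial_def V_local_axis[symmetric], THEN conjunct2, THEN conjunct2,
        THEN conjunct2, THEN conjunct2, rule_format, OF assms, THEN conjunct2]
    unfolding within_target[OF assms] .
  have "linear (?d i)" for i
    by (rule has_derivative_linear[OF frechet_derivative_works[THEN iffD1, OF V_local_differentiable[OF assms]]])
  then have e: "?d i h = (\<Sum>j\<in>UNIV. (h $ j) *\<^sub>R ?d i (axis j 1))" for i h
  proof -
    have "?d i h = ?d i (\<Sum>j\<in>UNIV. (h $ j) *\<^sub>R axis j 1)"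
      using basis_expansion[of h] by (simp add: scalar_mult_eq_scaleR)
    then show ?thesis using \<open>linear (?d i)\<close> by (simp add: linear_sum linear_scale)
  qed
  have "V_deriv c u v w - V_deriv c u w v
     = (\<Sum>i\<in>UNIV. \<Sum>j\<in>UNIV. (v $ i * w $ j) *\<^sub>R ?d i (axis j 1)) - (\<Sum>j\<in>UNIV. \<Sum>i\<in>UNIV. (v $ i * w $ j) *\<^sub>R ?d j (axis i 1))"
    unfolding V_deriv_def by (subst (1 2) e) (simp add: scaleR_sum_right mult.commute)
  also have "(\<Sum>j\<in>UNIV. \<Sum>i\<in>UNIV. (v $ i * w $ j) *\<^sub>R ?d j (axis i 1)) = (\<Sum>i\<in>UNIV. \<Sum>j\<in>UNIV. (v $ i * w $ j) *\<^sub>R ?d j (axis i 1))"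
    by (rule sum.swap)
  also have "(\<Sum>i\<in>UNIV. \<Sum>j\<in>UNIV. (v $ i * w $ j) *\<^sub>R ?d i (axis j 1)) - \<dots> =
     (\<Sum>i\<in>UNIV. \<Sum>j\<in>UNIV. (v $ i * w $ j) *\<^sub>R comm (V_local c u (axis i 1)) (V_local c u (axis j 1)))"
    by (simp only: sum_subtractf[symmetric] scaleR_diff_right[symmetric] f)
  also have "\<dots> = comm (V_local c u v) (V_local c u w)"
  proof -
    have p: "V_local c u v * V_local c u w = (\<Sum>i\<in>UNIV. \<Sum>j\<in>UNIV. (v $ i * w $ j) *\<^sub>R (V_local c u (axis i 1) * V_local c u (axis j 1)))"
      unfolding V_local_expand[OF assms, of v] V_local_expand[OF assms, of w] by (simp add: sum_product mult.commute)
    have "V_local c u w * V_local c u v = (\<Sum>i\<in>UNIV. \<Sum>j\<in>UNIV. (v $ i * w $ j) *\<^sub>R (V_local c u (axis j 1) * V_local c u (axis i 1)))"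
      unfolding V_local_expand[OF assms, of v] V_local_expand[OF assms, of w] sum_product
      by (subst sum.swap) (intro sum.cong refl, simp add: mult.commute)
    with p show ?thesis by (simp add: comm_def scaleR_diff_right sum_subtractf)
  qed
  finally show ?thesis .
qed

lemma tr_density_has_derivative:
  assumes "c \<in> \<A>" "u \<in> target c" "(b has_derivative b') (at u within half_space)"
  shows "((\<lambda>u. tr (\<rho> (param c u) * b u)) has_derivative
    (\<lambda>h. tr (\<rho> (param c u) * (b' h + comm (V_local c u h) (b u))))) (at u within half_space)"
proof -
  obtain S where S: "convex S" "u \<in> S" "S \<subseteq> target c" "\<And>x. x \<in> S \<Longrightarrow> at x within S = at x within half_space"
    using convex_nbhd[OF assms(1,2)] by blast
  have "((\<lambda>u. tr (\<rho> (param c u) * b u)) has_derivative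
    (\<lambda>h. tr (\<rho> (param c u) * (b' h + comm (V_local c u h) (b u))))) (at u within S)"
  proof (rule tr_has_derivative[OF S(1,2), where r = "\<lambda>u. \<rho> (param c u)" and L = "V_local c"])
    show "linear (V_local c x)" if "x \<in> S" for x using V_local_linear assms(1) S(3) that by blast
    show "continuous_on S (\<lambda>x. V_local c x h)" for h
      using continuous_on_subset[OF continuous_V_local S(3)] assms(1) by blast
    show "((\<lambda>x. \<rho> (param c x)) has_derivative (\<lambda>h. \<rho> (param c x) * V_local c x h - V_local c x h * \<rho> (param c x))) (at x within S)"
      if "x \<in> S" for x
      unfolding S(4)[OF that] using density_equation assms(1) S(3) that by blast
    show "(b has_derivative b') (at u within S)" using assms(3) S(2,4) by simp
  qed (rule density)
  then show ?thesis using S(2,4) by simp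
qed

lemma local_pullback: "local_form \<A> c (pullback \<tau> \<rho> V \<omega>) vs u = tr (\<rho> (param c u) * \<omega> (map (V_local c u) vs))"
  by (simp add: local_form_def pullback_def V_local_def[abs_def] o_def)

definition pullback_deriv where
  "pullback_deriv \<omega> c vs u h = tr (\<rho> (param c u) * ((\<Sum>m<length vs. \<omega> ((map (V_local c u) vs)[m := V_deriv c u (vs ! m) h]))
     + comm (V_local c u h) (\<omega> (map (V_local c u) vs))))"

lemma pullback_has_derivative:
  assumes "c \<in> \<A>" "u \<in> target c" "algebra_form k \<omega>" "length vs = k"
  shows "(local_form \<A> c (pullback \<tau> \<rho> V \<omega>) vs has_derivative pullback_deriv \<omega> c vs u) (at u within half_space)"
proof -
  have "((\<lambda>u. \<omega> (map (\<lambda>f. f u) (map (\<lambda>v u. V_local c u v) vs) @ [])) has_derivative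
     (\<lambda>h. \<Sum>i<length (map (\<lambda>v u. V_local c u v) vs). \<omega> ((map (\<lambda>f. f u) (map (\<lambda>v u. V_local c u v) vs) @ [])[i := V_deriv c u (vs ! i) h]))) (at u within half_space)"
    by (rule algebra_form_has_derivative[OF assms(3)]) (use assms V_local_has_derivative in auto)
  then have "((\<lambda>u. \<omega> (map (V_local c u) vs)) has_derivative
     (\<lambda>h. \<Sum>i<length vs. \<omega> ((map (V_local c u) vs)[i := V_deriv c u (vs ! i) h]))) (at u within half_space)"
    by (simp add: o_def)
  from tr_density_has_derivative[OF assms(1,2) this] show ?thesis
    unfolding local_pullback pullback_deriv_def[abs_def] by (simp add: local_pullback[abs_def])
qed

text \<open>The whole computation takes place under one trace, which is linear here because every
  term is a multiple of the density element and so has finite trace.\<close>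

lemma pullback_ce_diff:
  assumes "c \<in> \<A>" "u \<in> target c" "algebra_form k \<omega>" "length ws = Suc k"
  shows "(\<Sum>i<length ws. (-1) ^ i * pullback_deriv \<omega> c (omit i ws) u (ws ! i))
    = local_form \<A> c (pullback \<tau> \<rho> V (ce_diff \<omega>)) ws u"
proof -
  let ?X = "map (V_local c u) ws" and ?r = "\<rho> (param c u)"
  have f: "?r * a \<in> fin" for a using density_fin[OF density] fin_mult by blast
  let ?a = "\<lambda>i. \<Sum>m<k. \<omega> ((omit i ?X)[m := V_deriv c u (ws ! (if m < i then m else Suc m)) (ws ! i)])"
  have pullback_deriv: "pullback_deriv \<omega> c (omit i ws) u (ws ! i) = tr (?r * (?a i + comm (?X ! i) (\<omega> (omit i ?X))))" if "i < Suc k" for i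
  proof -
    have "omit i ws ! m = ws ! (if m < i then m else Suc m)" if "m < k" for m
      using that \<open>i < Suc k\<close> assms(4) by (auto simp: omit_def nth_append)
    then show ?thesis
      unfolding pullback_deriv_def using that assms(4) by (simp add: length_omit map_omit)
  qed
  have "(\<Sum>i<length ws. (-1) ^ i * pullback_deriv \<omega> c (omit i ws) u (ws ! i))
     = (\<Sum>i<Suc k. tr (?r * ((-1::real) ^ i *\<^sub>R (?a i + comm (?X ! i) (\<omega> (omit i ?X))))))"
    unfolding assms(4)
  proof (intro sum.cong refl)
    fix i assume "i \<in> {..<Suc k}"
    then show "(-1) ^ i * pullback_deriv \<omega> c (omit i ws) u (ws ! i) = tr (?r * ((-1::real) ^ i *\<^sub>R (?a i + comm (?X ! i) (\<omega> (omit i ?X)))))"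
      using tr_scale[OF f, of "(-1) ^ i"] by (simp add: pullback_deriv scaleR_conv_of_real)
  qed
  also have "\<dots> = tr (\<Sum>i<Suc k. ?r * ((-1::real) ^ i *\<^sub>R (?a i + comm (?X ! i) (\<omega> (omit i ?X)))))"
    by (rule tr_sum[symmetric]) (rule f)
  also have "\<dots> = tr (?r * ((\<Sum>i<Suc k. (-1::real) ^ i *\<^sub>R ?a i) + (\<Sum>i<Suc k. (-1::real) ^ i *\<^sub>R comm (?X ! i) (\<omega> (omit i ?X)))))"
    by (simp only: sum_distrib_left sum.distrib scaleR_add_right distrib_left)
  also have "(\<Sum>i<Suc k. (-1::real) ^ i *\<^sub>R ?a i) = (\<Sum>j<Suc k. \<Sum>i<j. (-1::real) ^ (i + j) *\<^sub>R \<omega> (comm (?X ! i) (?X ! j) # omit i (omit j ?X)))"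
    by (rule sum_derivatives_flat[OF algebra_form_alt_form[OF assms(3)], where d = "\<lambda>j i. V_deriv c u (ws ! j) (ws ! i)"])
       (use assms flatness in auto)
  finally show ?thesis by (simp add: local_pullback ce_diff_def assms(4) add.commute)
qed

text \<open>\<open>ce_diff \<omega>\<close> is evaluated at values of \<open>V\<close> and brackets
  of such values, never at derivatives of \<open>V\<close>. Hence it is differentiable along the
  chart, and its state can be differentiated like that of any other element.\<close>

lemma continuous_pullback_ce_diff:
  assumes "c \<in> \<A>" "algebra_form k \<omega>" "length ws = Suc k"
  shows "continuous_on (target c) (local_form \<A> c (pullback \<tau> \<rho> V (ce_diff \<omega>)) ws)"
  unfolding continuous_on_eq_continuous_within
proof
  fix u assume u: "u \<in> target c"
  let ?F = "at u within half_space"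
  have d: "(\<lambda>u. \<omega> (map (V_local c u) vs)) differentiable ?F" if "length vs = k" for vs
  proof -
    have "(\<lambda>u. \<omega> (map (\<lambda>f. f u) (map (\<lambda>v u. V_local c u v) vs))) differentiable ?F"
      by (rule algebra_form_differentiable[OF assms(2)]) (use that V_local_differentiable[OF assms(1) u] in auto)
    then show ?thesis by (simp add: o_def)
  qed
  have d': "(\<lambda>u. \<omega> (comm (V_local c u v) (V_local c u w) # map (V_local c u) vs)) differentiable ?F" if "length vs + 1 = k" for vs v w
  proof -
    have "(\<lambda>u. \<omega> (map (\<lambda>f. f u) ((\<lambda>u. comm (V_local c u v) (V_local c u w)) # map (\<lambda>v u. V_local c u v) vs))) differentiable ?F"
      by (rule algebra_form_differentiable[OF assms(2)]) (use that V_local_differentiable[OF assms(1) u] in \<open>auto simp: comm_def\<close>)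
    then show ?thesis by (simp add: o_def)
  qed
  have "(\<lambda>u. ce_diff \<omega> (map (V_local c u) ws)) differentiable ?F"
    unfolding ce_diff_def length_map assms(3)
  proof (intro derivative_intros differentiable_add differentiable_sum finite_lessThan ballI differentiable_scaleR differentiable_const)
    fix i assume "i \<in> {..<Suc k}"
    then show "(\<lambda>u. comm (map (V_local c u) ws ! i) (\<omega> (omit i (map (V_local c u) ws)))) differentiable ?F"
      unfolding comm_def map_omit[symmetric] using assms(3) d[of "omit i ws"] V_local_differentiable[OF assms(1) u]
      by (auto simp: length_omit)
  next
    fix j i assume ij: "j \<in> {..<Suc k}" "i \<in> {..<j}"
    then have "length (omit i (omit j ws)) + 1 = k" using assms(3) by (simp add: length_omit)
    from d'[OF this] show "(\<lambda>u. \<omega> (comm (map (V_local c u) ws ! i) (map (V_local c u) ws ! j) # omit i (omit j (map (V_local c u) ws)))) differentiable ?F"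
      using ij assms(3) by (simp add: map_omit)
  qed
  then obtain b' where "((\<lambda>u. ce_diff \<omega> (map (V_local c u) ws)) has_derivative b') ?F" unfolding differentiable_def by blast
  from tr_density_has_derivative[OF assms(1) u this]
  have "continuous ?F (local_form \<A> c (pullback \<tau> \<rho> V (ce_diff \<omega>)) ws)"
    unfolding local_pullback[abs_def] by (rule has_derivative_continuous)
  then show "continuous (at u within target c) (local_form \<A> c (pullback \<tau> \<rho> V (ce_diff \<omega>)) ws)"
    using within_target[OF assms(1) u] by simp
qed

lemma pullback_alt_form:
  assumes "c \<in> \<A>" "q \<in> cdom c" "algebra_form k \<omega>"
  shows "alt_form k (\<lambda>vs. pullback \<tau> \<rho> V \<omega> q (map (tv c q) vs))"
proof -
  have eq: "pullback \<tau> \<rho> V \<omega> q (map (tv c q) vs) = tr (\<rho> q * \<omega> (map (V_local c (coords c q)) vs))" for vs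
    using local_pullback[of c \<omega> vs "coords c q"] assms by (simp add: local_form_def)
  have lV: "linear (V_local c (coords c q))" using V_local_linear assms by simp
  have f: "\<rho> q * a \<in> fin" for a using density_fin[OF density] fin_mult by blast
  note w = algebra_form_alt_form[OF assms(3), unfolded alt_form_def]
  show ?thesis
    unfolding alt_form_def eq
  proof (intro conjI allI impI)
    fix as :: "(real^'n::_) list" and i assume i: "length as = k" "i < k"
    have "linear (\<lambda>a. \<omega> ((map (V_local c (coords c q)) as)[i := a]))" using w i by simp
    note l = linear_compose[OF lV this, unfolded o_def]
    show "linear (\<lambda>a. tr (\<rho> q * \<omega> (map (V_local c (coords c q)) (as[i := a]))))"
      unfolding map_update
    proof (rule linearI, goal_cases)
      case (1 a b)
      then show ?case by (simp add: linear_add[OF l] distrib_left tr_add[OF f f])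
    next
      case (2 r a)
      then show ?case by (simp add: linear_scale[OF l] tr_scale[OF f])
    qed
  next
    fix as :: "(real^'n::_) list" and i j assume *: "length as = k" "i < j" "j < k" "as ! i = as ! j"
    then have "\<omega> (map (V_local c (coords c q)) as) = 0" using w by simp
    then show "tr (\<rho> q * \<omega> (map (V_local c (coords c q)) as)) = 0" using tr_scale[OF f, of 0 0] by simp
  qed
qed

end

section \<open>The divergence theorem for differentiable vector fields on boxes\<close>

definition upd :: "real^'n \<Rightarrow> 'n \<Rightarrow> real \<Rightarrow> real^'n" where
  "upd x j t = (\<chi> i. if i = j then t else x $ i)"

lemma upd_nth [simp]: "upd x j t $ i = (if i = j then t else x $ i)"
  by (simp add: upd_def)

lemma continuous_on_upd: "continuous_on S (\<lambda>x. upd x j t)"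
  unfolding upd_def
proof (intro continuous_on_vec_lambda)
  show "continuous_on S (\<lambda>x. if i = j then t else x $ i)" for i
    by (cases "i = j") (auto intro!: continuous_intros)
qed

text \<open>Differentiability of \<open>F\<close> alone does not make the partial derivatives integrable, so the theorem is
  proved by bisection as for Goursat's theorem: the defect is additive in the box and
  \<open>o(volume)\<close> at every point. Face integrals are written as integrals over the whole box.\<close>

definition box_defect ::
  "('n::finite \<Rightarrow> real^'n \<Rightarrow> 'b::banach) \<Rightarrow> (real^'n \<Rightarrow> 'b) \<Rightarrow> real^'n \<Rightarrow> real^'n \<Rightarrow> 'b" where
  "box_defect F g a d =
     (\<Sum>j\<in>UNIV. (1 / d $ j) *\<^sub>R (integral (cbox a (a + d)) (\<lambda>x. F j (upd x j (a $ j + d $ j)))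
        - integral (cbox a (a + d)) (\<lambda>x. F j (upd x j (a $ j))))) - integral (cbox a (a + d)) g"

lemma integral_halves:
  fixes f :: "real^'n::finite \<Rightarrow> 'b::banach"
  assumes "continuous_on (cbox a (a + d)) f" "d $ k > 0"
  shows "integral (cbox a (a + d)) f =
     integral (cbox a (a + upd d k (d $ k / 2))) f +
     integral (cbox (upd a k (a $ k + d $ k / 2)) (upd a k (a $ k + d $ k / 2) + upd d k (d $ k / 2))) f"
proof -
  have all: "(\<forall>i. P i) = (P k \<and> (\<forall>i. i \<noteq> k \<longrightarrow> P i))" for P by metis
  have 1: "cbox a (a + d) \<inter> {x. x \<bullet> axis k 1 \<le> a $ k + d $ k / 2} = cbox a (a + upd d k (d $ k / 2))"
    unfolding set_eq_iff Int_iff mem_box_cart inner_axis mem_Collect_eq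
    by (subst (1 2) all) (use assms(2) in auto)
  have 2: "cbox a (a + d) \<inter> {x. x \<bullet> axis k 1 \<ge> a $ k + d $ k / 2}
     = cbox (upd a k (a $ k + d $ k / 2)) (upd a k (a $ k + d $ k / 2) + upd d k (d $ k / 2))"
    unfolding set_eq_iff Int_iff mem_box_cart inner_axis mem_Collect_eq
    by (subst (1 2) all) (use assms(2) in auto)
  show ?thesis
    using integral_split[OF integrable_continuous[OF assms(1)], of "axis k 1" "a $ k + d $ k / 2"]
    unfolding 1 2 by (simp add: axis_in_Basis_iff)
qed

text \<open>As the integrand does not depend on the coordinate \<open>k\<close>, the translation by
  half a side maps one half of the box to the other without changing the integral.\<close>

lemma integral_halves_invariant:
  fixes f :: "real^'n::finite \<Rightarrow> 'b::banach"
  assumes "continuous_on (cbox a (a + d)) f" "d $ k > 0" and inv: "\<And>x t. f (upd x k t) = f x"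
  shows "2 *\<^sub>R integral (cbox a (a + upd d k (d $ k / 2))) f = integral (cbox a (a + d)) f"
    and "2 *\<^sub>R integral (cbox (upd a k (a $ k + d $ k / 2)) (upd a k (a $ k + d $ k / 2) + upd d k (d $ k / 2))) f
      = integral (cbox a (a + d)) f"
proof -
  let ?s = "(d $ k / 2) *\<^sub>R axis k 1 :: real^'n"
  let ?a = "upd a k (a $ k + d $ k / 2)" and ?d = "upd d k (d $ k / 2)"
  have e1: "a + ?s = ?a" by (auto simp: vec_eq_iff axis_def)
  have e2: "a + ?d + ?s = ?a + ?d" by (auto simp: vec_eq_iff axis_def)
  have "f \<circ> ((+) ?s) = f"
  proof
    fix x
    have "?s + x = upd x k (x $ k + d $ k / 2)" by (auto simp: vec_eq_iff axis_def)
    then show "(f \<circ> ((+) ?s)) x = f x" using inv by simp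
  qed
  then have "integral (cbox a (a + ?d)) f = integral (cbox ?a (?a + ?d)) f"
    using integral_shift_cbox_plus[of a "a + ?d" f ?s] unfolding e1 e2 by simp
  with integral_halves[OF assms(1,2)]
  show "2 *\<^sub>R integral (cbox a (a + ?d)) f = integral (cbox a (a + d)) f"
    and "2 *\<^sub>R integral (cbox ?a (?a + ?d)) f = integral (cbox a (a + d)) f"
    by (simp_all add: scaleR_2)
qed

lemma upd_in_box:
  assumes "x \<in> cbox a b" "a $ j \<le> t" "t \<le> b $ j" shows "upd x j t \<in> cbox a b"
  using assms by (auto simp: mem_box_cart)

text \<open>In direction \<open>k\<close> the two contributions of the middle face cancel: each half
  has half the integral, but the factor \<open>1 / d $ k\<close> doubles. In the other directions
  the integrals over the halves add up to the one over the box.\<close>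

lemma box_defect_halves:
  fixes F :: "'n::finite \<Rightarrow> real^'n \<Rightarrow> 'b::banach"
  assumes F: "\<And>j. continuous_on (cbox a (a + d)) (F j)" and g: "continuous_on (cbox a (a + d)) g"
    and d: "\<And>j. d $ j > 0"
  shows "box_defect F g a d = box_defect F g a (upd d k (d $ k / 2))
     + box_defect F g (upd a k (a $ k + d $ k / 2)) (upd d k (d $ k / 2))"
proof -
  let ?d = "upd d k (d $ k / 2)" and ?a = "upd a k (a $ k + d $ k / 2)"
  let ?B = "cbox a (a + d)" and ?L = "cbox a (a + ?d)" and ?R = "cbox ?a (?a + ?d)"
  have c: "continuous_on ?B (\<lambda>x. F j (upd x j t))" if "a $ j \<le> t" "t \<le> a $ j + d $ j" for j t
    by (rule continuous_on_compose2[OF F continuous_on_upd]) (use that in \<open>auto intro!: upd_in_box\<close>)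
  have inv: "F k (upd (upd x k s) k t) = F k (upd x k t)" for x s t
    by (rule arg_cong[of _ _ "F k"]) (simp add: vec_eq_iff)
  have dk: "d $ k > 0" by (rule d)
  let ?I = "\<lambda>S j t. integral S (\<lambda>x. F j (upd x j t))"
  have j: "(1 / d $ j) *\<^sub>R (?I ?B j (a $ j + d $ j) - ?I ?B j (a $ j))
    = (1 / ?d $ j) *\<^sub>R (?I ?L j (a $ j + ?d $ j) - ?I ?L j (a $ j))
     + (1 / ?d $ j) *\<^sub>R (?I ?R j (?a $ j + ?d $ j) - ?I ?R j (?a $ j))" for j
  proof (cases "j = k")
    case True
    have L: "?I ?L k t = (1/2) *\<^sub>R ?I ?B k t" and R: "?I ?R k t = (1/2) *\<^sub>R ?I ?B k t"
      if "a $ k \<le> t" "t \<le> a $ k + d $ k" for t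
      unfolding integral_halves_invariant(1)[OF c[OF that] dk inv, symmetric]
      by (simp, simp flip: integral_halves_invariant(2)[OF c[OF that] dk inv] add: integral_halves_invariant(1)[OF c[OF that] dk inv])
    have m: "a $ k \<le> a $ k + d $ k / 2" "a $ k + d $ k / 2 \<le> a $ k + d $ k" using dk by auto
    have e: "a $ k + d $ k / 2 + d $ k / 2 = a $ k + d $ k" by simp
    have q: "a $ k \<le> a $ k + d $ k" "a $ k \<le> a $ k" "a $ k + d $ k \<le> a $ k + d $ k" using dk by auto
    show ?thesis
      unfolding True using m q
      by (simp add: e L R scaleR_diff_right add.assoc)
  next
    case False
    have "a $ j \<le> a $ j + d $ j" using d[of j] by simp
    then have "?I ?B j t = ?I ?L j t + ?I ?R j t" if "t = a $ j \<or> t = a $ j + d $ j" for t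
      using integral_halves[OF c dk] that by auto
    then show ?thesis using False by (simp add: scaleR_add_right[symmetric])
  qed
  show ?thesis
    unfolding box_defect_def j sum.distrib integral_halves[OF g dk] by simp
qed

text \<open>The coordinates are halved one after another. Each cut keeps the half with the larger
  defect, at the cost of a factor 2.\<close>

lemma box_defect_quarter:
  fixes F :: "'n::finite \<Rightarrow> real^'n \<Rightarrow> 'b::banach"
  assumes F: "\<And>j. continuous_on (cbox a (a + d)) (F j)" and g: "continuous_on (cbox a (a + d)) g"
    and d: "\<And>j. d $ j > 0"
  obtains a' where "cbox a' (a' + (1/2) *\<^sub>R d) \<subseteq> cbox a (a + d)"
    "norm (box_defect F g a d) \<le> 2 ^ CARD('n) * norm (box_defect F g a' ((1/2) *\<^sub>R d))"
proof -
  \<comment> \<open>The side lengths after the coordinates in \<open>J\<close> have been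
    halved.\<close>
  define h where "h J = (\<chi> i. if i \<in> J then d $ i / 2 else d $ i)" for J
  have "\<exists>a'. cbox a' (a' + h J) \<subseteq> cbox a (a + d) \<and>
      norm (box_defect F g a d) \<le> 2 ^ card J * norm (box_defect F g a' (h J))" if "finite J" for J
    using that
  proof induction
    case empty
    have "h {} = d" by (simp add: h_def vec_eq_iff)
    then show ?case by (intro exI[of _ a]) auto
  next
    case (insert k J)
    then obtain b where b: "cbox b (b + h J) \<subseteq> cbox a (a + d)"
      "norm (box_defect F g a d) \<le> 2 ^ card J * norm (box_defect F g b (h J))" by blast
    have hk: "h J $ k = d $ k" using insert by (simp add: h_def)
    have h: "upd (h J) k (h J $ k / 2) = h (insert k J)" unfolding hk by (auto simp: h_def vec_eq_iff)
    let ?b = "upd b k (b $ k + h J $ k / 2)"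
    have pos: "h J $ i > 0" "h (insert k J) $ i > 0" for i using d[of i] by (auto simp: h_def)
    have "box_defect F g b (h J) = box_defect F g b (h (insert k J)) + box_defect F g ?b (h (insert k J))"
      using box_defect_halves[of b "h J" F g k] continuous_on_subset[OF F b(1)] continuous_on_subset[OF g b(1)] pos
      unfolding h by blast
    then have "norm (box_defect F g b (h J)) \<le> norm (box_defect F g b (h (insert k J))) + norm (box_defect F g ?b (h (insert k J)))"
      by (simp add: norm_triangle_ineq)
    then have "\<exists>b'. (b' = b \<or> b' = ?b) \<and> norm (box_defect F g b (h J)) \<le> 2 * norm (box_defect F g b' (h (insert k J)))"
      by (cases "norm (box_defect F g b (h (insert k J))) \<le> norm (box_defect F g ?b (h (insert k J)))")
         (auto intro: exI[of _ b] exI[of _ ?b])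
    then obtain b' where b': "b' = b \<or> b' = ?b" "norm (box_defect F g b (h J)) \<le> 2 * norm (box_defect F g b' (h (insert k J)))"
      by blast
    have "b $ i \<le> b' $ i \<and> b' $ i + h (insert k J) $ i \<le> b $ i + h J $ i" for i
      using b'(1) d[of i] unfolding h[symmetric] by (auto simp: hk)
    then have "cbox b' (b' + h (insert k J)) \<subseteq> cbox b (b + h J)"
      by (auto simp: mem_box_cart) (meson order_trans)+
    moreover have "norm (box_defect F g a d) \<le> 2 ^ card J * (2 * norm (box_defect F g b' (h (insert k J))))"
      using b(2) b'(2) by (meson mult_left_mono order_trans zero_le_power zero_le_numeral)
    ultimately show ?case using b(1) insert by (intro exI[of _ b']) (auto simp: mult_ac)
  qed
  from this[of UNIV] obtain a' where "cbox a' (a' + h UNIV) \<subseteq> cbox a (a + d)"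
    "norm (box_defect F g a d) \<le> 2 ^ CARD('n) * norm (box_defect F g a' (h UNIV))" by auto
  moreover have "h UNIV = (1/2) *\<^sub>R d" by (simp add: h_def vec_eq_iff)
  ultimately show ?thesis using that by metis
qed

text \<open>The affine approximation of \<open>F\<close> at \<open>x\<close> has defect 0 against
  the constant \<open>g x\<close>: its difference quotients are exactly the summands of
  \<open>g x\<close>. What remains is at most \<open>e\<close> times diameter over side length, and
  \<open>K\<close> bounds the ratio of any two sides.\<close>

lemma box_defect_local:
  fixes F :: "'n::finite \<Rightarrow> real^'n \<Rightarrow> 'b::banach"
  assumes F: "\<And>j. continuous_on (cbox a (a + d)) (F j)" and g: "continuous_on (cbox a (a + d)) g"
    and d: "\<And>j. d $ j > 0" and x: "x \<in> cbox a (a + d)"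
    and lin: "\<And>j. linear (F' j)" and div: "g x = (\<Sum>j\<in>UNIV. F' j (axis j 1))"
    and Fe: "\<And>j y. y \<in> cbox a (a + d) \<Longrightarrow> norm (F j y - F j x - F' j (y - x)) \<le> e * norm (y - x)"
    and ge: "\<And>y. y \<in> cbox a (a + d) \<Longrightarrow> norm (g y - g x) \<le> e"
    and ratio: "\<And>i j. d $ i \<le> K * d $ j" and e: "e \<ge> 0"
  shows "norm (box_defect F g a d) \<le> e * (1 + 2 * (real CARD('n))\<^sup>2 * K) * (\<Prod>i\<in>UNIV. d $ i)"
proof -
  let ?B = "cbox a (a + d)"
  have c: "continuous_on ?B (\<lambda>x. F j (upd x j t))" if "a $ j \<le> t" "t \<le> a $ j + d $ j" for j t
    by (rule continuous_on_compose2[OF F continuous_on_upd]) (use that in \<open>auto intro!: upd_in_box\<close>)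
  have c1: "continuous_on ?B (\<lambda>x. F j (upd x j (a $ j + d $ j)))" "continuous_on ?B (\<lambda>x. F j (upd x j (a $ j)))" for j
    using d[of j] by (auto intro!: c)
  define H where "H y = (\<Sum>j\<in>UNIV. (1 / d $ j) *\<^sub>R (F j (upd y j (a $ j + d $ j)) - F j (upd y j (a $ j)))) - g y" for y
  have H: "continuous_on ?B H" unfolding H_def by (intro continuous_intros c1 g)
  have eq: "box_defect F g a d = integral ?B H"
    unfolding box_defect_def H_def
    by (simp add: integral_diff integral_sum integrable_continuous c1 g continuous_intros)
  have K0: "K \<ge> 0" using ratio[of undefined undefined] d[of undefined] by (smt (verit) mult_neg_pos)
  have diam: "norm (y - x) \<le> real CARD('n) * K * d $ j" if "y \<in> ?B" for y j
  proof -
    have "\<bar>(y - x) $ i\<bar> \<le> d $ i" for i using that x unfolding mem_box_cart by (simp add: abs_le_iff) (smt (verit))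
    then have "\<bar>(y - x) $ i\<bar> \<le> K * d $ j" for i using ratio order_trans by blast
    then have "(\<Sum>i\<in>UNIV. \<bar>(y - x) $ i\<bar>) \<le> (\<Sum>i\<in>(UNIV::'n set). K * d $ j)" by (intro sum_mono)
    then show ?thesis using norm_le_l1_cart[of "y - x"] by simp
  qed
  have "norm (H y) \<le> e * (1 + 2 * (real CARD('n))\<^sup>2 * K)" if y: "y \<in> ?B" for y
  proof -
    define p q where "p j = upd y j (a $ j + d $ j)" "q j = upd y j (a $ j)" for j
    have pq: "p j \<in> ?B" "q j \<in> ?B" for j
      using y d[of j] unfolding p_q_def by (auto intro!: upd_in_box)
    define r where "r j z = F j z - F j x - F' j (z - x)" for j z
    have pqd: "(p j - x) - (q j - x) = d $ j *\<^sub>R axis j 1" for j by (auto simp: p_q_def vec_eq_iff axis_def)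
    have "(1 / d $ j) *\<^sub>R (F j (p j) - F j (q j)) = F' j (axis j 1) + (1 / d $ j) *\<^sub>R (r j (p j) - r j (q j))" for j
    proof -
      have "F j (p j) - F j (q j) = F' j ((p j - x) - (q j - x)) + (r j (p j) - r j (q j))"
        by (simp add: r_def linear_diff[OF lin])
      then show ?thesis unfolding pqd using d[of j] by (simp add: linear_scale[OF lin] scaleR_add_right)
    qed
    then have "H y = (\<Sum>j\<in>UNIV. (1 / d $ j) *\<^sub>R (r j (p j) - r j (q j))) - (g y - g x)"
      unfolding H_def p_q_def[symmetric] div by (simp add: sum.distrib)
    also have "norm \<dots> \<le> norm (\<Sum>j\<in>UNIV. (1 / d $ j) *\<^sub>R (r j (p j) - r j (q j))) + norm (g y - g x)"
      by (rule norm_triangle_ineq4)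
    also have "\<dots> \<le> (\<Sum>j\<in>(UNIV::'n set). 2 * (e * (real CARD('n) * K))) + e"
    proof (intro add_mono ge y order_trans[OF norm_sum] sum_mono)
      fix j
      have r: "norm (r j z) \<le> e * (real CARD('n) * K * d $ j)" if "z \<in> ?B" for z
        using Fe[OF that, of j] mult_left_mono[OF diam[OF that, of j] e] by (simp add: r_def)
      have "norm (r j (p j) - r j (q j)) \<le> 2 * (e * (real CARD('n) * K * d $ j))"
        using r[OF pq(1)] r[OF pq(2)] norm_triangle_ineq4[of "r j (p j)" "r j (q j)"] by (smt (verit))
      then show "norm ((1 / d $ j) *\<^sub>R (r j (p j) - r j (q j))) \<le> 2 * (e * (real CARD('n) * K))"
        unfolding norm_scaleR using d[of j] by (simp add: field_simps)
    qed
    also have "\<dots> = e * (1 + 2 * (real CARD('n))\<^sup>2 * K)" by (simp add: algebra_simps power2_eq_square)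
    finally show ?thesis .
  qed
  moreover have "(H has_integral box_defect F g a d) ?B"
    unfolding eq using integrable_continuous[OF H] by (rule integrable_integral)
  moreover have "0 \<le> e * (1 + 2 * (real CARD('n))\<^sup>2 * K)" using e K0 by simp
  ultimately have "norm (box_defect F g a d) \<le> e * (1 + 2 * (real CARD('n))\<^sup>2 * K) * measure lborel ?B"
    using has_integral_bound by blast
  moreover have "?B \<noteq> {}" using x by blast
  ultimately show ?thesis by (simp add: content_cbox_cart)
qed

text \<open>The box of stage \<open>m\<close> keeps at least the fraction
  \<open>1 / (2 ^ CARD('n)) ^ m\<close> of the defect, while near the common point of all the boxes
  \<open>box_defect_local\<close> bounds it by \<open>e * C\<close> times the same fraction.\<close>

theorem box_divergence:
  fixes F :: "'n::finite \<Rightarrow> real^'n \<Rightarrow> 'b::banach"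
  assumes der: "\<And>j x. x \<in> cbox a (a + d) \<Longrightarrow> (F j has_derivative F' j x) (at x within cbox a (a + d))"
    and g: "continuous_on (cbox a (a + d)) g" and div: "\<And>x. x \<in> cbox a (a + d) \<Longrightarrow> g x = (\<Sum>j\<in>UNIV. F' j x (axis j 1))"
    and d: "\<And>j. d $ j > 0"
  shows "box_defect F g a d = 0"
proof -
  let ?B = "cbox a (a + d)"
  have F: "continuous_on ?B (F j)" for j using der has_derivative_continuous_on by blast
  let ?d = "\<lambda>m. (1 / 2 ^ m) *\<^sub>R d"
  let ?P = "\<lambda>m b. cbox b (b + ?d m) \<subseteq> ?B \<and> norm (box_defect F g a d) \<le> (2 ^ CARD('n)) ^ m * norm (box_defect F g b (?d m))"
  have "\<exists>b. \<forall>m. ?P m (b m) \<and> cbox (b (Suc m)) (b (Suc m) + ?d (Suc m)) \<subseteq> cbox (b m) (b m + ?d m)"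
  proof (rule dependent_nat_choice)
    show "\<exists>b. ?P 0 b" by (intro exI[of _ a]) simp
    fix b m assume b: "?P m b"
    have "?d m $ j > 0" for j using d[of j] by simp
    then obtain b' where b': "cbox b' (b' + (1/2) *\<^sub>R ?d m) \<subseteq> cbox b (b + ?d m)"
      "norm (box_defect F g b (?d m)) \<le> 2 ^ CARD('n) * norm (box_defect F g b' ((1/2) *\<^sub>R ?d m))"
      using box_defect_quarter[of b "?d m" F g] b continuous_on_subset[OF F] continuous_on_subset[OF g] by metis
    have s: "(1/2) *\<^sub>R ?d m = ?d (Suc m)" by simp
    have "norm (box_defect F g a d) \<le> (2 ^ CARD('n)) ^ m * (2 ^ CARD('n) * norm (box_defect F g b' (?d (Suc m))))"
      using b b'(2) unfolding s by (meson mult_left_mono order_trans zero_le_power zero_le_numeral)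
    then show "\<exists>b'. ?P (Suc m) b' \<and> cbox b' (b' + ?d (Suc m)) \<subseteq> cbox b (b + ?d m)"
      using b b'(1) unfolding s by (intro exI[of _ b']) (auto simp: mult_ac)
  qed
  then obtain b where b: "\<And>m. cbox (b m) (b m + ?d m) \<subseteq> ?B"
    "\<And>m. norm (box_defect F g a d) \<le> (2 ^ CARD('n)) ^ m * norm (box_defect F g (b m) (?d m))"
    "\<And>m. cbox (b (Suc m)) (b (Suc m) + ?d (Suc m)) \<subseteq> cbox (b m) (b m + ?d m)" by blast
  have "b m \<in> cbox (b m) (b m + ?d m)" for m using d by (auto simp: mem_box_cart less_imp_le)
  then have "(\<Inter>m. cbox (b m) (b m + ?d m)) \<noteq> {}"
    by (intro compact_nest compact_cbox lift_Suc_antimono_le[of "\<lambda>m. cbox (b m) (b m + ?d m)", OF b(3)]) auto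
  then obtain x where x: "\<And>m. x \<in> cbox (b m) (b m + ?d m)" by blast
  have xB: "x \<in> ?B" using b(1) x by blast
  \<comment> \<open>All boxes of the bisection have sides proportional to \<open>d\<close>, so one
    bound on the ratios serves for all of them.\<close>
  define K where "K = (\<Sum>i\<in>UNIV. \<Sum>j\<in>UNIV. d $ i / d $ j)"
  have ratio: "d $ i \<le> K * d $ j" for i j
  proof -
    have "d $ i / d $ j \<le> (\<Sum>j\<in>UNIV. d $ i / d $ j)" using d by (intro member_le_sum) (auto simp: less_imp_le)
    also have "\<dots> \<le> K" unfolding K_def using d by (intro member_le_sum[of i]) (auto intro!: sum_nonneg simp: less_imp_le)
    finally show ?thesis using d[of j] by (simp add: field_simps)
  qed
  have K0: "K \<ge> 0" unfolding K_def using d by (intro sum_nonneg) (auto simp: less_imp_le)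
  define C where "C = (1 + 2 * (real CARD('n))\<^sup>2 * K) * (\<Prod>i\<in>UNIV. d $ i)"
  have C: "C > 0" unfolding C_def using K0 d by (intro mult_pos_pos prod_pos add_pos_nonneg) auto
  have "norm (box_defect F g a d) \<le> e * C" if e: "e > 0" for e
  proof -
    have "\<forall>j. \<exists>\<delta>>0. \<forall>y\<in>?B. norm (y - x) < \<delta> \<longrightarrow> norm (F j y - F j x - F' j x (y - x)) \<le> e * norm (y - x)"
      using der[OF xB] e unfolding has_derivative_within_alt by blast
    then obtain \<delta> where \<delta>: "\<And>j. \<delta> j > 0" "\<And>j y. y \<in> ?B \<Longrightarrow> norm (y - x) < \<delta> j \<Longrightarrow> norm (F j y - F j x - F' j x (y - x)) \<le> e * norm (y - x)"
      by metis
    obtain \<delta>' where \<delta>': "\<delta>' > 0" "\<And>y. y \<in> ?B \<Longrightarrow> norm (y - x) < \<delta>' \<Longrightarrow> norm (g y - g x) < e"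
      using g xB e unfolding continuous_on_iff dist_norm by blast
    define \<eta> where "\<eta> = min \<delta>' (Min (range \<delta>))"
    have \<eta>: "\<eta> > 0" "\<eta> \<le> \<delta>'" "\<And>j. \<eta> \<le> \<delta> j" using \<delta>(1) \<delta>'(1) by (auto simp: \<eta>_def min_le_iff_disj)
    obtain m where m: "norm d / 2 ^ m < \<eta>"
      using real_arch_pow_inv[of "\<eta> / (norm d + 1)" "1/2"] \<eta>(1)
    proof -
      assume a: "\<And>m. norm d / 2 ^ m < \<eta> \<Longrightarrow> thesis"
      have "0 < \<eta> / (norm d + 1)" using \<eta>(1) by (simp add: add_nonneg_pos)
      then obtain m where "(1/2) ^ m < \<eta> / (norm d + 1)" using real_arch_pow_inv[of "\<eta> / (norm d + 1)" "1/2"] by auto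
      then have "(norm d + 1) * (1/2) ^ m < \<eta>"
        using pos_less_divide_eq[of "norm d + 1" "(1/2) ^ m" \<eta>] by (simp add: mult.commute add_nonneg_pos)
      moreover have "norm d * (1/2) ^ m \<le> (norm d + 1) * (1/2) ^ m" by (intro mult_right_mono) auto
      ultimately show thesis by (intro a[of m]) (simp add: power_one_over)
    qed
    let ?S = "cbox (b m) (b m + ?d m)"
    have small: "norm (y - x) < \<eta>" if "y \<in> ?S" for y
    proof -
      have "\<bar>(y - x) $ i\<bar> \<le> \<bar>?d m $ i\<bar>" for i
      proof -
        have "b m $ i \<le> y $ i" "y $ i \<le> b m $ i + ?d m $ i" "b m $ i \<le> x $ i" "x $ i \<le> b m $ i + ?d m $ i"
          using that x[of m] unfolding mem_box_cart by auto
        then show ?thesis unfolding vector_minus_component by linarith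
      qed
      then have "norm (y - x) \<le> norm (?d m)" by (rule norm_le_componentwise_cart[of "y - x" "?d m", unfolded real_norm_def])
      then show ?thesis using m by simp
    qed
    have "norm (box_defect F g (b m) (?d m)) \<le> e * (1 + 2 * (real CARD('n))\<^sup>2 * K) * (\<Prod>i\<in>UNIV. ?d m $ i)"
    proof (rule box_defect_local[where x = x and F' = "\<lambda>j. F' j x"])
      show "continuous_on ?S (F j)" for j using continuous_on_subset[OF F b(1)] .
      show "continuous_on ?S g" using continuous_on_subset[OF g b(1)] .
      show "linear (F' j x)" for j using der[OF xB] has_derivative_linear by blast
      show "norm (F j y - F j x - F' j x (y - x)) \<le> e * norm (y - x)" if "y \<in> ?S" for j y
        using \<delta>(2)[of y j] b(1) small[OF that] \<eta>(3)[of j] that by fastforce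
      show "norm (g y - g x) \<le> e" if "y \<in> ?S" for y
        using \<delta>'(2)[of y] b(1) small[OF that] \<eta>(2) that by fastforce
      show "?d m $ i \<le> K * ?d m $ j" for i j using ratio[of i j] by (simp add: divide_right_mono)
    qed (use x div[OF xB] d e in auto)
    \<comment> \<open>The volume shrinks by exactly the factor that was lost in passing to the
      smaller box.\<close>
    also have "(\<Prod>i\<in>UNIV. ?d m $ i) = (\<Prod>i\<in>UNIV. d $ i) / (2 ^ CARD('n)) ^ m"
      by (simp add: prod_dividef power_mult[symmetric] mult.commute)
    finally have "norm (box_defect F g (b m) (?d m)) \<le> e * C / (2 ^ CARD('n)) ^ m" by (simp add: C_def)
    then have "(2 ^ CARD('n)) ^ m * norm (box_defect F g (b m) (?d m)) \<le> e * C"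
      by (simp add: pos_le_divide_eq mult.commute)
    then show ?thesis using b(2)[of m] by simp
  qed
  then have "norm (box_defect F g a d) \<le> e" if "e > 0" for e
    using that C by (metis divide_pos_pos nonzero_eq_divide_eq less_irrefl)
  then show ?thesis by (metis dense norm_le_zero_iff not_less order_refl zero_less_norm_iff)
qed

section \<open>Integrals over the half-space and its boundary\<close>

lemma prod_Basis_vec: "(\<Prod>b\<in>(Basis :: (real^'n::finite) set). h b) = (\<Prod>i\<in>UNIV. h (axis i 1))"
proof -
  have 1: "(Basis :: (real^'n) set) = (\<lambda>i. axis i 1) ` UNIV" by (auto simp: Basis_vec_def)
  have 2: "inj (\<lambda>i::'n. axis i (1::real))" by (auto simp: inj_on_def axis_eq_axis)
  show ?thesis unfolding 1 prod.reindex[OF 2] o_def ..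
qed

lemma lborel_vec_eqI:
  fixes M :: "(real^'n::finite) measure"
  assumes "\<And>l u. (\<And>i. l $ i \<le> u $ i) \<Longrightarrow> emeasure M (box l u) = ennreal (\<Prod>i\<in>UNIV. u $ i - l $ i)"
    and "sets M = sets borel"
  shows "lborel = M"
proof (rule lborel_eqI)
  fix l u :: "real^'n" assume "\<And>b. b \<in> Basis \<Longrightarrow> l \<bullet> b \<le> u \<bullet> b"
  then have "l $ i \<le> u $ i" for i by (auto simp: Basis_vec_def cart_eq_inner_axis)
  then show "emeasure M (box l u) = (\<Prod>b\<in>Basis. (u - l) \<bullet> b)"
    by (simp add: assms(1) prod_Basis_vec inner_axis)
qed (rule assms(2))

lemma borel_measurable_vec_lambda:
  fixes f :: "'a \<Rightarrow> 'n::finite \<Rightarrow> real"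
  assumes "\<And>j. (\<lambda>x. f x j) \<in> borel_measurable M"
  shows "(\<lambda>x. \<chi> j. f x j) \<in> borel_measurable M"
  by (subst borel_measurable_euclidean_space) (use assms in \<open>auto simp: Basis_vec_def inner_axis\<close>)

lemma lborel_vec: "(lborel :: (real^'n::finite) measure) = distr (Pi\<^sub>M UNIV (\<lambda>_. lborel)) borel (\<lambda>f. \<chi> j. f j)"
proof (rule lborel_vec_eqI)
  interpret product_sigma_finite "\<lambda>_::'n. lborel :: real measure" ..
  have m: "(\<lambda>f. \<chi> j. f j :: real^'n) \<in> borel_measurable (Pi\<^sub>M UNIV (\<lambda>_. lborel))"
    by (intro borel_measurable_vec_lambda) measurable
  fix l u :: "real^'n" assume le: "\<And>i. l $ i \<le> u $ i"
  have "emeasure (distr (Pi\<^sub>M UNIV (\<lambda>_. lborel)) borel (\<lambda>f. \<chi> j. f j)) (box l u)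
    = emeasure (Pi\<^sub>M UNIV (\<lambda>_. lborel)) (Pi\<^sub>E UNIV (\<lambda>j. {l $ j <..< u $ j}))"
    using m by (subst emeasure_distr) (auto simp: space_PiM PiE_UNIV_domain Pi_iff mem_box_cart intro!: arg_cong2[where f = emeasure])
  also have "\<dots> = (\<Prod>j\<in>UNIV. emeasure lborel {l $ j <..< u $ j})"
    by (rule emeasure_PiM) auto
  also have "\<dots> = ennreal (\<Prod>i\<in>UNIV. u $ i - l $ i)"
    using le by (simp add: prod_ennreal)
  finally show "emeasure (distr (Pi\<^sub>M UNIV (\<lambda>_. lborel)) borel (\<lambda>f. \<chi> j. f j)) (box l u) = ennreal (\<Prod>i\<in>UNIV. u $ i - l $ i)" .
qed simp

definition boundary_proj :: "real^'n::{finite,linorder} \<Rightarrow> real^'n::_" where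
  "boundary_proj x = upd x first_coord 0"

text \<open>For \<open>s < t\<close> this is the uniform probability density in the first
  coordinate; its mass 1 makes the projected measure independent of the position and thickness of
  the slab.\<close>

definition slab_density :: "real \<Rightarrow> real \<Rightarrow> real^'n::{finite,linorder} \<Rightarrow> real" where
  "slab_density s t x = indicator {s..t} (x $ first_coord) / (t - s)"

lemma boundary_proj_measurable [measurable]: "boundary_proj \<in> borel_measurable borel"
  unfolding boundary_proj_def[abs_def] by (intro borel_measurable_continuous_onI continuous_on_upd)

lemma slab_density_measurable [measurable]: "slab_density s t \<in> borel_measurable borel"
  unfolding slab_density_def[abs_def] by measurable

lemma sets_hyperplane_lborel [simp, measurable_cong]: "sets hyperplane_lborel = sets borel"
  by (simp add: hyperplane_lborel_def)

text \<open>A slab of \<open>n\<close>-dimensional space projects to the \<open>(n-1)\<close>-dimensional measure; this reduces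
  integrals over the boundary to integrals over \<open>\<real>\<^sup>n\<close>.\<close>

lemma hyperplane_lborel_slab:
  assumes "s < t"
  shows "(hyperplane_lborel :: (real^'n::{finite,linorder}) measure) = distr (density lborel (slab_density s t)) borel boundary_proj"
proof (rule measure_eqI)
  interpret product_sigma_finite "\<lambda>_::'n. lborel :: real measure" ..
  fix A :: "(real^'n::_) set" assume "A \<in> sets hyperplane_lborel"
  then have A [measurable]: "A \<in> sets borel" by simp
  let ?I = "UNIV - {first_coord} :: 'n set"
  let ?P = "\<lambda>f. (\<chi> j. if j = first_coord then 0 else f j) :: real^'n::_"
  have P [measurable]: "?P \<in> borel_measurable (Pi\<^sub>M ?I (\<lambda>_. lborel))"
  proof (intro borel_measurable_vec_lambda)
    show "(\<lambda>f. if j = first_coord then 0 else f j) \<in> borel_measurable (Pi\<^sub>M ?I (\<lambda>_. lborel :: real measure))" for j :: 'n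
      by (cases "j = first_coord") auto
  qed
  have V [measurable]: "(\<lambda>f. \<chi> j. f j :: real^'n::_) \<in> borel_measurable (Pi\<^sub>M UNIV (\<lambda>_. lborel))"
    by (intro borel_measurable_vec_lambda) measurable
  have ins: "insert first_coord ?I = UNIV" by auto
  have "emeasure (distr (density lborel (slab_density s t)) borel boundary_proj) A
    = (\<integral>\<^sup>+x. ennreal (slab_density s t x) * indicator A (boundary_proj x) \<partial>lborel)"
  proof -
    have "emeasure (distr (density lborel (slab_density s t)) borel boundary_proj) A
      = (\<integral>\<^sup>+x. indicator A x \<partial>distr (density lborel (slab_density s t)) borel boundary_proj)"
      by (rule nn_integral_indicator[symmetric]) simp
    also have "\<dots> = (\<integral>\<^sup>+x. indicator A (boundary_proj x) \<partial>density lborel (slab_density s t))"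
      by (rule nn_integral_distr) simp_all
    also have "\<dots> = (\<integral>\<^sup>+x. ennreal (slab_density s t x) * indicator A (boundary_proj x) \<partial>lborel)"
      by (rule nn_integral_density) simp_all
    finally show ?thesis .
  qed
  also have "\<dots> = (\<integral>\<^sup>+f. ennreal (slab_density s t (\<chi> j. f j)) * indicator A (boundary_proj (\<chi> j. f j)) \<partial>Pi\<^sub>M UNIV (\<lambda>_. lborel))"
    unfolding lborel_vec by (subst nn_integral_distr) simp_all
  also have "\<dots> = (\<integral>\<^sup>+f. ennreal (slab_density s t (\<chi> j. f j)) * indicator A (boundary_proj (\<chi> j. f j)) \<partial>Pi\<^sub>M (insert first_coord ?I) (\<lambda>_. lborel))"
    unfolding ins ..
  \<comment> \<open>Fubini splits off the first coordinate: \<open>boundary_proj\<close> forgets it,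
    and the density depends on nothing else.\<close>
  also have "\<dots> = (\<integral>\<^sup>+f. (\<integral>\<^sup>+y. ennreal (slab_density s t (\<chi> j. (f(first_coord := y)) j))
      * indicator A (boundary_proj (\<chi> j. (f(first_coord := y)) j)) \<partial>lborel) \<partial>Pi\<^sub>M ?I (\<lambda>_. lborel))"
    by (rule product_nn_integral_insert) (simp_all add: ins)
  also have "\<dots> = (\<integral>\<^sup>+f. indicator A (?P f) \<partial>Pi\<^sub>M ?I (\<lambda>_. lborel))"
  proof (rule nn_integral_cong)
    fix f :: "'n \<Rightarrow> real"
    have "boundary_proj (\<chi> j. (f(first_coord := y)) j) = ?P f" for y
      by (auto simp: boundary_proj_def vec_eq_iff)
    moreover have "slab_density s t (\<chi> j. (f(first_coord := y)) j) = indicator {s..t} y * (1 / (t - s))" for y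
      by (simp add: slab_density_def)
    moreover have "(\<integral>\<^sup>+y. ennreal (indicator {s..t} y * (1 / (t - s))) * indicator A (?P f) \<partial>lborel)
       = (\<integral>\<^sup>+y. (ennreal (1 / (t - s)) * indicator A (?P f)) * indicator {s..t} y \<partial>lborel)"
      by (intro nn_integral_cong) (auto simp: indicator_def)
    moreover have "\<dots> = (ennreal (1 / (t - s)) * indicator A (?P f)) * ennreal (t - s)"
      using assms by (simp add: nn_integral_cmult_indicator)
    moreover have "ennreal (1 / (t - s)) * ennreal (t - s) = 1"
      using assms by (simp add: ennreal_mult[symmetric])
    then have "(ennreal (1 / (t - s)) * indicator A (?P f)) * ennreal (t - s) = indicator A (?P f)"
      by (metis (no_types) mult.commute mult.left_commute mult.right_neutral)
    ultimately show "(\<integral>\<^sup>+y. ennreal (slab_density s t (\<chi> j. (f(first_coord := y)) j))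
      * indicator A (boundary_proj (\<chi> j. (f(first_coord := y)) j)) \<partial>lborel) = indicator A (?P f)"
      by simp
  qed
  also have "\<dots> = emeasure hyperplane_lborel A"
    unfolding hyperplane_lborel_def
  proof -
    have "emeasure (distr (Pi\<^sub>M ?I (\<lambda>_. lborel)) borel ?P) A = (\<integral>\<^sup>+x. indicator A x \<partial>distr (Pi\<^sub>M ?I (\<lambda>_. lborel)) borel ?P)"
      by (rule nn_integral_indicator[symmetric]) simp
    also have "\<dots> = (\<integral>\<^sup>+f. indicator A (?P f) \<partial>Pi\<^sub>M ?I (\<lambda>_. lborel))"
      by (rule nn_integral_distr) simp_all
    finally show "(\<integral>\<^sup>+f. indicator A (?P f) \<partial>Pi\<^sub>M ?I (\<lambda>_. lborel)) = emeasure (distr (Pi\<^sub>M ?I (\<lambda>_. lborel)) borel ?P) A" ..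
  qed
  finally show "emeasure hyperplane_lborel A = emeasure (distr (density lborel (slab_density s t)) borel boundary_proj) A" ..
qed simp

lemma integral_hyperplane_slab:
  fixes f :: "real^'n::{finite,linorder} \<Rightarrow> complex"
  assumes "s < t" and f [measurable]: "f \<in> borel_measurable borel"
  shows "integral\<^sup>L hyperplane_lborel f = (LINT x|lborel. slab_density s t x *\<^sub>R f (boundary_proj x))"
    and "integrable hyperplane_lborel f \<longleftrightarrow> integrable lborel (\<lambda>x. slab_density s t x *\<^sub>R f (boundary_proj x))"
proof -
  have nn: "AE x in lborel. 0 \<le> slab_density s t (x :: real^'n::_)" using assms(1) by (simp add: slab_density_def)
  show "integral\<^sup>L hyperplane_lborel f = (LINT x|lborel. slab_density s t x *\<^sub>R f (boundary_proj x))"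
    unfolding hyperplane_lborel_slab[OF assms(1)]
    by (subst integral_distr) (use nn in \<open>auto intro!: integral_density\<close>)
  show "integrable hyperplane_lborel f \<longleftrightarrow> integrable lborel (\<lambda>x. slab_density s t x *\<^sub>R f (boundary_proj x))"
    unfolding hyperplane_lborel_slab[OF assms(1)]
    by (subst integrable_distr_eq) (use nn in \<open>simp_all add: integrable_density\<close>)
qed

text \<open>The box has one face on the boundary hyperplane and all its other faces outside the
  support, so only one face integral survives. It belongs to the upper face of the first coordinate,
  the outward direction, and therefore carries the sign plus.\<close>

lemma half_space_stokes:
  fixes f :: "'n::{finite,linorder} \<Rightarrow> real^'n::_ \<Rightarrow> complex"
  assumes K: "compact K"
    and der: "\<And>j x. x \<in> half_space \<Longrightarrow> (f j has_derivative f' j x) (at x within half_space)"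
    and supp: "\<And>j x. x \<in> half_space \<Longrightarrow> x \<notin> K \<Longrightarrow> f j x = 0" "\<And>x. x \<in> half_space \<Longrightarrow> x \<notin> K \<Longrightarrow> g x = 0"
    and g: "continuous_on half_space g" and div: "\<And>x. x \<in> half_space \<Longrightarrow> g x = (\<Sum>j\<in>UNIV. f' j x (axis j 1))"
  shows "(LINT x:half_space|lborel. g x) = (LINT x:{x. x $ first_coord = 0}|hyperplane_lborel. f first_coord x)"
proof -
  let ?o = "first_coord :: 'n" and ?H = "{x :: real^'n::_. x $ first_coord = 0}"
  obtain R' where R': "\<And>x. x \<in> K \<Longrightarrow> norm x \<le> R'" using compact_imp_bounded[OF K] unfolding bounded_iff by blast
  \<comment> \<open>Strictly larger than the absolute value of every coordinate of every point of
    \<open>K\<close>.\<close>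
  define R where "R = \<bar>R'\<bar> + 1"
  have R: "R > 0" by (simp add: R_def)
  have KR: "\<bar>x $ i\<bar> < R" if "x \<in> K" for x i
    using R'[OF that] component_le_norm_cart[of x i] by (simp add: R_def)
  define a d where "a = (\<chi> i::'n. - R)" "d = (\<chi> i::'n. if i = ?o then R else 2 * R)"
  let ?B = "cbox a (a + d)"
  have B: "x \<in> ?B \<longleftrightarrow> (\<forall>i. - R \<le> x $ i \<and> x $ i \<le> (if i = ?o then 0 else R))" for x
    unfolding mem_box_cart a_d_def by (intro iff_allI) auto
  have Bh: "?B \<subseteq> half_space" by (auto simp: half_space_def B) (metis)
  have KB: "x \<in> ?B" if "x \<in> K" "x \<in> half_space" for x
    unfolding B using KR[OF that(1)] that(2) by (auto simp: half_space_def abs_less_iff less_imp_le minus_less_iff)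
  have "box_defect f g a d = 0"
    by (rule box_divergence[where F' = f'])
       (use R Bh div in \<open>auto simp: a_d_def intro: has_derivative_subset[OF der] continuous_on_subset[OF g]\<close>)
  moreover have "integral ?B (\<lambda>x. f j (upd x j t)) = 0" if "\<bar>t\<bar> = R" "j = ?o \<Longrightarrow> t = - R" for j t
  proof -
    have "f j (upd x j t) = 0" if "x \<in> ?B" for x
    proof (rule supp(1))
      have "upd x j t $ j = t" by simp
      then show "upd x j t \<notin> K" using KR[of "upd x j t" j] \<open>\<bar>t\<bar> = R\<close> by auto
      show "upd x j t \<in> half_space" using that \<open>j = ?o \<Longrightarrow> t = - R\<close> R Bh by (auto simp: half_space_def)
    qed
    then have "integral ?B (\<lambda>x. f j (upd x j t)) = integral ?B (\<lambda>x. 0)" by (intro integral_cong) auto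
    then show ?thesis by simp
  qed
  moreover have "(\<Sum>j\<in>UNIV. (1 / d $ j) *\<^sub>R (integral ?B (\<lambda>x. f j (upd x j (a $ j + d $ j))) - integral ?B (\<lambda>x. f j (upd x j (a $ j)))))
    = (\<Sum>j\<in>{?o}. (1 / d $ j) *\<^sub>R (integral ?B (\<lambda>x. f j (upd x j (a $ j + d $ j))) - integral ?B (\<lambda>x. f j (upd x j (a $ j)))))"
    using R calculation(2) by (intro sum.mono_neutral_right) (auto simp: a_d_def)
  ultimately have eq: "integral ?B g = (1 / R) *\<^sub>R integral ?B (\<lambda>x. f ?o (boundary_proj x))"
    using R by (simp add: box_defect_def boundary_proj_def) (simp add: a_d_def)
  have "set_integrable lborel ?B g"
    unfolding set_integrable_def by (intro borel_integrable_compact compact_cbox continuous_on_subset[OF g Bh])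
  then have "integral ?B g = (LINT x:?B|lborel. g x)" by (rule set_borel_integral_eq_integral(2)[symmetric])
  also have "\<dots> = (LINT x:half_space|lborel. g x)"
    unfolding set_lebesgue_integral_def
    using supp(2) KB Bh by (intro Bochner_Integration.integral_cong) (auto simp: indicator_def)
  finally have 1: "integral ?B g = (LINT x:half_space|lborel. g x)" .
  have Hh: "?H \<subseteq> half_space" by (auto simp: half_space_def)
  have H: "closed ?H" by (intro closed_Collect_eq continuous_intros)
  have fc: "continuous_on half_space (f j)" for j using der has_derivative_continuous_on by blast
  have m: "(\<lambda>x. indicator ?H x *\<^sub>R f ?o x) \<in> borel_measurable borel"
    by (rule borel_measurable_continuous_on_indicator) (use H in \<open>auto intro: continuous_on_subset[OF fc Hh]\<close>)
  have pH: "boundary_proj x \<in> ?H" for x :: "real^'n::_" by (simp add: boundary_proj_def)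
  have pB: "boundary_proj ` ?B \<subseteq> half_space" using pH Hh by blast
  have "set_integrable lborel ?B (\<lambda>x. f ?o (boundary_proj x))"
    unfolding set_integrable_def boundary_proj_def
    by (intro borel_integrable_compact compact_cbox continuous_on_compose2[OF fc continuous_on_upd])
       (use pB in \<open>auto simp: boundary_proj_def\<close>)
  then have "(1 / R) *\<^sub>R integral ?B (\<lambda>x. f ?o (boundary_proj x)) = (1 / R) *\<^sub>R (LINT x:?B|lborel. f ?o (boundary_proj x))"
    by (simp add: set_borel_integral_eq_integral(2))
  also have "\<dots> = (LINT x|lborel. (1 / R) *\<^sub>R (indicator ?B x *\<^sub>R f ?o (boundary_proj x)))"
    unfolding set_lebesgue_integral_def by (rule integral_scaleR_right[symmetric])
  \<comment> \<open>The slab between \<open>- R\<close> and 0 has the same range of first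
    coordinates as the box, and in the other coordinates the box contains the support.\<close>
  also have "\<dots> = (LINT x|lborel. slab_density (- R) 0 x *\<^sub>R (indicator ?H (boundary_proj x) *\<^sub>R f ?o (boundary_proj x)))"
  proof (rule Bochner_Integration.integral_cong[OF refl])
    fix x :: "real^'n::_"
    show "(1 / R) *\<^sub>R (indicator ?B x *\<^sub>R f ?o (boundary_proj x))
      = slab_density (- R) 0 x *\<^sub>R (indicator ?H (boundary_proj x) *\<^sub>R f ?o (boundary_proj x))"
    proof (cases "boundary_proj x \<in> K")
      case True
      have "- R \<le> x $ i \<and> x $ i \<le> R" if "i \<noteq> ?o" for i
        using KR[OF True, of i] that by (simp add: boundary_proj_def abs_less_iff)
      then have "x \<in> ?B \<longleftrightarrow> x $ ?o \<in> {-R..0}" unfolding B by auto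
      then show ?thesis using pH[of x] by (simp add: slab_density_def indicator_def)
    next
      case False
      then have "f ?o (boundary_proj x) = 0" using pH[of x] Hh supp(1) by blast
      then show ?thesis by simp
    qed
  qed
  also have "\<dots> = (LINT x:?H|hyperplane_lborel. f ?o x)"
    unfolding set_lebesgue_integral_def using R by (intro integral_hyperplane_slab(1)[symmetric] m) auto
  finally show ?thesis using eq 1 by simp
qed

section \<open>Change of variables\<close>

text \<open>The change of variables theorem of the library is restricted to well-ordered index types, so
  it is applied to a well-ordered copy of the index type.\<close>

typedef 'a ordered = "UNIV :: 'a set" by auto

lemma ordered_inverse [simp]: "Rep_ordered (Abs_ordered i) = i" "Abs_ordered (Rep_ordered j) = j"
  by (simp_all add: Abs_ordered_inverse Rep_ordered_inverse)

instance ordered :: (finite) finite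
proof
  have "UNIV = Abs_ordered ` (UNIV :: 'a set)" by (metis (no_types) ordered_inverse(2) surjI)
  then show "finite (UNIV :: 'a ordered set)" by (metis finite_class.finite_UNIV finite_imageI)
qed

definition ordered_index :: "'a::finite ordered \<Rightarrow> nat" where
  "ordered_index = (SOME f. inj f)"

lemma inj_ordered_index: "inj (ordered_index :: 'a::finite ordered \<Rightarrow> nat)"
proof -
  have "\<exists>f :: 'a ordered \<Rightarrow> nat. inj f"
    using finite_imp_inj_to_nat_seg[OF finite_class.finite_UNIV] by metis
  then show ?thesis unfolding ordered_index_def by (rule someI_ex)
qed

instantiation ordered :: (finite) wellorder
begin

definition "i \<le> j \<longleftrightarrow> ordered_index i \<le> ordered_index j" for i j :: "'a ordered"
definition "i < j \<longleftrightarrow> ordered_index i < ordered_index j" for i j :: "'a ordered"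

instance
proof
  fix i j k :: "'a ordered"
  show "i < j \<longleftrightarrow> i \<le> j \<and> \<not> j \<le> i" "i \<le> i" "i \<le> j \<Longrightarrow> j \<le> k \<Longrightarrow> i \<le> k" "i \<le> j \<or> j \<le> i"
    by (auto simp: less_eq_ordered_def less_ordered_def)
  show "i \<le> j \<Longrightarrow> j \<le> i \<Longrightarrow> i = j"
    unfolding less_eq_ordered_def by (rule injD[OF inj_ordered_index]) (rule order_antisym)
next
  fix P :: "'a ordered \<Rightarrow> bool" and i
  assume *: "\<And>i. (\<And>j. j < i \<Longrightarrow> P j) \<Longrightarrow> P i"
  show "P i"
  proof (induction "ordered_index i" arbitrary: i rule: less_induct)
    case less
    show ?case by (rule *, rule less) (simp add: less_ordered_def)
  qed
qed

end

section \<open>Transfer between the index types\<close>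

definition to_ordered :: "real^'n::finite \<Rightarrow> real^'n ordered" where
  "to_ordered x = (\<chi> i. x $ Rep_ordered i)"

definition of_ordered :: "real^'n::finite ordered \<Rightarrow> real^'n" where
  "of_ordered y = (\<chi> i. y $ Abs_ordered i)"

lemma ordered_vec_inverse [simp]: "of_ordered (to_ordered x) = x" "to_ordered (of_ordered y) = y"
  by (simp_all add: to_ordered_def of_ordered_def vec_eq_iff)

lemma linear_to_ordered: "linear to_ordered"
  and linear_of_ordered: "linear of_ordered"
  by (auto simp: to_ordered_def of_ordered_def linear_iff vec_eq_iff)

lemma bounded_linear_ordered: "bounded_linear to_ordered" "bounded_linear of_ordered"
  using linear_to_ordered linear_of_ordered by (simp_all add: linear_conv_bounded_linear)

lemma to_ordered_axis: "to_ordered (axis (Rep_ordered i) a) = axis i a"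
  by (auto simp: to_ordered_def axis_def vec_eq_iff Rep_ordered_inject)

lemma of_ordered_axis: "of_ordered (axis i a) = axis (Rep_ordered i) a"
  by (metis ordered_vec_inverse(1) to_ordered_axis)

lemma bij_Rep_ordered: "bij Rep_ordered"
  by (rule o_bij[of Abs_ordered]) (auto simp: fun_eq_iff)

lemma measurable_ordered [measurable]:
  "to_ordered \<in> borel_measurable borel" "of_ordered \<in> borel_measurable borel"
  by (intro borel_measurable_continuous_onI bounded_linear.continuous_on[OF bounded_linear_ordered(1)] continuous_on_id)
     (intro borel_measurable_continuous_onI bounded_linear.continuous_on[OF bounded_linear_ordered(2)] continuous_on_id)

lemma lborel_ordered: "lborel = distr lborel borel (to_ordered :: real^'n::finite \<Rightarrow> _)"
proof (rule lborel_vec_eqI)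
  fix l u :: "real^'n ordered" assume le: "\<And>i. l $ i \<le> u $ i"
  have box: "to_ordered -` box l u = box (of_ordered l) (of_ordered u)"
  proof -
    have all: "(\<forall>i::'n ordered. P i) \<longleftrightarrow> (\<forall>i. P (Abs_ordered i))" for P by (metis ordered_inverse(2))
    show ?thesis by (rule set_eqI) (simp add: mem_box_cart to_ordered_def of_ordered_def, subst all, simp)
  qed
  have "emeasure (distr lborel borel (to_ordered :: real^'n \<Rightarrow> _)) (box l u) = emeasure lborel (box (of_ordered l) (of_ordered u))"
    by (subst emeasure_distr) (simp_all add: box)
  also have "\<dots> = ennreal (\<Prod>i\<in>UNIV. of_ordered u $ i - of_ordered l $ i)"
  proof (subst emeasure_lborel_box)
    show "of_ordered l \<bullet> b \<le> of_ordered u \<bullet> b" if "b \<in> Basis" for b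
      using that le by (auto simp: Basis_vec_def inner_axis of_ordered_def)
  qed (simp add: prod_Basis_vec inner_axis)
  also have "(\<Prod>i\<in>UNIV. of_ordered u $ i - of_ordered l $ i) = (\<Prod>i\<in>UNIV. u $ i - l $ i)"
    by (subst prod.reindex_bij_betw[OF bij_Rep_ordered, symmetric]) (simp add: of_ordered_def)
  finally show "emeasure (distr lborel borel (to_ordered :: real^'n \<Rightarrow> _)) (box l u) = ennreal (\<Prod>i\<in>UNIV. u $ i - l $ i)" .
qed simp

text \<open>The determinant over the copied index type, as a function of vectors over the original
  one, is a top form with value 1 on the axes; \<open>alt_form_det\<close> then gives its value on
  their images.\<close>

lemma det_ordered:
  fixes A :: "real^'n::finite \<Rightarrow> real^'n"
  assumes A: "linear A"
  shows "det (matrix (to_ordered \<circ> A \<circ> of_ordered)) = det (matrix A)"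
proof -
  obtain js where js: "distinct js" "set js = (UNIV :: 'n set)"
    using finite_distinct_list[OF finite_class.finite_UNIV] by metis
  then obtain pos where pos: "bij_betw pos (UNIV :: 'n set) {..<CARD('n)}" "\<And>s. pos s < CARD('n)" "\<And>s. js ! pos s = s"
    using enumeration_position by metis
  have len: "length js = CARD('n)" using js by (metis distinct_card)
  let ?f = "\<lambda>vs. det (\<chi> s. to_ordered (vs ! (pos \<circ> Rep_ordered) s))"
  have "bij_betw (pos \<circ> Rep_ordered) UNIV {..<CARD('n)}"
    using bij_Rep_ordered pos(1) by (rule bij_betw_trans)
  then have f: "alt_form CARD('n) ?f" by (rule alt_form_det_rows[OF _ linear_to_ordered])
  have nth: "map h js ! pos s = h s" for h :: "'n \<Rightarrow> real^'n" and s using pos len by simp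
  have "?f (map (\<lambda>j. A (axis j 1)) js) = det (transpose (matrix (to_ordered \<circ> A \<circ> of_ordered)))"
    by (rule arg_cong[of _ _ det]) (simp add: nth vec_eq_iff transpose_def matrix_def of_ordered_axis)
  moreover have "?f (map (\<lambda>j. axis j 1) js) = det (mat 1 :: real^'n ordered^'n ordered)"
    by (rule arg_cong[of _ _ det]) (simp add: nth to_ordered_axis, simp add: vec_eq_iff mat_def axis_def eq_commute)
  ultimately show ?thesis using alt_form_det[OF f js A] by (simp add: det_transpose)
qed

lemma set_integrable_compact:
  fixes f :: "real^'n::finite \<Rightarrow> 'b::{banach,second_countable_topology}"
  assumes "compact S" "continuous_on S f" shows "set_integrable lborel S f"
  unfolding set_integrable_def using assms by (rule borel_integrable_compact)

lemma set_integral_to_ordered: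
  fixes f :: "real^'n::finite ordered \<Rightarrow> real"
  assumes "compact S" "continuous_on (to_ordered ` S) f"
  shows "(LINT y:to_ordered ` S|lborel. f y) = (LINT x:S|lborel. f (to_ordered x))"
proof -
  have "compact (to_ordered ` S)"
    by (rule compact_continuous_image[OF linear_continuous_on[OF bounded_linear_ordered(1)] assms(1)])
  then have m: "(\<lambda>y. indicator (to_ordered ` S) y *\<^sub>R f y) \<in> borel_measurable borel"
    using assms(2) by (intro borel_measurable_continuous_on_indicator borel_closed compact_imp_closed)
  have i: "indicator (to_ordered ` S) (to_ordered x) = (indicator S x :: real)" for x
  proof -
    have "to_ordered x \<in> to_ordered ` S \<longleftrightarrow> x \<in> S" by (auto dest!: arg_cong[of _ _ of_ordered])
    then show ?thesis by (simp add: indicator_def)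
  qed
  show ?thesis
    unfolding set_lebesgue_integral_def
    by (subst lborel_ordered, subst integral_distr) (use m i in auto)
qed

text \<open>The map \<open>g\<close> is conjugated by \<open>to_ordered\<close>, which preserves
  Lebesgue measure and determinants. Compactness of \<open>S\<close> makes all the integrands
  integrable by continuity.\<close>

lemma change_of_variables_real:
  fixes g :: "real^'n::finite \<Rightarrow> real^'n" and F :: "real^'n \<Rightarrow> real"
  assumes S: "compact S" and der: "\<And>x. x \<in> S \<Longrightarrow> (g has_derivative g' x) (at x within S)"
    and cont: "\<And>v. continuous_on S (\<lambda>x. g' x v)" and inj: "inj_on g S" and F: "continuous_on (g ` S) F"
  shows "(LINT x:S|lborel. \<bar>det (matrix (g' x))\<bar> * F (g x)) = (LINT y:g ` S|lborel. F y)"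
    and "continuous_on S (\<lambda>x. det (matrix (g' x)))"
proof -
  let ?P = "to_ordered :: real^'n \<Rightarrow> _" and ?Q = "of_ordered :: _ \<Rightarrow> real^'n"
  note cP = bounded_linear.continuous_on[OF bounded_linear_ordered(1)]
  note cQ = bounded_linear.continuous_on[OF bounded_linear_ordered(2)]
  show cdet: "continuous_on S (\<lambda>x. det (matrix (g' x)))"
    unfolding det_def matrix_def using cont by (auto intro!: continuous_intros)
  have g: "continuous_on S g" using der has_derivative_continuous_on by blast
  let ?S = "?P ` S" and ?g = "?P \<circ> g \<circ> ?Q" and ?g' = "\<lambda>y. ?P \<circ> g' (?Q y) \<circ> ?Q" and ?F = "F \<circ> ?Q"
  have Q: "?Q ` ?S = S" by (force simp: image_image)
  have cS: "compact ?S" by (rule compact_continuous_image[OF linear_continuous_on[OF bounded_linear_ordered(1)] S])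
  have gS: "?g ` ?S = ?P ` (g ` S)" by (force simp: image_image)
  have cgS: "compact (g ` S)" by (rule compact_continuous_image[OF g S])
  have cgS': "compact (?P ` g ` S)" by (rule compact_continuous_image[OF linear_continuous_on[OF bounded_linear_ordered(1)] cgS])
  have der': "(?g has_derivative ?g' y) (at y within ?S)" if "y \<in> ?S" for y
  proof -
    have "?Q y \<in> S" using that by auto
    from der[OF this] have "(g has_derivative g' (?Q y)) (at (?Q y) within ?Q ` ?S)" unfolding Q .
    then have "(g \<circ> ?Q has_derivative g' (?Q y) \<circ> ?Q) (at y within ?S)"
      by (rule diff_chain_within[OF bounded_linear_imp_has_derivative[OF bounded_linear_ordered(2)]])
    then have "(?P \<circ> (g \<circ> ?Q) has_derivative ?P \<circ> (g' (?Q y) \<circ> ?Q)) (at y within ?S)"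
      by (rule diff_chain_within[OF _ bounded_linear_imp_has_derivative[OF bounded_linear_ordered(1)]])
    then show ?thesis by (simp add: o_assoc)
  qed
  have inj': "inj_on ?g ?S"
    using inj by (auto simp: inj_on_def) (metis ordered_vec_inverse(1))
  have det: "det (matrix (?g' y)) = det (matrix (g' (?Q y)))" if "y \<in> ?S" for y
    by (rule det_ordered) (use der[of "?Q y"] that in \<open>auto intro: has_derivative_linear\<close>)
  have F': "continuous_on (?P ` g ` S) ?F"
    by (intro continuous_on_compose cQ continuous_on_id) (auto simp: image_image intro: continuous_on_subset[OF F])
  have cI: "continuous_on ?S (\<lambda>y. \<bar>det (matrix (g' (?Q y)))\<bar> * F (g (?Q y)))"
    using Q by (intro continuous_intros continuous_on_compose2[OF cdet] continuous_on_compose2[OF F]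
        continuous_on_compose2[OF g] cQ continuous_on_id) auto
  \<comment> \<open>The real integrand is wrapped as a vector with one component, since the formula
    to be applied is about vector-valued integrands.\<close>
  let ?v = "\<lambda>r. (\<chi> i::1. r) :: real^1"
  have v: "bounded_linear ?v" by (auto simp: linear_conv_bounded_linear[symmetric] linear_iff vec_eq_iff)
  have FI: "set_integrable lborel (?P ` g ` S) (\<lambda>y. ?v (?F y))"
    by (intro set_integrable_compact cgS' bounded_linear.continuous_on[OF v] F')
  let ?b = "integral (?g ` ?S) (\<lambda>y. ?v (?F y))"
  have "(\<lambda>y. ?v (?F y)) absolutely_integrable_on (?g ` ?S)"
    using FI unfolding gS set_integrable_def
    by (simp only: integrable_completion[OF borel_measurable_integrable[OF FI[unfolded set_integrable_def]]])
  then have "integral ?S (\<lambda>y. \<bar>det (matrix (?g' y))\<bar> *\<^sub>R ?v (?F (?g y))) = ?b"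
    using has_absolute_integral_change_of_variables[OF _ der' inj', of "\<lambda>y. ?v (?F y)" ?b] cS by (auto simp: lmeasurable_compact fmeasurableD)
  also have "integral ?S (\<lambda>y. \<bar>det (matrix (?g' y))\<bar> *\<^sub>R ?v (?F (?g y))) = integral ?S (\<lambda>y. ?v (\<bar>det (matrix (g' (?Q y)))\<bar> * F (g (?Q y))))"
    by (rule integral_cong) (simp add: det vec_eq_iff)
  also have "\<dots> = ?v (integral ?S (\<lambda>y. \<bar>det (matrix (g' (?Q y)))\<bar> * F (g (?Q y))))"
    using integral_linear[OF set_borel_integral_eq_integral(1)[OF set_integrable_compact[OF cS cI]] v] by (simp add: o_def)
  also have "?b = ?v (integral (?P ` g ` S) ?F)"
    unfolding gS using integral_linear[OF set_borel_integral_eq_integral(1)[OF set_integrable_compact[OF cgS' F']] v] by (simp add: o_def)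
  finally have "integral ?S (\<lambda>y. \<bar>det (matrix (g' (?Q y)))\<bar> * F (g (?Q y))) = integral (?P ` g ` S) ?F"
    by (simp add: vec_eq_iff)
  then have "(LINT y:?S|lborel. \<bar>det (matrix (g' (?Q y)))\<bar> * F (g (?Q y))) = (LINT y:?P ` g ` S|lborel. ?F y)"
    using set_borel_integral_eq_integral(2)[OF set_integrable_compact[OF cS cI]]
      set_borel_integral_eq_integral(2)[OF set_integrable_compact[OF cgS' F']] by simp
  then show "(LINT x:S|lborel. \<bar>det (matrix (g' x))\<bar> * F (g x)) = (LINT y:g ` S|lborel. F y)"
    unfolding set_integral_to_ordered[OF S cI] set_integral_to_ordered[OF cgS F'] by simp
qed

lemma change_of_variables_complex:
  fixes g :: "real^'n::finite \<Rightarrow> real^'n" and F :: "real^'n \<Rightarrow> complex"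
  assumes S: "compact S" and der: "\<And>x. x \<in> S \<Longrightarrow> (g has_derivative g' x) (at x within S)"
    and cont: "\<And>v. continuous_on S (\<lambda>x. g' x v)" and inj: "inj_on g S" and F: "continuous_on (g ` S) F"
  shows "(LINT x:S|lborel. \<bar>det (matrix (g' x))\<bar> *\<^sub>R F (g x)) = (LINT y:g ` S|lborel. F y)"
proof -
  have g: "continuous_on S g" using der has_derivative_continuous_on by blast
  have cR: "continuous_on (g ` S) (\<lambda>x. Re (F x))" and cI: "continuous_on (g ` S) (\<lambda>x. Im (F x))"
    using F by (auto intro: continuous_intros)
  note R = change_of_variables_real[OF S der cont inj cR] and I = change_of_variables_real[OF S der cont inj cI]
  have "continuous_on S (\<lambda>x. \<bar>det (matrix (g' x))\<bar> *\<^sub>R F (g x))"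
    by (intro continuous_intros R(2) continuous_on_compose2[OF F] g) auto
  then have i1: "set_integrable lborel S (\<lambda>x. \<bar>det (matrix (g' x))\<bar> *\<^sub>R F (g x))"
    by (rule set_integrable_compact[OF S])
  have i2: "set_integrable lborel (g ` S) F"
    by (rule set_integrable_compact[OF compact_continuous_image[OF g S] F])
  have re: "Re (LINT x:T|lborel. h x) = (LINT x:T|lborel. Re (h x))"
    and im: "Im (LINT x:T|lborel. h x) = (LINT x:T|lborel. Im (h x))"
    if "set_integrable lborel T h" for T and h :: "real^'n \<Rightarrow> complex"
    using that unfolding set_lebesgue_integral_def set_integrable_def
    by (simp_all flip: integral_Re integral_Im)
  show ?thesis
    using R(1) I(1) by (intro complex_eqI) (simp_all add: re[OF i1] re[OF i2] im[OF i1] im[OF i2])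
qed

section \<open>Charts at the boundary\<close>

locale oriented = manifold \<A>
  for \<A> :: "('q::{t2_space,second_countable_topology}, 'n::{finite,linorder}) chart set" +
  fixes \<sigma> :: "('q, 'n) chart \<Rightarrow> 'q \<Rightarrow> real"
  assumes orient: "orientation \<A> \<sigma>"

context manifold
begin

lemma transition_inverse:
  assumes "c \<in> \<A>" "c' \<in> \<A>" "q \<in> cdom c" "q \<in> cdom c'"
  shows "T c c' q (T c' c q v) = v"
  using transition_cocycle[OF assms(2,1,2,4,3,4)] transition_id[OF assms(2,4)] by simp

text \<open>If the first coordinate of \<open>q\<close> were negative in the chart \<open>c\<close>,
  the first coordinate of \<open>c'\<close> would attain its greatest value 0 at an interior point.
  Its derivative would then vanish, against the invertibility of the transition derivative.\<close>

lemma boundary_chart: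
  assumes "c \<in> \<A>" "q \<in> cdom c"
  shows "q \<in> boundary \<A> \<longleftrightarrow> coords c q $ first_coord = 0"
proof
  show "coords c q $ first_coord = 0 \<Longrightarrow> q \<in> boundary \<A>" using assms by (auto simp: boundary_def)
next
  assume "q \<in> boundary \<A>"
  then obtain c' where c': "c' \<in> \<A>" "q \<in> cdom c'" "coords c' q $ first_coord = 0" unfolding boundary_def by blast
  let ?x = "coords c q" and ?o = "first_coord :: 'n"
  have xq: "?x \<in> coords c ` (cdom c \<inter> cdom c')" using assms c' by blast
  show "?x $ ?o = 0"
  proof (rule ccontr)
    assume "?x $ ?o \<noteq> 0"
    then have neg: "?x $ ?o < 0" using coords_half_space[OF assms] by (simp add: half_space_def)
    obtain U where U: "open U" "coords c ` (cdom c \<inter> cdom c') = half_space \<inter> U"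
      using openin_overlap[OF assms(1) c'(1)] unfolding openin_open by blast
    define S where "S = {x :: real^'n::_. x $ ?o < 0} \<inter> U"
    have S: "open S" "S \<subseteq> half_space \<inter> U" "?x \<in> S"
      using U(1) neg xq unfolding U(2) S_def by (auto simp: half_space_def intro!: open_Int open_Collect_less continuous_intros)
    have "((\<lambda>u. (coords c' \<circ> param c) u $ ?o) has_derivative (\<lambda>h. T c c' q h $ ?o)) (at ?x within half_space)"
      using transition_works(1)[OF assms(1) c'(1) assms(2) c'(2)]
      by (rule bounded_linear.has_derivative[OF bounded_linear_vec_nth])
    then have "((\<lambda>u. (coords c' \<circ> param c) u $ ?o) has_derivative (\<lambda>h. T c c' q h $ ?o)) (at ?x within S)"
      by (rule has_derivative_subset) (use S in auto)
    then have d: "((\<lambda>u. (coords c' \<circ> param c) u $ ?o) has_derivative (\<lambda>h. T c c' q h $ ?o)) (at ?x)"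
      using at_within_open[OF S(3,1)] by simp
    have "(coords c' \<circ> param c) y $ ?o \<le> (coords c' \<circ> param c) ?x $ ?o" if "y \<in> S" for y
    proof -
      have "y \<in> coords c ` (cdom c \<inter> cdom c')" using that S(2) unfolding U(2) by (rule subsetD[rotated])
      then obtain q' where q': "y = coords c q'" "q' \<in> cdom c" "q' \<in> cdom c'" by (elim imageE IntE)
      then show ?thesis using assms c' coords_half_space[OF c'(1) q'(3)] by (simp add: half_space_def)
    qed
    then have "(\<lambda>h. T c c' q h $ ?o) = (\<lambda>_. 0)" by (intro differential_zero_maxmin[OF S(3,1) d]) auto
    from fun_cong[OF this, of "T c' c q (axis ?o 1)"] show False
      using transition_inverse[OF assms(1) c'(1) assms(2) c'(2)] by simp
  qed
qed

lemma closed_boundary: "closed (boundary \<A>)"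
proof -
  have "open (- boundary \<A>)"
  proof (subst open_subopen, intro ballI)
    fix q assume q: "q \<in> - boundary \<A>"
    obtain c where c: "c \<in> \<A>" "q \<in> cdom c" using chart_at by blast
    have "open ((\<lambda>q. coords c q $ first_coord) -` {..<0} \<inter> cdom c)"
      using open_cdom[OF c(1)] continuous_coords[OF c(1)] continuous_on_open_vimage[OF open_cdom[OF c(1)], of "\<lambda>q. coords c q $ first_coord"]
      by (auto intro: continuous_intros)
    moreover have "q \<in> (\<lambda>q. coords c q $ first_coord) -` {..<0} \<inter> cdom c"
      using q c boundary_chart[OF c] coords_half_space[OF c] by (auto simp: half_space_def)
    moreover have "(\<lambda>q. coords c q $ first_coord) -` {..<0} \<inter> cdom c \<subseteq> - boundary \<A>"
      using boundary_chart[OF c(1)] by auto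
    ultimately show "\<exists>T. open T \<and> q \<in> T \<and> T \<subseteq> - boundary \<A>" by blast
  qed
  then show ?thesis by (simp add: closed_def)
qed

text \<open>Close to the point, the line in direction \<open>j\<close> stays in the boundary, and
  there the first coordinate of \<open>c'\<close> is constantly 0.\<close>

lemma transition_boundary_tangent:
  assumes c: "c \<in> \<A>" "c' \<in> \<A>" and q: "q \<in> cdom c" "q \<in> cdom c'" "q \<in> boundary \<A>" and j: "j \<noteq> first_coord"
  shows "T c c' q (axis j 1) $ first_coord = 0"
proof -
  let ?x = "coords c q" and ?o = "first_coord :: 'n"
  define l where "l t = ?x + t *\<^sub>R axis j 1" for t :: real
  have x0: "?x $ ?o = 0" using boundary_chart[OF c(1) q(1)] q(3) by simp
  then have l0: "l t $ ?o = 0" for t using j by (simp add: l_def axis_def)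
  then have lh: "l t \<in> half_space" for t by (simp add: half_space_def)
  obtain U where U: "open U" "coords c ` (cdom c \<inter> cdom c') = half_space \<inter> U"
    using openin_overlap[OF c] unfolding openin_open by blast
  define A where "A = l -` U"
  have A: "open A" unfolding A_def l_def[abs_def] by (intro open_vimage U(1) continuous_intros)
  have "?x \<in> coords c ` (cdom c \<inter> cdom c')" using q by (intro imageI IntI)
  then have A0: "0 \<in> A" unfolding U(2) by (simp add: A_def l_def)
  let ?f = "\<lambda>u. (coords c' \<circ> param c) u $ ?o"
  have d: "(?f has_derivative (\<lambda>h. T c c' q h $ ?o)) (at (l 0) within l ` A)"
  proof (rule bounded_linear.has_derivative[OF bounded_linear_vec_nth], rule has_derivative_subset)
    show "(coords c' \<circ> param c has_derivative T c c' q) (at (l 0) within half_space)"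
      using transition_works(1)[OF c q(1,2)] by (simp add: l_def)
    show "l ` A \<subseteq> half_space" using lh by blast
  qed
  have dl: "(l has_derivative (\<lambda>t. t *\<^sub>R axis j 1)) (at 0 within A)"
    unfolding l_def by (auto intro!: derivative_eq_intros)
  have "(?f \<circ> l has_derivative (\<lambda>h. T c c' q h $ ?o) \<circ> (\<lambda>t. t *\<^sub>R axis j 1)) (at 0 within A)"
    by (rule diff_chain_within[OF dl d])
  moreover have "(?f \<circ> l) t = 0" if "t \<in> A" for t
  proof -
    have "l t \<in> half_space \<inter> U" using that lh by (simp add: A_def)
    then have "l t \<in> coords c ` (cdom c \<inter> cdom c')" unfolding U(2) .
    then obtain q' where q': "l t = coords c q'" "q' \<in> cdom c" "q' \<in> cdom c'" by (elim imageE IntE)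
    then have "q' \<in> boundary \<A>" using boundary_chart[OF c(1) q'(2)] l0[of t] by simp
    then show ?thesis using boundary_chart[OF c(2) q'(3)] c q' by simp
  qed
  then have "(?f \<circ> l has_derivative (\<lambda>_. 0)) (at 0 within A)"
    by (intro has_derivative_transform[OF A0 _ has_derivative_const[of 0]])
  ultimately have "(\<lambda>h. T c c' q h $ ?o) \<circ> (\<lambda>t. t *\<^sub>R axis j 1) = (\<lambda>_. 0)"
    unfolding at_within_open[OF A0 A] by (rule has_derivative_unique)
  from fun_cong[OF this, of 1] show ?thesis by simp
qed

text \<open>The value 0 is impossible, since then all images would have first coordinate 0, against
  surjectivity; a negative value is impossible, since then a step inward in \<open>c\<close> would
  leave the half-space in \<open>c'\<close>.\<close>

lemma transition_boundary_normal:
  assumes c: "c \<in> \<A>" "c' \<in> \<A>" and q: "q \<in> cdom c" "q \<in> cdom c'" "q \<in> boundary \<A>"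
  shows "T c c' q (axis first_coord 1) $ first_coord > 0"
proof -
  let ?x = "coords c q" and ?o = "first_coord :: 'n"
  let ?f = "\<lambda>u. (coords c' \<circ> param c) u $ ?o" and ?a = "T c c' q (axis ?o 1) $ ?o"
  have lin: "linear (T c c' q)" by (rule transition_linear[OF c q(1,2)])
  have "?a \<noteq> 0"
  proof
    assume "?a = 0"
    then have z: "T c c' q (axis j 1) $ ?o = 0" for j
      using transition_boundary_tangent[OF c q] by (cases "j = ?o") auto
    have "T c c' q v $ ?o = 0" for v
    proof -
      have "T c c' q v = T c c' q (\<Sum>j\<in>UNIV. (v $ j) *\<^sub>R axis j 1)"
        using basis_expansion[of v] by (simp add: scalar_mult_eq_scaleR)
      also have "\<dots> $ ?o = 0" by (simp add: linear_sum[OF lin] linear_scale[OF lin] z)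
      finally show ?thesis .
    qed
    from this[of "T c' c q (axis ?o 1)"] show False
      using transition_inverse[OF c q(1,2)] by simp
  qed
  moreover have "\<not> ?a < 0"
  proof
    assume a: "?a < 0"
    have x0: "?x $ ?o = 0" using boundary_chart[OF c(1) q(1)] q(3) by simp
    have f0: "?f ?x = 0" using boundary_chart[OF c(2) q(2)] q c by simp
    have "(?f has_derivative (\<lambda>h. T c c' q h $ ?o)) (at ?x within half_space)"
      using transition_works(1)[OF c q(1,2)] by (rule bounded_linear.has_derivative[OF bounded_linear_vec_nth])
    then obtain d where d: "d > 0" "\<And>y. y \<in> half_space \<Longrightarrow> norm (y - ?x) < d \<Longrightarrow>
        norm (?f y - ?f ?x - T c c' q (y - ?x) $ ?o) \<le> (- ?a / 2) * norm (y - ?x)"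
      unfolding has_derivative_within_alt using a by (meson half_gt_zero neg_0_less_iff_less)
    have "?x \<in> coords c ` (cdom c \<inter> cdom c')" using q by (intro imageI IntI)
    from openin_overlap[OF c, unfolded openin_contains_ball, THEN conjunct2, rule_format, OF this]
    obtain e where e: "e > 0" "half_space \<inter> ball ?x e \<subseteq> coords c ` (cdom c \<inter> cdom c')"
      unfolding Int_commute[of half_space] by blast
    define t where "t = min d e / 2"
    have t: "t > 0" "t < d" "t < e" using d(1) e(1) by (auto simp: t_def min_def)
    \<comment> \<open>A short step inward. The first coordinate of its image is at least half of
      \<open>- t * ?a\<close>, hence positive.\<close>
    define y where "y = ?x - t *\<^sub>R axis ?o 1"
    have y: "y \<in> half_space" using x0 t by (simp add: y_def half_space_def)
    have n: "norm (y - ?x) = t" using t by (simp add: y_def norm_axis_1)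
    have "y \<in> ball ?x e" using n t by (simp add: dist_norm norm_minus_commute)
    then have "y \<in> coords c ` (cdom c \<inter> cdom c')" using e(2) y by (intro subsetD[OF e(2)] IntI)
    then obtain q' where q': "y = coords c q'" "q' \<in> cdom c" "q' \<in> cdom c'" by (elim imageE IntE)
    then have "?f y \<le> 0" using coords_half_space[OF c(2) q'(3)] c by (simp add: half_space_def)
    moreover have "T c c' q (y - ?x) $ ?o = - t * ?a" by (simp add: y_def linear_scale[OF lin] linear_neg[OF lin])
    then have "\<bar>?f y + t * ?a\<bar> \<le> (- ?a / 2) * t" using d(2)[OF y] n t f0 by simp
    then have "- (t * ?a) \<le> ?f y + (- ?a / 2) * t" by linarith
    moreover have "t * ?a < 0" using t a by (simp add: mult_pos_neg)
    ultimately show False by (simp add: field_simps)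
  qed
  ultimately show ?thesis by linarith
qed

text \<open>Extends the transition map of the boundary to a thickening of the boundary by an interval.\<close>

definition thick_transition :: "('q, 'n) chart \<Rightarrow> ('q, 'n) chart \<Rightarrow> 'q \<Rightarrow> real^'n::_ \<Rightarrow> real^'n::_" where
  "thick_transition c c' q h = upd (T c c' q (boundary_proj h)) first_coord (h $ first_coord)"

end

section \<open>Integrating densities in different charts\<close>

lemma boundary_proj_id: "x $ first_coord = 0 \<Longrightarrow> boundary_proj x = x"
  by (simp add: boundary_proj_def vec_eq_iff)

lemma linear_boundary_proj: "linear boundary_proj"
  by (auto simp: boundary_proj_def linear_iff vec_eq_iff)

lemma continuous_on_boundary_proj: "continuous_on S boundary_proj"
  unfolding boundary_proj_def[abs_def] by (rule continuous_on_upd)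

text \<open>Thickness 1 makes the slab density an indicator function, so integrals over the
  hyperplane become plain integrals over slabs.\<close>

definition slab :: "(real^'n::{finite,linorder}) set \<Rightarrow> (real^'n::_) set" where
  "slab S = {x. x $ first_coord \<in> {0..1} \<and> boundary_proj x \<in> S}"

lemma compact_slab:
  fixes S :: "(real^'n::{finite,linorder}) set"
  assumes "compact S" shows "compact (slab S)"
proof -
  have "slab S = {x. x $ first_coord \<in> {0..1}} \<inter> boundary_proj -` S" by (auto simp: slab_def)
  moreover have "closed {x :: real^'n::_. x $ first_coord \<in> {0..1}}"
    unfolding atLeastAtMost_iff by (intro closed_Collect_conj closed_Collect_le continuous_intros)
  moreover have "closed (boundary_proj -` S)"
    by (intro closed_vimage compact_imp_closed assms continuous_on_boundary_proj)
  ultimately have "closed (slab S)" by auto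
  moreover obtain B where B: "\<And>x. x \<in> S \<Longrightarrow> norm x \<le> B" using compact_imp_bounded[OF assms] unfolding bounded_iff by blast
  have "norm x \<le> B + 1" if "x \<in> slab S" for x
  proof -
    have "x = boundary_proj x + (x $ first_coord) *\<^sub>R axis first_coord 1"
      by (auto simp: boundary_proj_def vec_eq_iff axis_def)
    then have "norm x \<le> norm (boundary_proj x) + norm ((x $ first_coord) *\<^sub>R axis first_coord (1::real) :: real^'n::_)"
      by (metis norm_triangle_ineq)
    then show ?thesis using B[of "boundary_proj x"] that by (simp add: slab_def norm_axis_1)
  qed
  then have "bounded (slab S)" unfolding bounded_iff by blast
  ultimately show ?thesis by (simp add: compact_eq_bounded_closed)
qed

lemma hyperplane_integral_compact:
  fixes F :: "real^'n::{finite,linorder} \<Rightarrow> complex"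
  assumes S: "compact S" and F: "continuous_on S F"
  shows "set_integrable hyperplane_lborel S F"
    and "(LINT u:S|hyperplane_lborel. F u) = (LINT x:slab S|lborel. F (boundary_proj x))"
proof -
  have m: "(\<lambda>u. indicator S u *\<^sub>R F u) \<in> borel_measurable borel"
    by (intro borel_measurable_continuous_on_indicator F borel_closed compact_imp_closed S)
  have eq: "slab_density 0 1 x *\<^sub>R (indicator S (boundary_proj x) *\<^sub>R F (boundary_proj x))
      = indicator (slab S) x *\<^sub>R F (boundary_proj x)" for x
    by (auto simp: slab_density_def slab_def indicator_def)
  have "continuous_on (slab S) (\<lambda>x. F (boundary_proj x))"
    by (rule continuous_on_compose2[OF F continuous_on_boundary_proj]) (auto simp: slab_def)
  then have "set_integrable lborel (slab S) (\<lambda>x. F (boundary_proj x))"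
    by (rule set_integrable_compact[OF compact_slab[OF S]])
  then show "set_integrable hyperplane_lborel S F"
    unfolding set_integrable_def integral_hyperplane_slab(2)[OF zero_less_one m] eq .
  show "(LINT u:S|hyperplane_lborel. F u) = (LINT x:slab S|lborel. F (boundary_proj x))"
    unfolding set_lebesgue_integral_def integral_hyperplane_slab(1)[OF zero_less_one m] eq ..
qed

lemma set_integral_support:
  assumes "S \<subseteq> A" "\<And>x. x \<in> A \<Longrightarrow> x \<notin> S \<Longrightarrow> f x = 0"
  shows "(LINT x:A|M. f x) = (LINT x:S|M. f x)" "set_integrable M A f \<longleftrightarrow> set_integrable M S f"
proof -
  have "indicator A x *\<^sub>R f x = indicator S x *\<^sub>R f x" for x using assms by (auto simp: indicator_def)
  then show "(LINT x:A|M. f x) = (LINT x:S|M. f x)" "set_integrable M A f \<longleftrightarrow> set_integrable M S f"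
    by (simp_all only: set_lebesgue_integral_def set_integrable_def)
qed

context manifold
begin

lemma continuous_on_param_image:
  assumes "c \<in> \<A>" "S \<subseteq> cdom c" "continuous_on S f"
  shows "continuous_on (coords c ` S) (\<lambda>u. f (param c u))"
proof (rule continuous_on_compose2[OF assms(3)])
  show "continuous_on (coords c ` S) (param c)"
    by (rule continuous_on_subset[OF continuous_param[OF assms(1)]]) (use assms in \<open>auto simp: target_def\<close>)
  show "param c ` coords c ` S \<subseteq> S"
  proof clarify
    fix q assume q: "q \<in> S"
    then have "param c (coords c q) = q" using assms(1,2) by (intro param_coords) auto
    then show "param c (coords c q) \<in> S" using q by simp
  qed
qed

lemma compact_coords_image: "c \<in> \<A> \<Longrightarrow> compact S \<Longrightarrow> S \<subseteq> cdom c \<Longrightarrow> compact (coords c ` S)"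
  by (rule compact_continuous_image[OF continuous_on_subset[OF continuous_coords]])

lemma density_integrable:
  fixes D :: "'q \<Rightarrow> complex"
  assumes c: "c \<in> \<A>" and S: "compact S" "S \<subseteq> cdom c" and D: "continuous_on S D" "\<And>q. q \<in> cdom c \<Longrightarrow> q \<notin> S \<Longrightarrow> D q = 0"
  shows "set_integrable lborel (target c) (\<lambda>u. D (param c u))"
    and "(LINT u:target c|lborel. D (param c u)) = (LINT u:coords c ` S|lborel. D (param c u))"
proof -
  have 1: "coords c ` S \<subseteq> target c" using S by (auto simp: target_def)
  have 2: "D (param c u) = 0" if "u \<in> target c" "u \<notin> coords c ` S" for u
  proof -
    have "param c u \<notin> S" using that coords_param[OF c that(1)] by (metis imageI)
    then show ?thesis using D(2) param_cdom[OF c that(1)] by blast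
  qed
  show "(LINT u:target c|lborel. D (param c u)) = (LINT u:coords c ` S|lborel. D (param c u))"
    by (rule set_integral_support(1)[OF 1 2])
  show "set_integrable lborel (target c) (\<lambda>u. D (param c u))"
    by (rule set_integral_support(2)[OF 1 2, THEN iffD2, OF _ _
          set_integrable_compact[OF compact_coords_image[OF c S] continuous_on_param_image[OF c S(2) D(1)]]])
qed

text \<open>The change of variables is carried out on the image of the common compact set
  \<open>S\<close>, where all the data are continuous; outside of \<open>S\<close> the densities
  vanish.\<close>

lemma density_chart_independent:
  fixes D D' :: "'q \<Rightarrow> complex"
  assumes c: "c \<in> \<A>" "c' \<in> \<A>" and S: "compact S" "S \<subseteq> cdom c" "S \<subseteq> cdom c'"
    and D: "continuous_on S D" "\<And>q. q \<in> cdom c \<Longrightarrow> q \<notin> S \<Longrightarrow> D q = 0"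
    and D': "continuous_on S D'" "\<And>q. q \<in> cdom c' \<Longrightarrow> q \<notin> S \<Longrightarrow> D' q = 0"
    and tr: "\<And>q. q \<in> S \<Longrightarrow> D q = \<bar>det (matrix (T c c' q))\<bar> *\<^sub>R D' q"
  shows "(LINT u:target c|lborel. D (param c u)) = (LINT u:target c'|lborel. D' (param c' u))"
proof -
  let ?g = "coords c' \<circ> param c" and ?S = "coords c ` S"
  have pc: "param c (coords c q) = q" "param c' (coords c' q) = q" if "q \<in> S" for q
    using that S c param_coords by blast+
  have g: "?g ` ?S = coords c' ` S" using pc by (force simp: image_image)
  have sub: "?S \<subseteq> coords c ` (cdom c \<inter> cdom c')" using S by auto
  have "(LINT u:?S|lborel. \<bar>det (matrix (T c c' (param c u)))\<bar> *\<^sub>R D' (param c' (?g u))) = (LINT u:?g ` ?S|lborel. D' (param c' u))"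
  proof (rule change_of_variables_complex)
    show "compact ?S" by (rule compact_coords_image[OF c(1) S(1,2)])
    show "(?g has_derivative T c c' (param c u)) (at u within ?S)" if u: "u \<in> ?S" for u
    proof -
      obtain q where q: "q \<in> S" "u = coords c q" using u by blast
      then have "(?g has_derivative T c c' q) (at (coords c q) within half_space)"
        using S c by (intro transition_works) auto
      then have "(?g has_derivative T c c' q) (at (coords c q) within ?S)"
        by (rule has_derivative_subset) (use S c coords_half_space in blast)
      then show ?thesis using q pc by simp
    qed
    show "continuous_on ?S (\<lambda>u. T c c' (param c u) v)" for v
      by (rule continuous_on_subset[OF transition_works(2)[OF c] sub])
    show "inj_on ?g ?S"
      using pc by (auto simp: inj_on_def) (metis)
    show "continuous_on (?g ` ?S) (\<lambda>u. D' (param c' u))"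
      unfolding g by (rule continuous_on_param_image[OF c(2) S(3) D'(1)])
  qed
  moreover have "(LINT u:?S|lborel. \<bar>det (matrix (T c c' (param c u)))\<bar> *\<^sub>R D' (param c' (?g u))) = (LINT u:?S|lborel. D (param c u))"
    unfolding set_lebesgue_integral_def
    by (rule Bochner_Integration.integral_cong[OF refl]) (auto simp: indicator_def pc tr)
  ultimately have "(LINT u:?S|lborel. D (param c u)) = (LINT u:coords c' ` S|lborel. D' (param c' u))"
    unfolding g by simp
  moreover have "(LINT u:target c|lborel. D (param c u)) = (LINT u:?S|lborel. D (param c u))"
    by (rule density_integrable(2)[OF c(1) S(1,2) D])
  moreover have "(LINT u:target c'|lborel. D' (param c' u)) = (LINT u:coords c' ` S|lborel. D' (param c' u))"
    by (rule density_integrable(2)[OF c(2) S(1,3) D'])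
  ultimately show ?thesis by simp
qed

lemma boundary_density_integrable:
  fixes D :: "'q \<Rightarrow> complex"
  assumes c: "c \<in> \<A>" and S: "compact S" "S \<subseteq> cdom c" "S \<subseteq> boundary \<A>"
    and D: "continuous_on S D" "\<And>q. q \<in> cdom c \<Longrightarrow> q \<in> boundary \<A> \<Longrightarrow> q \<notin> S \<Longrightarrow> D q = 0"
  shows "set_integrable hyperplane_lborel (coords c ` (cdom c \<inter> boundary \<A>)) (\<lambda>u. D (param c u))"
    and "(LINT u:coords c ` (cdom c \<inter> boundary \<A>)|hyperplane_lborel. D (param c u)) = (LINT x:slab (coords c ` S)|lborel. D (param c (boundary_proj x)))"
proof -
  have 1: "coords c ` S \<subseteq> coords c ` (cdom c \<inter> boundary \<A>)" using S by auto
  have 2: "D (param c u) = 0" if u: "u \<in> coords c ` (cdom c \<inter> boundary \<A>)" "u \<notin> coords c ` S" for u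
  proof -
    obtain q where q: "u = coords c q" "q \<in> cdom c" "q \<in> boundary \<A>" using u(1) by (elim imageE IntE)
    then have "q \<notin> S" using u(2) by blast
    then show ?thesis using D(2)[OF q(2,3)] c q by simp
  qed
  note h = hyperplane_integral_compact[OF compact_coords_image[OF c S(1,2)] continuous_on_param_image[OF c S(2) D(1)]]
  show "(LINT u:coords c ` (cdom c \<inter> boundary \<A>)|hyperplane_lborel. D (param c u)) = (LINT x:slab (coords c ` S)|lborel. D (param c (boundary_proj x)))"
    by (rule trans[OF set_integral_support(1)[OF 1 2] h(2)])
  show "set_integrable hyperplane_lborel (coords c ` (cdom c \<inter> boundary \<A>)) (\<lambda>u. D (param c u))"
    by (rule set_integral_support(2)[OF 1 2, THEN iffD2, OF _ _ h(1)])
qed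

text \<open>Change of variables in full dimension for a map \<open>g\<close> that acts as the
  transition on the boundary and leaves the thickening coordinate alone. Its derivative is
  \<open>thick_transition\<close>, whose determinant is thus the Jacobian of the boundary
  transition. This includes dimension 1, where the boundary measure is a point mass.\<close>

lemma boundary_density_chart_independent:
  fixes D D' :: "'q \<Rightarrow> complex"
  assumes c: "c \<in> \<A>" "c' \<in> \<A>" and S: "compact S" "S \<subseteq> cdom c" "S \<subseteq> cdom c'" "S \<subseteq> boundary \<A>"
    and D: "continuous_on S D" "\<And>q. q \<in> cdom c \<Longrightarrow> q \<in> boundary \<A> \<Longrightarrow> q \<notin> S \<Longrightarrow> D q = 0"
    and D': "continuous_on S D'" "\<And>q. q \<in> cdom c' \<Longrightarrow> q \<in> boundary \<A> \<Longrightarrow> q \<notin> S \<Longrightarrow> D' q = 0"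
    and tr: "\<And>q. q \<in> S \<Longrightarrow> D q = \<bar>det (matrix (thick_transition c c' q))\<bar> *\<^sub>R D' q"
  shows "(LINT u:coords c ` (cdom c \<inter> boundary \<A>)|hyperplane_lborel. D (param c u))
    = (LINT u:coords c' ` (cdom c' \<inter> boundary \<A>)|hyperplane_lborel. D' (param c' u))"
proof -
  let ?o = "first_coord :: 'n"
  define g where "g x = upd ((coords c' \<circ> param c) (boundary_proj x)) ?o (x $ ?o)" for x
  have blp: "bounded_linear boundary_proj" using linear_boundary_proj by (simp add: linear_conv_bounded_linear)
  let ?S = "slab (coords c ` S)" and ?S' = "slab (coords c' ` S)"
  have pc: "param c (coords c q) = q" "param c' (coords c' q) = q" if "q \<in> S" for q
    using that S c param_coords by blast+
  have b0: "coords c q $ ?o = 0" "coords c' q $ ?o = 0" if "q \<in> S" for q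
    using that S c boundary_chart by blast+
  have bp: "boundary_proj (upd (coords c q) ?o t) = coords c q" "boundary_proj (upd (coords c' q) ?o t) = coords c' q" if "q \<in> S" for q t
    using b0[OF that] by (auto simp: boundary_proj_def vec_eq_iff)
  have slab: "?S = {upd (coords c q) ?o t | q t. q \<in> S \<and> t \<in> {0..1}}"
    and slab': "?S' = {upd (coords c' q) ?o t | q t. q \<in> S \<and> t \<in> {0..1}}"
  proof -
    have *: "slab (coords a ` S) = {upd (coords a q) ?o t | q t. q \<in> S \<and> t \<in> {0..1}}"
      if a: "\<And>q t. q \<in> S \<Longrightarrow> boundary_proj (upd (coords a q) ?o t) = coords a q" for a
    proof (intro set_eqI iffI)
      fix x assume "x \<in> slab (coords a ` S)"
      then obtain q where q: "q \<in> S" "boundary_proj x = coords a q" "x $ ?o \<in> {0..1}" by (auto simp: slab_def)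
      have "x = upd (boundary_proj x) ?o (x $ ?o)" by (auto simp: boundary_proj_def vec_eq_iff)
      then show "x \<in> {upd (coords a q) ?o t | q t. q \<in> S \<and> t \<in> {0..1}}" using q by auto
    qed (use a in \<open>auto simp: slab_def\<close>)
    show "?S = {upd (coords c q) ?o t | q t. q \<in> S \<and> t \<in> {0..1}}" "?S' = {upd (coords c' q) ?o t | q t. q \<in> S \<and> t \<in> {0..1}}"
      by (rule *, rule bp, assumption)+
  qed
  have g: "g (upd (coords c q) ?o t) = upd (coords c' q) ?o t" if "q \<in> S" for q t
    using bp[OF that] pc[OF that] by (simp add: g_def)
  have gS: "g ` ?S = ?S'" unfolding slab slab' using g by (auto simp: image_iff) (metis g)
  have "(LINT x:?S|lborel. \<bar>det (matrix (thick_transition c c' (param c (boundary_proj x))))\<bar> *\<^sub>R D' (param c' (boundary_proj (g x))))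
     = (LINT y:g ` ?S|lborel. D' (param c' (boundary_proj y)))"
  proof (rule change_of_variables_complex)
    show "compact ?S" by (intro compact_slab compact_coords_image c S)
    show "(g has_derivative thick_transition c c' (param c (boundary_proj x))) (at x within ?S)" if x: "x \<in> ?S" for x
    proof -
      obtain q where q: "q \<in> S" "boundary_proj x = coords c q" using x by (auto simp: slab_def)
      have "(coords c' \<circ> param c has_derivative T c c' q) (at (coords c q) within half_space)"
        using S c q by (intro transition_works) auto
      then have "(coords c' \<circ> param c has_derivative T c c' q) (at (boundary_proj x) within boundary_proj ` ?S)"
        unfolding q(2) by (rule has_derivative_subset) (use S(2) coords_half_space[OF c(1)] in \<open>auto simp: slab_def\<close>)
      moreover have "(boundary_proj has_derivative boundary_proj) (at x within ?S)"
        by (rule bounded_linear_imp_has_derivative[OF blp])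
      ultimately have 1: "((coords c' \<circ> param c) \<circ> boundary_proj has_derivative T c c' q \<circ> boundary_proj) (at x within ?S)"
        by (intro diff_chain_within)
      have "(boundary_proj \<circ> ((coords c' \<circ> param c) \<circ> boundary_proj) has_derivative boundary_proj \<circ> (T c c' q \<circ> boundary_proj)) (at x within ?S)"
        by (rule diff_chain_within[OF 1 bounded_linear_imp_has_derivative[OF blp]])
      moreover have "((\<lambda>x. (x $ ?o) *\<^sub>R axis ?o 1) has_derivative (\<lambda>h. (h $ ?o) *\<^sub>R axis ?o 1)) (at x within ?S)"
        by (intro has_derivative_scaleR_left bounded_linear_imp_has_derivative bounded_linear_vec_nth)
      ultimately have "((\<lambda>x. (boundary_proj \<circ> ((coords c' \<circ> param c) \<circ> boundary_proj)) x + (x $ ?o) *\<^sub>R axis ?o 1) has_derivative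
         (\<lambda>h. (boundary_proj \<circ> (T c c' q \<circ> boundary_proj)) h + (h $ ?o) *\<^sub>R axis ?o 1)) (at x within ?S)"
        by (rule has_derivative_add)
      \<comment> \<open>Written as a sum, \<open>upd\<close> can be differentiated jointly in the
        vector and in the inserted coordinate.\<close>
      moreover have u: "upd y ?o t = boundary_proj y + t *\<^sub>R axis ?o 1" for y :: "real^'n::_" and t
        by (auto simp: boundary_proj_def vec_eq_iff axis_def)
      ultimately show ?thesis
        using pc(1)[OF q(1)] q(2) unfolding g_def[abs_def] thick_transition_def[abs_def] u o_def by simp
    qed
    show "continuous_on ?S (\<lambda>x. thick_transition c c' (param c (boundary_proj x)) v)" for v
    proof -
      have "continuous_on ?S (\<lambda>x. T c c' (param c (boundary_proj x)) (boundary_proj v))"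
        by (rule continuous_on_compose2[OF transition_works(2)[OF c] continuous_on_boundary_proj]) (use S in \<open>auto simp: slab_def\<close>)
      then show ?thesis
        unfolding thick_transition_def by (rule continuous_on_compose2[OF continuous_on_upd[of UNIV]]) auto
    qed
    show "inj_on g ?S"
    proof (rule inj_onI)
      fix x y assume xy: "x \<in> ?S" "y \<in> ?S" "g x = g y"
      then obtain q t q' t' where q: "x = upd (coords c q) ?o t" "q \<in> S" "y = upd (coords c q') ?o t'" "q' \<in> S"
        unfolding slab by blast
      then have e: "upd (coords c' q) ?o t = upd (coords c' q') ?o t'" using xy(3) g by simp
      have "boundary_proj (upd (coords c' q) ?o t) = boundary_proj (upd (coords c' q') ?o t')" using e by simp
      then have "coords c' q = coords c' q'" using bp(2) q by simp
      then have "q = q'" using pc(2) q by metis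
      moreover have "t = t'" using arg_cong[OF e, of "\<lambda>v. v $ ?o"] by simp
      ultimately show "x = y" using q by simp
    qed
    have "continuous_on (coords c' ` S) (\<lambda>u. D' (param c' u))" by (rule continuous_on_param_image[OF c(2) S(3) D'(1)])
    then show "continuous_on (g ` ?S) (\<lambda>y. D' (param c' (boundary_proj y)))"
      unfolding gS by (rule continuous_on_compose2[OF _ continuous_on_boundary_proj]) (auto simp: slab_def)
  qed
  moreover have "(LINT x:?S|lborel. \<bar>det (matrix (thick_transition c c' (param c (boundary_proj x))))\<bar> *\<^sub>R D' (param c' (boundary_proj (g x))))
     = (LINT x:?S|lborel. D (param c (boundary_proj x)))"
    unfolding set_lebesgue_integral_def
  proof (rule Bochner_Integration.integral_cong[OF refl])
    fix x
    show "indicator ?S x *\<^sub>R (\<bar>det (matrix (thick_transition c c' (param c (boundary_proj x))))\<bar> *\<^sub>R D' (param c' (boundary_proj (g x))))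
       = indicator ?S x *\<^sub>R D (param c (boundary_proj x))"
    proof (cases "x \<in> ?S")
      case True
      then obtain q t where q: "x = upd (coords c q) ?o t" "q \<in> S" unfolding slab by blast
      then show ?thesis using g[OF q(2)] bp[OF q(2)] pc[OF q(2)] tr[OF q(2)] by simp
    qed simp
  qed
  moreover have "(LINT u:coords c ` (cdom c \<inter> boundary \<A>)|hyperplane_lborel. D (param c u)) = (LINT x:?S|lborel. D (param c (boundary_proj x)))"
    by (rule boundary_density_integrable(2)[OF c(1) S(1,2,4) D])
  moreover have "(LINT u:coords c' ` (cdom c' \<inter> boundary \<A>)|hyperplane_lborel. D' (param c' u)) = (LINT x:?S'|lborel. D' (param c' (boundary_proj x)))"
    by (rule boundary_density_integrable(2)[OF c(2) S(1,3,4) D'])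
  ultimately show ?thesis unfolding gS by simp
qed

end

section \<open>Partitions of unity\<close>

text \<open>What \<open>chart_partition\<close> requires of a single function, except for its sign.
  Since multiplication by a continuous function preserves it, a product from two partitions is
  admissible for both of the charts concerned.\<close>

definition admissible :: "'q::topological_space set \<Rightarrow> ('q, 'n::finite) chart \<Rightarrow> ('q \<Rightarrow> real) \<Rightarrow> bool" where
  "admissible M c f \<longleftrightarrow> continuous_on M f \<and> compact (closure {q \<in> M. f q \<noteq> 0}) \<and> closure {q \<in> M. f q \<noteq> 0} \<subseteq> cdom c"

lemma admissible_mult:
  fixes f g :: "'q::t2_space \<Rightarrow> real"
  assumes "admissible M c f" "continuous_on M g"
  shows "admissible M c (\<lambda>q. f q * g q)"
proof -
  have sub: "closure {q \<in> M. f q * g q \<noteq> 0} \<subseteq> closure {q \<in> M. f q \<noteq> 0}" by (intro closure_mono) auto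
  moreover have "closure {q \<in> M. f q * g q \<noteq> 0} = closure {q \<in> M. f q \<noteq> 0} \<inter> closure {q \<in> M. f q * g q \<noteq> 0}"
    using sub by blast
  moreover have "compact (closure {q \<in> M. f q \<noteq> 0} \<inter> closure {q \<in> M. f q * g q \<noteq> 0})"
    using assms(1) by (intro compact_Int_closed) (auto simp: admissible_def)
  ultimately show ?thesis using assms by (auto simp: admissible_def intro: continuous_intros)
qed

text \<open>Each partition is inserted into the other; the products of a \<open>p i\<close> with a
  \<open>p' j\<close> are supported in both charts and can be moved from one to the other. The
  abstract \<open>J\<close> stands for the integral over the manifold or over its boundary.\<close>

lemma chart_partition_independent:
  fixes J :: "('q::t2_space, 'n::finite) chart \<Rightarrow> ('q \<Rightarrow> real) \<Rightarrow> complex"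
  assumes P: "chart_partition \<A> M K N c p" "chart_partition \<A> M K N' c' p'"
    and sum: "\<And>c f (n :: nat). c \<in> \<A> \<Longrightarrow> (\<And>j. j < n \<Longrightarrow> admissible M c (f j)) \<Longrightarrow> J c (\<lambda>q. \<Sum>j<n. f j q) = (\<Sum>j<n. J c (f j))"
    and cong: "\<And>c f g. c \<in> \<A> \<Longrightarrow> (\<And>q. q \<in> M \<Longrightarrow> q \<in> K \<Longrightarrow> q \<in> cdom c \<Longrightarrow> f q = g q) \<Longrightarrow> J c f = J c g"
    and ind: "\<And>c c' f. c \<in> \<A> \<Longrightarrow> c' \<in> \<A> \<Longrightarrow> admissible M c f \<Longrightarrow> admissible M c' f \<Longrightarrow> J c f = J c' f"
  shows "(\<Sum>i<N. J (c i) (p i)) = (\<Sum>j<N'. J (c' j) (p' j))"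
proof -
  have a: "c i \<in> \<A>" "admissible M (c i) (p i)" "continuous_on M (p i)" if "i < N" for i
    using P(1) that by (auto simp: chart_partition_def admissible_def)
  have a': "c' j \<in> \<A>" "admissible M (c' j) (p' j)" "continuous_on M (p' j)" if "j < N'" for j
    using P(2) that by (auto simp: chart_partition_def admissible_def)
  have one: "(\<Sum>i<N. p i q) = 1" "(\<Sum>j<N'. p' j q) = 1" if "q \<in> K" for q
    using P that by (auto simp: chart_partition_def)
  have ad: "admissible M (c i) (\<lambda>q. p i q * p' j q)" "admissible M (c' j) (\<lambda>q. p i q * p' j q)" if "i < N" "j < N'" for i j
    using admissible_mult[OF a(2)[OF that(1)] a'(3)[OF that(2)]]
      admissible_mult[OF a'(2)[OF that(2)] a(3)[OF that(1)]] by (simp_all add: mult.commute)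
  have "(\<Sum>i<N. J (c i) (p i)) = (\<Sum>i<N. \<Sum>j<N'. J (c i) (\<lambda>q. p i q * p' j q))"
  proof (rule sum.cong[OF refl])
    fix i assume i: "i \<in> {..<N}"
    have "J (c i) (p i) = J (c i) (\<lambda>q. \<Sum>j<N'. p i q * p' j q)"
      by (rule cong) (use i a one in \<open>auto simp: sum_distrib_left[symmetric]\<close>)
    also have "\<dots> = (\<Sum>j<N'. J (c i) (\<lambda>q. p i q * p' j q))"
      using sum[of "c i" N' "\<lambda>j q. p i q * p' j q"] i a ad by auto
    finally show "J (c i) (p i) = (\<Sum>j<N'. J (c i) (\<lambda>q. p i q * p' j q))" .
  qed
  also have "\<dots> = (\<Sum>i<N. \<Sum>j<N'. J (c' j) (\<lambda>q. p i q * p' j q))"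
    by (intro sum.cong refl ind) (use a a' ad in auto)
  also have "\<dots> = (\<Sum>j<N'. \<Sum>i<N. J (c' j) (\<lambda>q. p i q * p' j q))" by (rule sum.swap)
  also have "\<dots> = (\<Sum>j<N'. J (c' j) (p' j))"
  proof (rule sum.cong[OF refl])
    fix j assume j: "j \<in> {..<N'}"
    have "J (c' j) (p' j) = J (c' j) (\<lambda>q. \<Sum>i<N. p i q * p' j q)"
      by (rule cong) (use j a' one in \<open>auto simp: sum_distrib_right[symmetric]\<close>)
    also have "\<dots> = (\<Sum>i<N. J (c' j) (\<lambda>q. p i q * p' j q))"
      using sum[of "c' j" N "\<lambda>i q. p i q * p' j q"] j a' ad by auto
    finally show "(\<Sum>i<N. J (c' j) (\<lambda>q. p i q * p' j q)) = J (c' j) (p' j)" ..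
  qed
  finally show ?thesis .
qed

text \<open>Squaring makes the positive part continuously differentiable. This serves to build bump
  functions and to keep a denominator away from 0.\<close>

lemma pos_part_squared_derivative:
  "((\<lambda>s. (max 0 s)\<^sup>2) has_real_derivative 2 * max 0 s) (at (s :: real))"
proof -
  consider "s > 0" | "s < 0" | "s = 0" by linarith
  then show ?thesis
  proof cases
    case 1
    have "((\<lambda>s. s\<^sup>2) has_real_derivative 2 * s) (at s)" by (auto intro!: derivative_eq_intros)
    then have "((\<lambda>s. (max 0 s)\<^sup>2) has_real_derivative 2 * s) (at s)"
      by (rule has_field_derivative_transform_within_open[of _ _ _ "{0<..}"]) (use 1 in auto)
    then show ?thesis using 1 by simp
  next
    case 2
    have "((\<lambda>s. 0) has_real_derivative 0) (at s)" by simp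
    then have "((\<lambda>s. (max 0 s)\<^sup>2) has_real_derivative 0) (at s)"
      by (rule has_field_derivative_transform_within_open[of _ _ _ "{..<0}"]) (use 2 in auto)
    then show ?thesis using 2 by simp
  next
    case 3
    have "((\<lambda>h. (max 0 h)\<^sup>2 / h) \<longlongrightarrow> 0) (at (0::real))"
    proof (rule Lim_null_comparison)
      show "eventually (\<lambda>h. norm ((max 0 h)\<^sup>2 / h) \<le> \<bar>h\<bar>) (at (0::real))"
        by (intro always_eventually allI) (auto simp: max_def power2_eq_square)
      show "((\<lambda>h. \<bar>h\<bar>) \<longlongrightarrow> 0) (at (0::real))" by (rule tendsto_rabs_zero) (rule tendsto_ident_at)
    qed
    then show ?thesis using 3 by (simp add: DERIV_def)
  qed
qed

section \<open>Continuously differentiable functions on the manifold\<close>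

context manifold
begin

text \<open>The derivative is part of the data because the forms \<open>dp \<and> \<eta>\<close> are
  built from it.\<close>

definition C1_deriv :: "('q \<Rightarrow> real) \<Rightarrow> (('q, 'n) chart \<Rightarrow> real^'n::_ \<Rightarrow> real^'n::_ \<Rightarrow> real) \<Rightarrow> bool" where
  "C1_deriv f df \<longleftrightarrow> (\<forall>c\<in>\<A>.
     (\<forall>u\<in>target c. ((\<lambda>u. f (param c u)) has_derivative df c u) (at u within half_space)) \<and>
     (\<forall>v. continuous_on (target c) (\<lambda>u. df c u v)))"

lemma C1_derivD:
  assumes "C1_deriv f df" "c \<in> \<A>"
  shows "u \<in> target c \<Longrightarrow> ((\<lambda>u. f (param c u)) has_derivative df c u) (at u within half_space)"
    and "continuous_on (target c) (\<lambda>u. df c u v)"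
  using assms by (auto simp: C1_deriv_def)

lemma C1_continuous_param:
  assumes "C1_deriv f df" "c \<in> \<A>" shows "continuous_on (target c) (\<lambda>u. f (param c u))"
proof (rule has_derivative_continuous_on)
  fix u assume u: "u \<in> target c"
  show "((\<lambda>u. f (param c u)) has_derivative df c u) (at u within target c)"
    unfolding within_target[OF assms(2) u] by (rule C1_derivD(1)[OF assms u])
qed

lemma continuous_on_cdom:
  assumes "c \<in> \<A>" "continuous_on (target c) h" shows "continuous_on (cdom c) (\<lambda>q. h (coords c q))"
  by (rule continuous_on_compose2[OF assms(2) continuous_coords[OF assms(1)]]) (auto simp: target_def)

lemma C1_continuous:
  assumes "C1_deriv f df" shows "continuous_on UNIV f"
proof -
  have "isCont f q" for q
  proof -
    obtain c where c: "c \<in> \<A>" "q \<in> cdom c" by (rule chart_at)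
    have "continuous_on (cdom c) (\<lambda>q. f (param c (coords c q)))"
      by (rule continuous_on_cdom[OF c(1) C1_continuous_param[OF assms c(1)]])
    then have "continuous_on (cdom c) f" using param_coords[OF c(1)] by (simp cong: continuous_on_cong)
    then show ?thesis using c open_cdom[OF c(1)] by (simp add: continuous_on_eq_continuous_at)
  qed
  then show ?thesis by (simp add: continuous_on_eq_continuous_at)
qed

lemma C1_mult:
  assumes "C1_deriv f df" "C1_deriv g dg"
  shows "C1_deriv (\<lambda>q. f q * g q) (\<lambda>c u v. f (param c u) * dg c u v + df c u v * g (param c u))"
  unfolding C1_deriv_def
  using C1_derivD[OF assms(1)] C1_derivD[OF assms(2)] C1_continuous_param[OF assms(1)] C1_continuous_param[OF assms(2)]
  by (intro ballI conjI allI has_derivative_mult continuous_intros) simp_all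

lemma C1_sum:
  assumes "\<And>i. i \<in> I \<Longrightarrow> C1_deriv (f i) (df i)"
  shows "C1_deriv (\<lambda>q. \<Sum>i\<in>I. f i q) (\<lambda>c u v. \<Sum>i\<in>I. df i c u v)"
  unfolding C1_deriv_def
  by (intro ballI conjI allI has_derivative_sum continuous_on_sum C1_derivD[OF assms])

lemma C1_compose:
  assumes "C1_deriv f df" "\<And>q. (\<theta> has_real_derivative \<theta>' (f q)) (at (f q))" "continuous_on (range f) \<theta>'"
  shows "C1_deriv (\<lambda>q. \<theta> (f q)) (\<lambda>c u v. df c u v * \<theta>' (f (param c u)))"
  unfolding C1_deriv_def
proof (intro ballI conjI allI)
  fix c u assume c: "c \<in> \<A>" "u \<in> target c"
  show "((\<lambda>u. \<theta> (f (param c u))) has_derivative (\<lambda>v. df c u v * \<theta>' (f (param c u)))) (at u within half_space)"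
    by (rule DERIV_compose_FDERIV[OF assms(2) C1_derivD(1)[OF assms(1) c]])
next
  fix c v assume c: "c \<in> \<A>"
  show "continuous_on (target c) (\<lambda>u. df c u v * \<theta>' (f (param c u)))"
    by (intro continuous_intros C1_derivD(2)[OF assms(1) c] continuous_on_compose2[OF assms(3) C1_continuous_param[OF assms(1) c]]) auto
qed

text \<open>The bump is the square of the positive part of
  \<open>e\<^sup>2 - (norm (u - x0))\<^sup>2\<close>, extended by 0. Its support lies in the image
  \<open>S\<close> of the part of a closed ball in the half-space. As \<open>S\<close> is compact,
  it is closed in the Hausdorff manifold, so the extension is differentiable across the edge of the
  chart.\<close>

lemma bump_exists:
  assumes c: "c \<in> \<A>" "q0 \<in> cdom c"
  obtains f df where "C1_deriv f df" "\<And>q. f q \<ge> 0" "f q0 > 0" "compact (closure {q. f q \<noteq> 0})" "closure {q. f q \<noteq> 0} \<subseteq> cdom c"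
proof -
  let ?x0 = "coords c q0"
  obtain e where e: "e > 0" "cball ?x0 e \<inter> half_space \<subseteq> target c"
    using openin_target[OF c(1), unfolded openin_contains_cball] coords_target[OF c(2)] by blast
  define s where "s u = e\<^sup>2 - (u - ?x0) \<bullet> (u - ?x0)" for u
  define b where "b u = (max 0 (s u))\<^sup>2" for u
  define b' where "b' u h = - 2 * ((u - ?x0) \<bullet> h) * (2 * max 0 (s u))" for u h
  have b: "(b has_derivative b' u) (at u)" for u
  proof -
    have "(s has_derivative (\<lambda>h. - 2 * ((u - ?x0) \<bullet> h))) (at u)"
      unfolding s_def by (auto intro!: derivative_eq_intros simp: inner_commute)
    from DERIV_compose_FDERIV[OF pos_part_squared_derivative this] show ?thesis
      by (simp add: b_def[abs_def] b'_def[abs_def])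
  qed
  define S where "S = param c ` (cball ?x0 e \<inter> half_space)"
  have "compact S" unfolding S_def
    by (intro compact_continuous_image continuous_on_subset[OF continuous_param[OF c(1)] e(2)] compact_Int_closed compact_cball closed_half_space)
  have Sc: "S \<subseteq> cdom c" unfolding S_def using e(2) param_cdom[OF c(1)] by blast
  define f where "f q = (if q \<in> cdom c then b (coords c q) else 0)" for q
  have s0: "max 0 (s (coords c q)) = 0" if "q \<in> cdom c" "q \<notin> S" for q
  proof -
    have "coords c q \<notin> cball ?x0 e"
      using that coords_half_space[OF c(1) that(1)] param_coords[OF c(1) that(1)] unfolding S_def by (metis IntI imageI)
    then have "e < norm (coords c q - ?x0)" by (simp add: dist_norm norm_minus_commute)
    then have "e\<^sup>2 < (norm (coords c q - ?x0))\<^sup>2" using e(1) by (intro power_strict_mono) auto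
    then show ?thesis by (simp add: s_def dot_square_norm)
  qed
  then have f0: "f q = 0" if "q \<notin> S" for q using that by (simp add: f_def b_def)
  define df where "df c' u v = (if param c' u \<in> cdom c then b' (coords c (param c' u)) (T c' c (param c' u) v) else 0)" for c' u v
  have "C1_deriv f df"
    unfolding C1_deriv_def
  proof (intro ballI conjI allI)
    fix c' assume c': "c' \<in> \<A>"
    let ?O = "coords c' ` (cdom c' \<inter> cdom c)" and ?W = "coords c' ` (cdom c' - S)"
    have O: "openin (top_of_set half_space) ?O" by (rule openin_overlap[OF c' c(1)])
    have W: "openin (top_of_set half_space) ?W"
      using c' open_cdom[OF c'] compact_imp_closed[OF \<open>compact S\<close>] by (intro openin_coords_image) auto
    \<comment> \<open>Two relatively open pieces: on the overlap with \<open>c\<close> the chain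
      rule applies, and off \<open>S\<close> the function is 0.\<close>
    have OW: "target c' = ?O \<union> ?W" using Sc by (auto simp: target_def)
    have OW_sub: "?O \<union> ?W \<subseteq> half_space" using openin_imp_subset[OF O] openin_imp_subset[OF W] by blast
    have dW: "df c' u v = 0" "f (param c' u) = 0" if u: "u \<in> ?W" for u v
    proof -
      obtain q where q: "u = coords c' q" "q \<in> cdom c'" "q \<notin> S" using u by (elim imageE DiffE)
      then have "param c' u = q" using c' by simp
      then show "df c' u v = 0" "f (param c' u) = 0"
        using s0[of q] q(3) f0[of q] by (auto simp: df_def b'_def)
    qed
    have O': "param c' u \<in> cdom c" "param c' u \<in> cdom c'" "coords c' (param c' u) = u" if "u \<in> ?O" for u
      using that c' by auto
    show "((\<lambda>u. f (param c' u)) has_derivative df c' u) (at u within half_space)" if u: "u \<in> target c'" for u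
    proof (cases "u \<in> ?O")
      case True
      let ?q = "param c' u"
      have "((coords c \<circ> param c') has_derivative T c' c ?q) (at u within half_space)"
        using transition_works(1)[OF c' c(1), of ?q] O'[OF True] by simp
      then have "(b \<circ> (coords c \<circ> param c') has_derivative b' (coords c ?q) \<circ> T c' c ?q) (at u within half_space)"
        by (intro diff_chain_within) (auto intro: has_derivative_at_withinI[OF b])
      moreover have "b' (coords c ?q) \<circ> T c' c ?q = df c' u" using O'(1)[OF True] by (auto simp: df_def)
      ultimately have "(b \<circ> (coords c \<circ> param c') has_derivative df c' u) (at u within ?O)"
        using at_within_openin[OF O True] by simp
      then have "((\<lambda>u. f (param c' u)) has_derivative df c' u) (at u within ?O)"
        by (rule has_derivative_transform[OF True, rotated]) (use O' in \<open>simp add: f_def\<close>)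
      then show ?thesis using at_within_openin[OF O True] by simp
    next
      case False
      then have uW: "u \<in> ?W" using u OW by blast
      have "((\<lambda>u. 0) has_derivative (\<lambda>_. 0)) (at u within ?W)" by (rule has_derivative_const)
      then have "((\<lambda>u. f (param c' u)) has_derivative (\<lambda>_. 0)) (at u within ?W)"
        by (rule has_derivative_transform[OF uW, rotated]) (use dW in simp)
      moreover have "df c' u = (\<lambda>_. 0)" using dW(1)[OF uW] by auto
      ultimately show ?thesis using at_within_openin[OF W uW] by simp
    qed
    show "continuous_on (target c') (\<lambda>u. df c' u v)" for v
      unfolding OW
    proof (rule continuous_on_Un_local_open)
      show "openin (top_of_set (?O \<union> ?W)) ?O" "openin (top_of_set (?O \<union> ?W)) ?W"
        by (rule openin_subset_trans[OF O _ OW_sub], blast) (rule openin_subset_trans[OF W _ OW_sub], blast)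
      have "continuous_on ?O (\<lambda>u. b' (coords c (param c' u)) (T c' c (param c' u) v))"
      proof -
        have g: "continuous_on ?O (coords c \<circ> param c')"
        proof (rule has_derivative_continuous_on)
          fix u assume u: "u \<in> ?O"
          show "((coords c \<circ> param c') has_derivative T c' c (param c' u)) (at u within ?O)"
            unfolding at_within_openin[OF O u] using transition_works(1)[OF c' c(1), of "param c' u"] O'[OF u] by simp
        qed
        then show ?thesis
          unfolding b'_def s_def o_def by (intro continuous_intros transition_works(2)[OF c' c(1)])
      qed
      then show "continuous_on ?O (\<lambda>u. df c' u v)"
        by (rule continuous_on_eq) (use O' in \<open>simp add: df_def\<close>)
      show "continuous_on ?W (\<lambda>u. df c' u v)"
        using dW(1) by (simp cong: continuous_on_cong)
    qed
  qed
  moreover have "f q \<ge> 0" for q by (simp add: f_def b_def)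
  moreover have "f q0 > 0" using c e(1) by (simp add: f_def b_def s_def)
  moreover have cl: "closure {q. f q \<noteq> 0} \<subseteq> S"
    using f0 compact_imp_closed[OF \<open>compact S\<close>] by (intro closure_minimal) auto
  moreover have "compact (closure {q. f q \<noteq> 0})"
    using compact_Int_closed[OF \<open>compact S\<close>, of "closure {q. f q \<noteq> 0}"] cl by (simp add: inf.absorb2)
  ultimately show ?thesis using that[of f df] Sc by blast
qed

text \<open>The sum \<open>t\<close> of the finitely many bump functions may vanish outside
  \<open>K\<close>, so the quotients are formed with \<open>\<psi> (t q)\<close>, which agrees with
  \<open>t q\<close> on \<open>K\<close> and is positive everywhere.\<close>

lemma smooth_partition_exists:
  assumes "compact K"
  obtains N c p dp where "chart_partition \<A> UNIV K N c p" "\<And>i. i < N \<Longrightarrow> C1_deriv (p i) (dp i)"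
proof -
  have "\<exists>c f df. c \<in> \<A> \<and> C1_deriv f df \<and> (\<forall>q. f q \<ge> 0) \<and> f q0 > 0 \<and> compact (closure {q. f q \<noteq> 0}) \<and> closure {q. f q \<noteq> 0} \<subseteq> cdom c" for q0
  proof -
    obtain c where c: "c \<in> \<A>" "q0 \<in> cdom c" by (rule chart_at)
    show ?thesis by (rule bump_exists[OF c]) (use c in blast)
  qed
  then obtain C F dF where F: "\<And>q0. C q0 \<in> \<A>" "\<And>q0. C1_deriv (F q0) (dF q0)" "\<And>q0 q. F q0 q \<ge> 0" "\<And>q0. F q0 q0 > 0"
    "\<And>q0. compact (closure {q. F q0 q \<noteq> 0})" "\<And>q0. closure {q. F q0 q \<noteq> 0} \<subseteq> cdom (C q0)"
    by metis
  have op: "open {q. F q0 q > 0}" for q0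
    using C1_continuous[OF F(2)] by (intro open_Collect_less continuous_intros) auto
  have "K \<subseteq> (\<Union>q0\<in>K. {q. F q0 q > 0})" using F(4) by blast
  then obtain K' where K': "K' \<subseteq> K" "finite K'" "K \<subseteq> (\<Union>q0\<in>K'. {q. F q0 q > 0})"
    using compactE_image[OF assms, of K "\<lambda>q0. {q. F q0 q > 0}"] op by metis
  obtain xs where xs: "set xs = K'" using finite_list[OF K'(2)] by blast
  define N where "N = length xs"
  define f where "f i = F (xs ! i)" for i
  define t where "t q = (\<Sum>i<N. f i q)" for q
  have t0: "t q \<ge> 0" for q unfolding t_def f_def by (intro sum_nonneg F)
  have tC1: "C1_deriv t (\<lambda>c u v. \<Sum>i<N. dF (xs ! i) c u v)"
    unfolding t_def f_def by (rule C1_sum) (rule F(2))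
  have tpos: "t q > 0" if q: "q \<in> K" for q
  proof -
    obtain q0 where q0: "q0 \<in> K'" "F q0 q > 0" using K'(3) q by blast
    then obtain i where i: "i < N" "xs ! i = q0" using xs unfolding N_def by (metis in_set_conv_nth)
    have "f i q \<le> t q" unfolding t_def f_def using i by (intro member_le_sum) (auto intro: F)
    then show ?thesis using q0 i by (simp add: f_def)
  qed
  have "\<exists>m>0. \<forall>q\<in>K. m \<le> t q"
  proof (cases "K = {}")
    case True then show ?thesis by (intro exI[of _ 1]) simp
  next
    case False
    have "continuous_on K t" using C1_continuous[OF tC1] continuous_on_subset by blast
    then obtain q where "q \<in> K" "\<forall>q'\<in>K. t q \<le> t q'" using continuous_attains_inf[OF assms False] by blast
    then show ?thesis using tpos by blast
  qed
  then obtain m where m: "m > 0" "\<And>q. q \<in> K \<Longrightarrow> m \<le> t q" by blast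
  \<comment> \<open>Equal to \<open>s\<close> for \<open>s \<ge> m\<close>, with value
    \<open>m\<close> at 0, and continuously differentiable in between.\<close>
  define \<psi> where "\<psi> s = s + (max 0 (m - s))\<^sup>2 / m" for s
  define \<psi>' where "\<psi>' s = 1 - 2 * max 0 (m - s) / m" for s
  have \<psi>: "(\<psi> has_real_derivative \<psi>' s) (at s)" for s
  proof -
    have "((\<lambda>s. (max 0 (m - s))\<^sup>2) has_real_derivative (2 * max 0 (m - s)) * (-1)) (at s)"
      by (rule DERIV_chain2[OF pos_part_squared_derivative]) (auto intro!: derivative_eq_intros)
    from DERIV_add[OF DERIV_ident DERIV_cdivide[OF this, of m]] show ?thesis by (simp add: \<psi>_def[abs_def] \<psi>'_def)
  qed
  have \<psi>pos: "\<psi> s > 0" if "s \<ge> 0" for s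
  proof (cases "s = 0")
    case True then show ?thesis using m(1) by (simp add: \<psi>_def)
  next
    case False
    have "0 \<le> (max 0 (m - s))\<^sup>2 / m" using m(1) by simp
    then show ?thesis using False that unfolding \<psi>_def by linarith
  qed
  define \<theta> where "\<theta> s = 1 / \<psi> s" for s
  define \<theta>' where "\<theta>' s = - (\<psi>' s / (\<psi> s)\<^sup>2)" for s
  have \<theta>: "(\<theta> has_real_derivative \<theta>' (t q)) (at (t q))" for q
    unfolding \<theta>_def \<theta>'_def using \<psi>[of "t q"] \<psi>pos[OF t0[of q]]
    by (auto intro!: derivative_eq_intros simp: power2_eq_square)
  have \<theta>'c: "continuous_on (range t) \<theta>'"
  proof -
    have "continuous_on (range t) \<psi>" unfolding \<psi>_def[abs_def] using m(1) by (intro continuous_intros) auto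
    moreover have "continuous_on (range t) \<psi>'" unfolding \<psi>'_def[abs_def] using m(1) by (intro continuous_intros) auto
    moreover have "\<psi> (t q) \<noteq> 0" for q using \<psi>pos[OF t0[of q]] by simp
    ultimately show ?thesis unfolding \<theta>'_def[abs_def] by (intro continuous_intros) auto
  qed
  define p where "p i q = f i q * \<theta> (t q)" for i q
  have pC1: "\<exists>dp. C1_deriv (p i) dp" for i
    unfolding p_def f_def using C1_mult[OF F(2) C1_compose[OF tC1 \<theta> \<theta>'c]] by blast
  then obtain dp where dp: "\<And>i. C1_deriv (p i) (dp i)" by metis
  have "chart_partition \<A> UNIV K N (\<lambda>i. C (xs ! i)) p"
    unfolding chart_partition_def
  proof (intro conjI allI impI ballI)
    fix i assume "i < N"
    show "C (xs ! i) \<in> \<A>" by (rule F)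
    show "continuous_on UNIV (p i)" by (rule C1_continuous[OF dp])
    show "0 \<le> p i q" for q
      unfolding p_def f_def \<theta>_def using F(3) \<psi>pos[OF t0[of q]] by (intro mult_nonneg_nonneg) auto
    have sub: "closure {q \<in> UNIV. p i q \<noteq> 0} \<subseteq> closure {q. F (xs ! i) q \<noteq> 0}"
      by (intro closure_mono) (auto simp: p_def f_def)
    then show "closure {q \<in> UNIV. p i q \<noteq> 0} \<subseteq> cdom (C (xs ! i))" using F(6) by blast
    show "compact (closure {q \<in> UNIV. p i q \<noteq> 0})"
      using compact_Int_closed[OF F(5)[of "xs ! i"], of "closure {q \<in> UNIV. p i q \<noteq> 0}"] sub by (simp add: inf.absorb2)
  next
    fix q assume q: "q \<in> K"
    have "max 0 (m - t q) = 0" using m(2)[OF q] by simp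
    then have "\<psi> (t q) = t q" by (simp add: \<psi>_def)
    then show "(\<Sum>i<N. p i q) = 1"
      using tpos[OF q] unfolding p_def \<theta>_def by (simp add: sum_divide_distrib[symmetric] t_def)
  qed
  then show ?thesis using that dp by blast
qed

end

section \<open>Stokes' theorem for differentiable forms\<close>

lemma alt_form_cong:
  assumes "\<And>vs. length vs = k \<Longrightarrow> f vs = g vs" "alt_form k g" shows "alt_form k f"
  using assms unfolding alt_form_def by simp

text \<open>Common to the manifold and its boundary: once the densities \<open>D\<close> are
  integrable, independent of the chart and zero off the support of the form, the value found with
  one partition is the value for all.\<close>

lemma has_form_integral_overI:
  fixes D :: "('q::t2_space, 'n::finite) chart \<Rightarrow> 'q \<Rightarrow> complex"
  assumes D: "\<And>c q. D c q = of_real (\<sigma> c q) * \<eta> q (map (coord_vec \<A> c q) js)"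
    and param: "\<And>c q. c \<in> \<A> \<Longrightarrow> q \<in> cdom c \<Longrightarrow> param c (coords c q) = q"
    and int: "\<And>c f. c \<in> \<A> \<Longrightarrow> admissible M c f \<Longrightarrow>
      set_integrable \<mu> (coords c ` (cdom c \<inter> M)) (\<lambda>u. of_real (f (param c u)) * D c (param c u))"
    and ind: "\<And>c c' f. c \<in> \<A> \<Longrightarrow> c' \<in> \<A> \<Longrightarrow> admissible M c f \<Longrightarrow> admissible M c' f \<Longrightarrow>
      (LINT u:coords c ` (cdom c \<inter> M)|\<mu>. of_real (f (param c u)) * D c (param c u))
      = (LINT u:coords c' ` (cdom c' \<inter> M)|\<mu>. of_real (f (param c' u)) * D c' (param c' u))"
    and vanish: "\<And>c q. c \<in> \<A> \<Longrightarrow> q \<in> cdom c \<Longrightarrow> q \<in> M \<Longrightarrow> q \<notin> form_support \<A> (length js) \<eta> \<Longrightarrow> D c q = 0"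
    and part: "chart_partition \<A> M (M \<inter> form_support \<A> (length js) \<eta>) N c p"
  shows "has_form_integral_over \<A> \<sigma> M \<mu> js \<eta>
    (\<Sum>i<N. LINT u:coords (c i) ` (cdom (c i) \<inter> M)|\<mu>. of_real (p i (param (c i) u)) * D (c i) (param (c i) u))"
proof -
  define J where "J c f = (LINT u:coords c ` (cdom c \<inter> M)|\<mu>. of_real (f (param c u)) * D c (param c u))" for c f
  have ci: "chart_integrand \<A> \<sigma> js c f \<eta> = (\<lambda>u. of_real (f (param c u)) * D c (param c u))" for c f
    by (rule ext) (simp add: chart_integrand_def Let_def D)
  have A: "(\<Sum>i<N'. J (c' i) (p' i)) = (\<Sum>i<N. J (c i) (p i))"
    if "chart_partition \<A> M (M \<inter> form_support \<A> (length js) \<eta>) N' c' p'" for N' c' p'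
  proof (rule chart_partition_independent[OF that part])
    fix c and f :: "nat \<Rightarrow> 'q \<Rightarrow> real" and n :: nat
    assume c: "c \<in> \<A>" and f: "\<And>j. j < n \<Longrightarrow> admissible M c (f j)"
    have "integrable \<mu> (\<lambda>u. indicator (coords c ` (cdom c \<inter> M)) u *\<^sub>R (of_real (f j (param c u)) * D c (param c u)))" if "j < n" for j
      using int[OF c f[OF that]] unfolding set_integrable_def .
    then show "J c (\<lambda>q. \<Sum>j<n. f j q) = (\<Sum>j<n. J c (f j))"
      unfolding J_def set_lebesgue_integral_def
      by (subst Bochner_Integration.integral_sum[symmetric]) (auto simp: sum_distrib_right scaleR_sum_right)
  next
    fix c and f g :: "'q \<Rightarrow> real" assume c: "c \<in> \<A>" and fg: "\<And>q. q \<in> M \<Longrightarrow> q \<in> M \<inter> form_support \<A> (length js) \<eta> \<Longrightarrow> q \<in> cdom c \<Longrightarrow> f q = g q"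
    show "J c f = J c g"
      unfolding J_def set_lebesgue_integral_def
    proof (rule Bochner_Integration.integral_cong[OF refl])
      fix u
      show "indicator (coords c ` (cdom c \<inter> M)) u *\<^sub>R (of_real (f (param c u)) * D c (param c u))
        = indicator (coords c ` (cdom c \<inter> M)) u *\<^sub>R (of_real (g (param c u)) * D c (param c u))"
      proof (cases "u \<in> coords c ` (cdom c \<inter> M)")
        case True
        then obtain q where q: "u = coords c q" "q \<in> cdom c" "q \<in> M" by (elim imageE IntE)
        then have "f q = g q \<or> D c q = 0" using fg[of q] vanish[OF c q(2,3)] by blast
        then show ?thesis using q param[OF c q(2)] by auto
      qed simp
    qed
  next
    fix c c' and f :: "'q \<Rightarrow> real" assume "c \<in> \<A>" "c' \<in> \<A>" "admissible M c f" "admissible M c' f"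
    then show "J c f = J c' f" unfolding J_def by (rule ind)
  qed
  have B: "set_integrable \<mu> (coords (c' i) ` (cdom (c' i) \<inter> M)) (chart_integrand \<A> \<sigma> js (c' i) (p' i) \<eta>)"
    if "chart_partition \<A> M (M \<inter> form_support \<A> (length js) \<eta>) N' c' p'" "i < N'" for N' c' p' i
    unfolding ci by (rule int) (use that in \<open>auto simp: chart_partition_def admissible_def\<close>)
  show ?thesis
    unfolding has_form_integral_over_def Let_def
  proof (intro conjI allI impI)
    show "\<exists>N c p. chart_partition \<A> M (M \<inter> form_support \<A> (length js) \<eta>) N c p"
      by (intro exI) (rule part)
  next
    fix N' c' p' i assume P: "chart_partition \<A> M (M \<inter> form_support \<A> (length js) \<eta>) N' c' p'" and i: "i < N'"
    show "set_integrable \<mu> (coords (c' i) ` (cdom (c' i) \<inter> M)) (chart_integrand \<A> \<sigma> js (c' i) (p' i) \<eta>)"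
      by (rule B[OF P i])
  next
    fix N' c' p' assume P: "chart_partition \<A> M (M \<inter> form_support \<A> (length js) \<eta>) N' c' p'"
    show "(\<Sum>i<N. LINT u:coords (c i) ` (cdom (c i) \<inter> M)|\<mu>. of_real (p i (param (c i) u)) * D (c i) (param (c i) u))
      = (\<Sum>i<N'. LINT u:coords (c' i) ` (cdom (c' i) \<inter> M)|\<mu>. chart_integrand \<A> \<sigma> js (c' i) (p' i) \<eta> u)"
      using A[OF P] unfolding J_def ci by simp
  qed
qed

context manifold
begin

lemma admissible_integrable:
  assumes c: "c \<in> \<A>" and f: "admissible UNIV c f" and D: "continuous_on (cdom c) D"
  shows "set_integrable lborel (target c) (\<lambda>u. of_real (f (param c u)) * (D (param c u) :: complex))"
proof (rule density_integrable(1)[OF c, where D = "\<lambda>q. of_real (f q) * D q"])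
  let ?S = "closure {q \<in> UNIV. f q \<noteq> 0}"
  show S: "compact ?S" "?S \<subseteq> cdom c" using f by (auto simp: admissible_def)
  show "continuous_on ?S (\<lambda>q. of_real (f q) * D q)"
    using f continuous_on_subset[OF D S(2)] by (auto simp: admissible_def intro!: continuous_intros intro: continuous_on_subset)
  show "of_real (f q) * D q = 0" if "q \<notin> ?S" for q
    using that closure_subset[of "{q \<in> UNIV. f q \<noteq> 0}"] by auto
qed

lemma admissible_chart_independent:
  assumes c: "c \<in> \<A>" "c' \<in> \<A>" and f: "admissible UNIV c f" "admissible UNIV c' f"
    and D: "continuous_on (cdom c) D" "continuous_on (cdom c') D'"
    and tr: "\<And>q. q \<in> cdom c \<Longrightarrow> q \<in> cdom c' \<Longrightarrow> D q = \<bar>det (matrix (T c c' q))\<bar> *\<^sub>R (D' q :: complex)"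
  shows "(LINT u:target c|lborel. of_real (f (param c u)) * D (param c u))
     = (LINT u:target c'|lborel. of_real (f (param c' u)) * D' (param c' u))"
proof (rule density_chart_independent[OF c, where D = "\<lambda>q. of_real (f q) * D q" and D' = "\<lambda>q. of_real (f q) * D' q"])
  let ?S = "closure {q \<in> UNIV. f q \<noteq> 0}"
  show S: "compact ?S" "?S \<subseteq> cdom c" "?S \<subseteq> cdom c'" using f by (auto simp: admissible_def)
  have fS: "continuous_on ?S f" using f(1) by (auto simp: admissible_def intro: continuous_on_subset)
  show "continuous_on ?S (\<lambda>q. of_real (f q) * D q)" "continuous_on ?S (\<lambda>q. of_real (f q) * D' q)"
    using fS continuous_on_subset[OF D(1) S(2)] continuous_on_subset[OF D(2) S(3)] by (auto intro!: continuous_intros)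
  show "of_real (f q) * D q = 0" "of_real (f q) * D' q = 0" if "q \<notin> ?S" for q
    using that closure_subset[of "{q \<in> UNIV. f q \<noteq> 0}"] by auto
  show "of_real (f q) * D q = \<bar>det (matrix (T c c' q))\<bar> *\<^sub>R (of_real (f q) * D' q)" if "q \<in> ?S" for q
    using tr[OF subsetD[OF S(2) that] subsetD[OF S(3) that]] by simp
qed

lemma boundary_admissible_support:
  assumes "admissible (boundary \<A>) c f"
  shows "compact (closure {q \<in> boundary \<A>. f q \<noteq> 0})" "closure {q \<in> boundary \<A>. f q \<noteq> 0} \<subseteq> cdom c"
    "closure {q \<in> boundary \<A>. f q \<noteq> 0} \<subseteq> boundary \<A>" "continuous_on (closure {q \<in> boundary \<A>. f q \<noteq> 0}) f"
    "\<And>q. q \<in> boundary \<A> \<Longrightarrow> q \<notin> closure {q \<in> boundary \<A>. f q \<noteq> 0} \<Longrightarrow> f q = 0"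
proof -
  show "compact (closure {q \<in> boundary \<A>. f q \<noteq> 0})" "closure {q \<in> boundary \<A>. f q \<noteq> 0} \<subseteq> cdom c"
    using assms by (auto simp: admissible_def)
  show b: "closure {q \<in> boundary \<A>. f q \<noteq> 0} \<subseteq> boundary \<A>"
    by (rule closure_minimal[OF _ closed_boundary]) auto
  show "continuous_on (closure {q \<in> boundary \<A>. f q \<noteq> 0}) f"
    using assms b by (auto simp: admissible_def intro: continuous_on_subset)
  show "f q = 0" if "q \<in> boundary \<A>" "q \<notin> closure {q \<in> boundary \<A>. f q \<noteq> 0}" for q
    using that closure_subset[of "{q \<in> boundary \<A>. f q \<noteq> 0}"] by auto
qed

lemma boundary_admissible_integrable:
  assumes c: "c \<in> \<A>" and f: "admissible (boundary \<A>) c f" and D: "continuous_on (cdom c) D"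
  shows "set_integrable hyperplane_lborel (coords c ` (cdom c \<inter> boundary \<A>)) (\<lambda>u. of_real (f (param c u)) * (D (param c u) :: complex))"
proof (rule boundary_density_integrable(1)[OF c, where D = "\<lambda>q. of_real (f q) * D q"])
  let ?S = "closure {q \<in> boundary \<A>. f q \<noteq> 0}"
  note S = boundary_admissible_support[OF f]
  show "compact ?S" "?S \<subseteq> cdom c" "?S \<subseteq> boundary \<A>" by (rule S)+
  show "continuous_on ?S (\<lambda>q. of_real (f q) * D q)"
    using S(4) continuous_on_subset[OF D S(2)] by (auto intro!: continuous_intros)
  show "of_real (f q) * D q = 0" if "q \<in> boundary \<A>" "q \<notin> ?S" for q
    using S(5)[OF that] by simp
qed

lemma boundary_admissible_chart_independent:
  assumes c: "c \<in> \<A>" "c' \<in> \<A>" and f: "admissible (boundary \<A>) c f" "admissible (boundary \<A>) c' f"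
    and D: "continuous_on (cdom c) D" "continuous_on (cdom c') D'"
    and tr: "\<And>q. q \<in> cdom c \<Longrightarrow> q \<in> cdom c' \<Longrightarrow> q \<in> boundary \<A> \<Longrightarrow> D q = \<bar>det (matrix (thick_transition c c' q))\<bar> *\<^sub>R (D' q :: complex)"
  shows "(LINT u:coords c ` (cdom c \<inter> boundary \<A>)|hyperplane_lborel. of_real (f (param c u)) * D (param c u))
     = (LINT u:coords c' ` (cdom c' \<inter> boundary \<A>)|hyperplane_lborel. of_real (f (param c' u)) * D' (param c' u))"
proof (rule boundary_density_chart_independent[OF c, where D = "\<lambda>q. of_real (f q) * D q" and D' = "\<lambda>q. of_real (f q) * D' q"])
  let ?S = "closure {q \<in> boundary \<A>. f q \<noteq> 0}"
  note S = boundary_admissible_support[OF f(1)] and S' = boundary_admissible_support[OF f(2)]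
  show "compact ?S" "?S \<subseteq> cdom c" "?S \<subseteq> cdom c'" "?S \<subseteq> boundary \<A>" by (rule S S')+
  show "continuous_on ?S (\<lambda>q. of_real (f q) * D q)" "continuous_on ?S (\<lambda>q. of_real (f q) * D' q)"
    using S(4) continuous_on_subset[OF D(1) S(2)] continuous_on_subset[OF D(2) S'(2)] by (auto intro!: continuous_intros)
  show "of_real (f q) * D q = 0" "of_real (f q) * D' q = 0" if "q \<in> boundary \<A>" "q \<notin> ?S" for q
    using S(5)[OF that] by simp_all
  show "of_real (f q) * D q = \<bar>det (matrix (thick_transition c c' q))\<bar> *\<^sub>R (of_real (f q) * D' q)" if "q \<in> ?S" for q
    using tr[OF subsetD[OF S(2) that] subsetD[OF S'(2) that] subsetD[OF S(3) that]] by simp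
qed

end

text \<open>Stokes' theorem concerns only a pair with \<open>\<zeta> = d\<eta>\<close> in every
  chart, so the algebra is left behind here. As \<open>\<eta>\<close> is merely differentiable, the
  continuity of \<open>\<zeta>\<close> is an assumption of its own.\<close>

locale exact_form = oriented \<A> \<sigma>
  for \<A> :: "('q::{t2_space,second_countable_topology}, 'n::{finite,linorder}) chart set" and \<sigma> +
  fixes k :: nat and \<eta> \<zeta> :: "('q, 'n) mform"
    and eta_deriv :: "('q, 'n) chart \<Rightarrow> (real^'n::_) list \<Rightarrow> real^'n::_ \<Rightarrow> real^'n::_ \<Rightarrow> complex"
  assumes dim: "Suc k = CARD('n)"
    and alt: "\<And>c q. c \<in> \<A> \<Longrightarrow> q \<in> cdom c \<Longrightarrow> alt_form k (\<lambda>vs. \<eta> q (map (tvec_of \<A> c q) vs))"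
    and der: "\<And>c u vs. c \<in> \<A> \<Longrightarrow> u \<in> target c \<Longrightarrow> length vs = k \<Longrightarrow>
      (local_form \<A> c \<eta> vs has_derivative eta_deriv c vs u) (at u within half_space)"
    and dform: "\<And>c u ws. c \<in> \<A> \<Longrightarrow> u \<in> target c \<Longrightarrow> length ws = Suc k \<Longrightarrow>
      local_form \<A> c \<zeta> ws u = (\<Sum>i<length ws. (-1) ^ i * eta_deriv c (omit i ws) u (ws ! i))"
    and cont_dform: "\<And>c ws. c \<in> \<A> \<Longrightarrow> length ws = Suc k \<Longrightarrow> continuous_on (target c) (local_form \<A> c \<zeta> ws)"
begin

definition js :: "'n list" where "js = sorted_list_of_set UNIV"
definition js' :: "'n list" where "js' = sorted_list_of_set (UNIV - {first_coord})"

lemma js: "js = first_coord # js'" "distinct js" "set js = UNIV" "length js = Suc k" "length js' = k" "first_coord \<notin> set js'"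
proof -
  show "js = first_coord # js'"
    unfolding js_def js'_def first_coord_def by (rule sorted_list_of_set_nonempty) auto
  show "distinct js" "set js = UNIV" by (simp_all add: js_def)
  show "length js = Suc k" by (simp add: js_def dim)
  show "length js' = k" using dim by (simp add: js'_def)
  show "first_coord \<notin> set js'" by (simp add: js'_def)
qed

lemma local_form_coords:
  "c \<in> \<A> \<Longrightarrow> q \<in> cdom c \<Longrightarrow> local_form \<A> c \<phi> vs (coords c q) = \<phi> q (map (tv c q) vs)"
  by (simp add: local_form_def)

text \<open>The values of the form satisfy these identities at all points of the chart, and
  derivatives within the half-space are unique.\<close>

lemma eta_deriv_alt_form:
  assumes c: "c \<in> \<A>" "u \<in> target c" shows "alt_form k (\<lambda>vs. eta_deriv c vs u w)"
proof -
  have uniq: "eta_deriv c vs u = h'"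
    if "length vs = k" "\<And>u'. u' \<in> target c \<Longrightarrow> local_form \<A> c \<eta> vs u' = h u'" "(h has_derivative h') (at u within half_space)" for vs h h'
  proof (rule half_space_derivative_unique)
    show "u \<in> half_space" using target_half_space[OF c(1)] c(2) by blast
    show "(local_form \<A> c \<eta> vs has_derivative eta_deriv c vs u) (at u within half_space)" by (rule der[OF c that(1)])
    have "(h has_derivative h') (at u within target c)" using that(3) within_target[OF c] by simp
    then have "(local_form \<A> c \<eta> vs has_derivative h') (at u within target c)"
      by (rule has_derivative_transform[OF c(2), rotated]) (rule that(2))
    then show "(local_form \<A> c \<eta> vs has_derivative h') (at u within half_space)" using within_target[OF c] by simp
  qed
  have a: "alt_form k (\<lambda>vs. local_form \<A> c \<eta> vs u')" if "u' \<in> target c" for u'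
    unfolding local_form_def by (rule alt[OF c(1) param_cdom[OF c(1) that]])
  show ?thesis
    unfolding alt_form_def
  proof (intro conjI allI impI)
    fix as :: "(real^'n::_) list" and i assume i: "length as = k" "i < k"
    have lin: "linear (\<lambda>a. local_form \<A> c \<eta> (as[i := a]) u')" if "u' \<in> target c" for u'
      using a[OF that] i unfolding alt_form_def by blast
    have d: "(local_form \<A> c \<eta> (as[i := a]) has_derivative eta_deriv c (as[i := a]) u) (at u within half_space)" for a
      using der[OF c] i by simp
    show "linear (\<lambda>a. eta_deriv c (as[i := a]) u w)"
    proof (rule linearI)
      fix a b
      have "eta_deriv c (as[i := a + b]) u = (\<lambda>h. eta_deriv c (as[i := a]) u h + eta_deriv c (as[i := b]) u h)"
        by (rule uniq[OF _ _ has_derivative_add[OF d d]]) (use i linear_add[OF lin] in auto)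
      then show "eta_deriv c (as[i := a + b]) u w = eta_deriv c (as[i := a]) u w + eta_deriv c (as[i := b]) u w" by simp
    next
      fix r a
      have "eta_deriv c (as[i := r *\<^sub>R a]) u = (\<lambda>h. r *\<^sub>R eta_deriv c (as[i := a]) u h)"
        by (rule uniq[OF _ _ has_derivative_scaleR_right[OF d]]) (use i linear_scale[OF lin] in auto)
      then show "eta_deriv c (as[i := r *\<^sub>R a]) u w = r *\<^sub>R eta_deriv c (as[i := a]) u w" by simp
    qed
  next
    fix as :: "(real^'n::_) list" and i j assume *: "length as = k" "i < j" "j < k" "as ! i = as ! j"
    have "eta_deriv c as u = (\<lambda>_. 0)"
    proof (rule uniq[OF *(1) _ has_derivative_const])
      show "local_form \<A> c \<eta> as u' = 0" if "u' \<in> target c" for u'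
        using a[OF that] * unfolding alt_form_def by blast
    qed
    then show "eta_deriv c as u w = 0" by simp
  qed
qed

lemma dform_alt_form:
  assumes c: "c \<in> \<A>" "q \<in> cdom c" shows "alt_form (Suc k) (\<lambda>ws. \<zeta> q (map (tv c q) ws))"
proof (rule alt_form_cong)
  note u = coords_target[OF c(2)]
  show "alt_form (Suc k) (\<lambda>ws. \<Sum>i<length ws. (-1::real) ^ i *\<^sub>R eta_deriv c (omit i ws) (coords c q) (ws ! i))"
  proof (rule alt_form_wedge)
    show "alt_form k (\<lambda>vs. eta_deriv c vs (coords c q) w)" for w by (rule eta_deriv_alt_form[OF c(1) u])
    show "linear (\<lambda>w. eta_deriv c vs (coords c q) w)" if "length vs = k" for vs
      using der[OF c(1) u that] has_derivative_linear by blast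
  qed
  show "\<zeta> q (map (tv c q) ws) = (\<Sum>i<length ws. (-1::real) ^ i *\<^sub>R eta_deriv c (omit i ws) (coords c q) (ws ! i))" if "length ws = Suc k" for ws
    using dform[OF c(1) u that] local_form_coords[OF c, of \<zeta> ws] by (simp add: scaleR_conv_of_real)
qed

lemma coord_vec_change:
  assumes "c \<in> \<A>" "c' \<in> \<A>" "q \<in> cdom c" "q \<in> cdom c'"
  shows "map (coord_vec \<A> c q) is' = map (tv c' q) (map (\<lambda>j. T c c' q (axis j 1)) is')"
  using tv_change[OF assms] by (simp add: coord_vec_def)

lemma coord_vec_map: "map (coord_vec \<A> c q) is' = map (tv c q) (map (\<lambda>j. axis j 1) is')"
  by (simp add: coord_vec_def)

lemma sigma_cont: "c \<in> \<A> \<Longrightarrow> continuous_on (cdom c) (\<sigma> c)"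
  and sigma_pm: "c \<in> \<A> \<Longrightarrow> q \<in> cdom c \<Longrightarrow> \<sigma> c q = 1 \<or> \<sigma> c q = -1"
  using orient unfolding orientation_def by blast+

lemma sigma_change: "c \<in> \<A> \<Longrightarrow> c' \<in> \<A> \<Longrightarrow> q \<in> cdom c \<Longrightarrow> q \<in> cdom c' \<Longrightarrow> \<sigma> c q = sgn (det (matrix (T c c' q))) * \<sigma> c' q"
  using orient unfolding orientation_def by blast

text \<open>The orientation absorbs the sign of the determinant, and the absolute value that is left
  is the one in the change of variables.\<close>

lemma top_form_change:
  fixes F :: "(real^'n::_) list \<Rightarrow> complex"
  assumes c: "c \<in> \<A>" "c' \<in> \<A>" "q \<in> cdom c" "q \<in> cdom c'" and F: "alt_form (Suc k) F"
  shows "of_real (\<sigma> c q) * F (map (\<lambda>j. T c c' q (axis j 1)) js)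
    = \<bar>det (matrix (T c c' q))\<bar> *\<^sub>R (of_real (\<sigma> c' q) * F (map (\<lambda>j. axis j 1) js))"
proof -
  have "F (map (\<lambda>j. T c c' q (axis j 1)) js) = det (matrix (T c c' q)) *\<^sub>R F (map (\<lambda>j. axis j 1) js)"
    by (rule alt_form_det[OF _ js(2,3) transition_linear[OF c]]) (use F dim in simp)
  moreover have "\<sigma> c q * det (matrix (T c c' q)) = \<bar>det (matrix (T c c' q))\<bar> * \<sigma> c' q"
    unfolding sigma_change[OF c] by (simp add: sgn_if)
  ultimately show ?thesis
    by (simp add: scaleR_conv_of_real mult.assoc[symmetric] flip: of_real_mult)
qed

text \<open>The oriented coefficients in a chart: of \<open>\<zeta>\<close>, of \<open>\<eta>\<close> along the boundary, and of \<open>dp \<and> \<eta>\<close>.\<close>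

definition top_density where "top_density c q = of_real (\<sigma> c q) * \<zeta> q (map (coord_vec \<A> c q) js)"
definition bd_density where "bd_density c q = of_real (\<sigma> c q) * \<eta> q (map (coord_vec \<A> c q) js')"
definition wedge_density where "wedge_density dp c q = of_real (\<sigma> c q) * (\<Sum>i<Suc k. (-1) ^ i * of_real (dp c (coords c q) (axis (js ! i) 1))
   * \<eta> q (map (coord_vec \<A> c q) (omit i js)))"

lemma top_density_change:
  assumes "c \<in> \<A>" "c' \<in> \<A>" "q \<in> cdom c" "q \<in> cdom c'"
  shows "top_density c q = \<bar>det (matrix (T c c' q))\<bar> *\<^sub>R top_density c' q"
  unfolding top_density_def coord_vec_change[OF assms] coord_vec_map[of c']
  by (rule top_form_change[OF assms dform_alt_form[OF assms(2,4)]])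

lemma C1_deriv_linear:
  assumes "C1_deriv p dp" "c \<in> \<A>" "u \<in> target c" shows "linear (dp c u)"
  using C1_derivD(1)[OF assms] has_derivative_linear by blast

lemma C1_deriv_change:
  assumes p: "C1_deriv p dp" and c: "c \<in> \<A>" "c' \<in> \<A>" "q \<in> cdom c" "q \<in> cdom c'"
  shows "dp c (coords c q) v = dp c' (coords c' q) (T c c' q v)"
proof -
  let ?O = "coords c ` (cdom c \<inter> cdom c')" and ?u = "coords c q"
  have u: "?u \<in> ?O" using c by blast
  have O: "at ?u within ?O = at ?u within half_space" by (rule at_within_openin[OF openin_overlap[OF c(1,2)] u])
  have g: "((coords c' \<circ> param c) has_derivative T c c' q) (at ?u within ?O)"
    unfolding O by (rule transition_works(1)[OF c])
  have "((\<lambda>u. p (param c' u)) has_derivative dp c' (coords c' q)) (at ((coords c' \<circ> param c) ?u) within (coords c' \<circ> param c) ` ?O)"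
  proof (rule has_derivative_subset)
    show "(coords c' \<circ> param c) ` ?O \<subseteq> half_space" using param_coords[OF c(1)] coords_half_space[OF c(2)] by auto
    show "((\<lambda>u. p (param c' u)) has_derivative dp c' (coords c' q)) (at ((coords c' \<circ> param c) ?u) within half_space)"
      using C1_derivD(1)[OF p c(2), of "coords c' q"] c by simp
  qed
  then have "((\<lambda>u. p (param c' u)) \<circ> (coords c' \<circ> param c) has_derivative dp c' (coords c' q) \<circ> T c c' q) (at ?u within ?O)"
    by (rule diff_chain_within[OF g])
  then have "((\<lambda>u. p (param c u)) has_derivative dp c' (coords c' q) \<circ> T c c' q) (at ?u within ?O)"
    by (rule has_derivative_transform[OF u, rotated]) (use c in auto)
  then have "((\<lambda>u. p (param c u)) has_derivative dp c' (coords c' q) \<circ> T c c' q) (at ?u within half_space)"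
    unfolding O .
  from half_space_derivative_unique[OF coords_half_space[OF c(1,3)] this C1_derivD(1)[OF p c(1) coords_target[OF c(3)]]]
  show ?thesis by (metis comp_apply)
qed

lemma wedge_density_change:
  assumes p: "C1_deriv p dp" and c: "c \<in> \<A>" "c' \<in> \<A>" "q \<in> cdom c" "q \<in> cdom c'"
  shows "wedge_density dp c q = \<bar>det (matrix (T c c' q))\<bar> *\<^sub>R wedge_density dp c' q"
proof -
  \<comment> \<open>The wedge product of \<open>dp\<close> and \<open>\<eta>\<close> in the
    coordinates of \<open>c'\<close>.\<close>
  define G where "G ws = (\<Sum>i<length ws. (-1::real) ^ i *\<^sub>R (dp c' (coords c' q) (ws ! i) *\<^sub>R \<eta> q (map (tv c' q) (omit i ws))))" for ws
  have lin: "linear (dp c' (coords c' q))" by (rule C1_deriv_linear[OF p c(2) coords_target[OF c(4)]])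
  have G: "alt_form (Suc k) G"
    unfolding G_def
  proof (rule alt_form_wedge)
    show "alt_form k (\<lambda>vs. dp c' (coords c' q) w *\<^sub>R \<eta> q (map (tv c' q) vs))" for w
      using alt[OF c(2,4)] unfolding alt_form_def by (simp add: linear_compose_scale_right)
    show "linear (\<lambda>w. dp c' (coords c' q) w *\<^sub>R \<eta> q (map (tv c' q) vs))" for vs
      by (rule linearI) (simp_all add: linear_add[OF lin] linear_scale[OF lin] scaleR_left_distrib)
  qed
  have "wedge_density dp c q = of_real (\<sigma> c q) * G (map (\<lambda>j. T c c' q (axis j 1)) js)"
    unfolding wedge_density_def G_def
    by (simp add: js(4) C1_deriv_change[OF p c] map_omit coord_vec_change[OF c] scaleR_conv_of_real mult.assoc del: map_map sum.lessThan_Suc)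
  also have "\<dots> = \<bar>det (matrix (T c c' q))\<bar> *\<^sub>R (of_real (\<sigma> c' q) * G (map (\<lambda>j. axis j 1) js))"
    by (rule top_form_change[OF c G])
  also have "of_real (\<sigma> c' q) * G (map (\<lambda>j. axis j 1) js) = wedge_density dp c' q"
    unfolding wedge_density_def G_def
    by (simp add: js(4) map_omit coord_vec_map scaleR_conv_of_real mult.assoc del: map_map sum.lessThan_Suc)
  finally show ?thesis .
qed

lemma linear_thick_transition:
  assumes "c \<in> \<A>" "c' \<in> \<A>" "q \<in> cdom c" "q \<in> cdom c'" shows "linear (thick_transition c c' q)"
proof -
  have "linear (\<lambda>h. T c c' q (boundary_proj h))"
    using linear_compose[OF linear_boundary_proj transition_linear[OF assms]] by (simp add: o_def)
  then show ?thesis by (auto simp: thick_transition_def linear_iff vec_eq_iff)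
qed

text \<open>\<open>F\<close> is the wedge product of the differential of the first coordinate of
  \<open>c'\<close> with \<open>\<eta>\<close>. It is evaluated on the axes moved by the transition
  and by its thickening \<open>?P\<close>. As vectors tangent to the boundary have first coordinate
  0, this gives \<open>a hT = det ?T h0\<close> and \<open>hT = det ?P h0\<close>, where
  \<open>a > 0\<close> is the number in \<open>transition_boundary_normal\<close>. Unless
  \<open>h0 = 0\<close>, the two determinants therefore have the same sign, and
  \<open>\<sigma>\<close> orients the boundary as well.\<close>

lemma bd_density_change:
  assumes c: "c \<in> \<A>" "c' \<in> \<A>" "q \<in> cdom c" "q \<in> cdom c'" and q: "q \<in> boundary \<A>"
  shows "bd_density c q = \<bar>det (matrix (thick_transition c c' q))\<bar> *\<^sub>R bd_density c' q"
proof -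
  let ?T = "T c c' q" and ?P = "thick_transition c c' q" and ?o = "first_coord :: 'n"
  let ?h = "\<lambda>vs. \<eta> q (map (tv c' q) vs)" and ?e = "\<lambda>j. axis j 1 :: real^'n::_"
  define F where "F ws = (\<Sum>i<length ws. (-1::real) ^ i *\<^sub>R ((ws ! i $ ?o) *\<^sub>R ?h (omit i ws)))" for ws
  have F: "alt_form CARD('n) F"
    unfolding F_def dim[symmetric]
  proof (rule alt_form_wedge)
    show "alt_form k (\<lambda>vs. (w $ ?o) *\<^sub>R ?h vs)" for w
      using alt[OF c(2,4)] unfolding alt_form_def by (simp add: linear_compose_scale_right)
    show "linear (\<lambda>w. (w $ ?o) *\<^sub>R ?h vs)" for vs
      by (auto simp: linear_iff scaleR_left_distrib)
  qed
  have Fval: "F (w # ws) = (w $ ?o) *\<^sub>R ?h ws" if "\<And>v. v \<in> set ws \<Longrightarrow> v $ ?o = 0" for w ws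
  proof -
    have "F (w # ws) = (\<Sum>i\<in>{0}. (-1::real) ^ i *\<^sub>R (((w # ws) ! i $ ?o) *\<^sub>R ?h (omit i (w # ws))))"
      unfolding F_def
    proof (rule sum.mono_neutral_right)
      show "\<forall>i\<in>{..<length (w # ws)} - {0}. (-1::real) ^ i *\<^sub>R (((w # ws) ! i $ ?o) *\<^sub>R ?h (omit i (w # ws))) = 0"
        using that by (auto simp: nth_Cons split: nat.splits)
    qed auto
    then show ?thesis by (simp add: omit_def)
  qed
  have tan: "?T (?e j) $ ?o = 0" if "j \<in> set js'" for j
    using that js(6) by (intro transition_boundary_tangent[OF c q]) auto
  have Pe: "?P (?e j) = ?T (?e j)" if "j \<in> set js'" for j
  proof -
    have "j \<noteq> ?o" using that js(6) by blast
    then have z: "?e j $ ?o = 0" by (simp add: axis_def)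
    show ?thesis
      unfolding thick_transition_def boundary_proj_id[OF z] z using tan[OF that] by (simp add: vec_eq_iff)
  qed
  have P1: "?P (?e ?o) $ ?o = 1" by (simp add: thick_transition_def axis_def)
  define hT h0 where "hT = ?h (map (\<lambda>j. ?T (?e j)) js')" and "h0 = ?h (map ?e js')"
  have FT: "F (map (\<lambda>j. ?T (?e j)) js) = (?T (?e ?o) $ ?o) *\<^sub>R hT"
    unfolding js(1) hT_def list.map using tan by (subst Fval) auto
  have Pm: "map (\<lambda>j. ?P (?e j)) js' = map (\<lambda>j. ?T (?e j)) js'" using Pe by simp
  have FP: "F (map (\<lambda>j. ?P (?e j)) js) = hT"
    unfolding js(1) hT_def list.map Pm using P1 tan by (subst Fval) auto
  have "?e j $ ?o = 0" if "j \<in> set js'" for j using that js(6) by (auto simp: axis_def)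
  then have Fe: "F (map ?e js) = h0"
    unfolding js(1) h0_def list.map by (subst Fval) auto
  have dT: "(?T (?e ?o) $ ?o) *\<^sub>R hT = det (matrix ?T) *\<^sub>R h0"
    using alt_form_det[OF F js(2,3) transition_linear[OF c]] unfolding FT Fe .
  have dP: "hT = det (matrix ?P) *\<^sub>R h0"
    using alt_form_det[OF F js(2,3) linear_thick_transition[OF c]] unfolding FP Fe .
  have "of_real (\<sigma> c q) * hT = \<bar>det (matrix ?P)\<bar> *\<^sub>R (of_real (\<sigma> c' q) * h0)"
  \<comment> \<open>For \<open>h0 = 0\<close> both sides are 0. Otherwise the two expressions for
    \<open>hT\<close> determine the ratio of the determinants, so no block matrix has to be
    expanded.\<close>
  proof (cases "h0 = 0")
    case False
    have "((?T (?e ?o) $ ?o) * det (matrix ?P) - det (matrix ?T)) *\<^sub>R h0 = 0"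
      using dT unfolding dP by (simp add: scaleR_left_diff_distrib)
    then have "det (matrix ?T) = (?T (?e ?o) $ ?o) * det (matrix ?P)" using False by simp
    then have "sgn (det (matrix ?T)) = sgn (det (matrix ?P))"
      using transition_boundary_normal[OF c q] by (simp add: sgn_mult)
    then have "\<sigma> c q * det (matrix ?P) = \<bar>det (matrix ?P)\<bar> * \<sigma> c' q"
      unfolding sigma_change[OF c] by (simp add: sgn_if split: if_splits)
    then show ?thesis unfolding dP
      by (simp add: scaleR_conv_of_real mult.assoc[symmetric] flip: of_real_mult)
  qed (simp add: dP)
  then show ?thesis
    unfolding bd_density_def coord_vec_change[OF c] coord_vec_map[of c'] hT_def h0_def .
qed

lemma continuous_on_local_eta: "c \<in> \<A> \<Longrightarrow> length vs = k \<Longrightarrow> continuous_on (target c) (local_form \<A> c \<eta> vs)"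
  by (rule has_derivative_continuous_on, subst within_target, assumption, assumption, rule der)

lemma continuous_on_eta:
  assumes "c \<in> \<A>" "length is' = k" shows "continuous_on (cdom c) (\<lambda>q. \<eta> q (map (coord_vec \<A> c q) is'))"
proof -
  have "continuous_on (cdom c) (\<lambda>q. local_form \<A> c \<eta> (map (\<lambda>j. axis j 1) is') (coords c q))"
    by (intro continuous_on_cdom continuous_on_local_eta assms) (simp add: assms)
  then show ?thesis
    by (rule continuous_on_eq) (use local_form_coords[OF assms(1)] in \<open>simp add: coord_vec_map del: map_map\<close>)
qed

lemma top_density_cont: assumes "c \<in> \<A>" shows "continuous_on (cdom c) (top_density c)"
proof -
  have "continuous_on (cdom c) (\<lambda>q. local_form \<A> c \<zeta> (map (\<lambda>j. axis j 1) js) (coords c q))"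
    by (intro continuous_on_cdom cont_dform assms) (simp add: js)
  then have "continuous_on (cdom c) (\<lambda>q. \<zeta> q (map (coord_vec \<A> c q) js))"
    by (rule continuous_on_eq) (use local_form_coords[OF assms(1)] in \<open>simp add: coord_vec_map del: map_map\<close>)
  then show ?thesis unfolding top_density_def[abs_def] by (intro continuous_intros sigma_cont assms)
qed

lemma bd_density_cont: "c \<in> \<A> \<Longrightarrow> continuous_on (cdom c) (bd_density c)"
  unfolding bd_density_def[abs_def] by (intro continuous_intros sigma_cont continuous_on_eta js)

lemma length_omit_js: "i < Suc k \<Longrightarrow> length (omit i js) = k"
  by (simp add: length_omit js)

lemma wedge_density_cont: assumes "c \<in> \<A>" "C1_deriv p dp" shows "continuous_on (cdom c) (wedge_density dp c)"
  unfolding wedge_density_def[abs_def]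
  by (intro continuous_intros sigma_cont continuous_on_eta assms length_omit_js
      continuous_on_cdom[OF assms(1) C1_derivD(2)[OF assms(2,1)]]) auto

lemma C1_deriv_zero:
  assumes p: "C1_deriv p dp" and c: "c \<in> \<A>" and q: "q \<in> cdom c" "q \<notin> closure {q. p q \<noteq> 0}"
  shows "dp c (coords c q) h = 0"
proof -
  let ?S = "closure {q. p q \<noteq> 0}"
  have p0: "p q = 0" if "q \<notin> ?S" for q using that closure_subset[of "{q. p q \<noteq> 0}"] by blast
  let ?W = "coords c ` (cdom c - ?S)"
  have W: "openin (top_of_set half_space) ?W"
    by (rule openin_coords_image[OF c]) (auto intro: open_Diff open_cdom[OF c])
  let ?u = "coords c q"
  have u: "?u \<in> ?W" using q by blast
  have "((\<lambda>u. 0) has_derivative (\<lambda>_. 0)) (at ?u within ?W)" by (rule has_derivative_const)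
  then have "((\<lambda>u. p (param c u)) has_derivative (\<lambda>_. 0)) (at ?u within ?W)"
  proof (rule has_derivative_transform[OF u, rotated])
    fix x assume "x \<in> ?W"
    then obtain q' where "x = coords c q'" "q' \<in> cdom c" "q' \<notin> ?S" by (elim imageE DiffE)
    then show "p (param c x) = 0" using p0[of q'] param_coords[OF c, of q'] by simp
  qed
  then have "((\<lambda>u. p (param c u)) has_derivative (\<lambda>_. 0)) (at ?u within half_space)"
    unfolding at_within_openin[OF W u] .
  from half_space_derivative_unique[OF coords_half_space[OF c q(1)] C1_derivD(1)[OF p c coords_target[OF q(1)]] this]
  show ?thesis by simp
qed

lemma wedge_density_zero:
  assumes "C1_deriv p dp" "c \<in> \<A>" "q \<in> cdom c" "q \<notin> closure {q. p q \<noteq> 0}"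
  shows "wedge_density dp c q = 0"
  using C1_deriv_zero[OF assms] by (simp add: wedge_density_def del: sum.lessThan_Suc)

text \<open>The divergence theorem on the half-space is applied to the field whose component
  \<open>j\<close> is \<open>\<sigma> p\<close> times \<open>\<eta>\<close> on all coordinate
  vectors but the \<open>j\<close>-th, with the sign of its position. The divergence is the density
  of \<open>d(p \<eta>)\<close>, that is, of \<open>p \<zeta> + dp \<and> \<eta>\<close>.\<close>

lemma local_stokes:
  assumes c: "c \<in> \<A>" and p: "C1_deriv p dp" and S: "compact (closure {q. p q \<noteq> 0})" "closure {q. p q \<noteq> 0} \<subseteq> cdom c"
  shows "(LINT u:target c|lborel. of_real (p (param c u)) * top_density c (param c u) + wedge_density dp c (param c u))
     = (LINT u:coords c ` (cdom c \<inter> boundary \<A>)|hyperplane_lborel. of_real (p (param c u)) * bd_density c (param c u))"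
proof -
  let ?S = "closure {q. p q \<noteq> 0}" and ?o = "first_coord :: 'n"
  let ?K = "coords c ` ?S"
  let ?e = "\<lambda>j. axis j 1 :: real^'n::_"
  have p0: "p q = 0" if "q \<notin> ?S" for q using that closure_subset[of "{q. p q \<noteq> 0}"] by blast
  have K: "compact ?K" by (rule compact_coords_image[OF c S])
  note dp0 = C1_deriv_zero[OF p c] and Wd0 = wedge_density_zero[OF p c]
  obtain pos where pos: "\<And>s. pos s < CARD('n)" "\<And>s. js ! pos s = s" "\<And>i. i < CARD('n) \<Longrightarrow> pos (js ! i) = i"
    using enumeration_position[OF js(2,3)] by metis
  have bij: "bij_betw ((!) js) {..<Suc k} UNIV"
    using bij_betw_nth[OF js(2), of "{..<Suc k}" UNIV] js(3,4) by simp
  define vs where "vs j = map ?e (omit (pos j) js)" for j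
  have lvs: "length (vs j) = k" for j using pos(1)[of j] by (simp add: vs_def length_omit_js dim)
  define sg where "sg j = ((-1) ^ pos j :: complex)" for j
  define f where "f j x = (if x \<in> target c then of_real (\<sigma> c (param c x)) * (of_real (p (param c x)) * (sg j * local_form \<A> c \<eta> (vs j) x)) else 0)" for j x
  define f' where "f' j x h = (if x \<in> target c then of_real (\<sigma> c (param c x)) * (of_real (p (param c x)) * (sg j * eta_deriv c (vs j) x h)
     + of_real (dp c x h) * (sg j * local_form \<A> c \<eta> (vs j) x)) else 0)" for j x h
  define g where "g x = (if x \<in> target c then of_real (p (param c x)) * top_density c (param c x) + wedge_density dp c (param c x) else 0)" for x
  have notK: "param c x \<notin> ?S" if "x \<notin> ?K" "x \<in> target c" for x using that coords_param[OF c that(2)] by (metis imageI)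
  have supp: "f j x = 0" "g x = 0" "f' j x = (\<lambda>_. 0)" if "x \<notin> ?K" for j x
  proof -
    have *: "p (param c x) = 0 \<and> wedge_density dp c (param c x) = 0 \<and> (\<forall>h. dp c x h = 0)" if "x \<in> target c"
    proof -
      have n: "param c x \<notin> ?S" by (rule notK[OF \<open>x \<notin> ?K\<close> that])
      show ?thesis
        using p0[OF n] Wd0[OF param_cdom[OF c that] n] dp0[OF param_cdom[OF c that] n] unfolding coords_param[OF c that] by blast
    qed
    then show "f j x = 0" "g x = 0" "f' j x = (\<lambda>_. 0)"
      unfolding f_def g_def f'_def[abs_def] by (cases "x \<in> target c"; simp)+
  qed
  have oK: "openin (top_of_set half_space) (half_space - ?K)"
    unfolding openin_open using compact_imp_closed[OF K] by (intro exI[of _ "- ?K"]) auto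
  have der_f: "(f j has_derivative f' j x) (at x within half_space)" if x: "x \<in> half_space" for j x
  proof (cases "x \<in> target c")
    case True
    \<comment> \<open>Being continuous with values 1 and -1, \<open>\<sigma> c\<close> equals the
      constant \<open>s\<close> on the open set \<open>?Q\<close>, so it can be treated as a
      constant factor when differentiating.\<close>
    define s where "s = \<sigma> c (param c x)"
    let ?Q = "cdom c \<inter> \<sigma> c -` {s - 1/2 <..< s + 1/2}" and ?q = "param c x"
    have Q: "open ?Q" using continuous_on_open_vimage[OF open_cdom[OF c], of "\<sigma> c"] sigma_cont[OF c] by (simp add: Int_commute)
    have sQ: "\<sigma> c q = s" if "q \<in> ?Q" for q
      using that sigma_pm[OF c, of q] sigma_pm[OF c param_cdom[OF c True]] by (auto simp: s_def)
    have O: "openin (top_of_set half_space) (coords c ` ?Q)" by (rule openin_coords_image[OF c Q]) blast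
    have "?q \<in> ?Q" using param_cdom[OF c True] by (simp add: s_def)
    then have xO: "x \<in> coords c ` ?Q" using coords_param[OF c True] by (metis imageI)
    have "((\<lambda>x. of_real s * (of_real (p (param c x)) * (sg j * local_form \<A> c \<eta> (vs j) x))) has_derivative
       (\<lambda>h. of_real s * (of_real (p (param c x)) * (sg j * eta_deriv c (vs j) x h) + of_real (dp c x h) * (sg j * local_form \<A> c \<eta> (vs j) x))))
       (at x within half_space)"
      by (intro has_derivative_mult_right has_derivative_mult has_derivative_of_real der[OF c True lvs] C1_derivD(1)[OF p c True])
    then have "((\<lambda>x. of_real s * (of_real (p (param c x)) * (sg j * local_form \<A> c \<eta> (vs j) x))) has_derivative f' j x)
       (at x within coords c ` ?Q)"
      unfolding at_within_openin[OF O xO] using True by (simp add: f'_def[abs_def] s_def)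
    then have "(f j has_derivative f' j x) (at x within coords c ` ?Q)"
    proof (rule has_derivative_transform[OF xO, rotated])
      fix y assume "y \<in> coords c ` ?Q"
      then obtain q where q: "y = coords c q" "q \<in> ?Q" by blast
      then have "y \<in> target c" "param c y = q" using c by auto
      then show "f j y = of_real s * (of_real (p (param c y)) * (sg j * local_form \<A> c \<eta> (vs j) y))"
        using sQ[OF q(2)] by (simp add: f_def)
    qed
    then show ?thesis unfolding at_within_openin[OF O xO] .
  next
    case False
    have "?K \<subseteq> target c" using S(2) by (auto simp: target_def)
    then have xK: "x \<in> half_space - ?K" using x False by blast
    have "((\<lambda>x. 0) has_derivative (\<lambda>_. 0)) (at x within half_space - ?K)" by (rule has_derivative_const)
    then have "(f j has_derivative (\<lambda>_. 0)) (at x within half_space - ?K)"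
      by (rule has_derivative_transform[OF xK, rotated]) (use supp in blast)
    then show ?thesis unfolding at_within_openin[OF oK xK] using supp(3)[of x j] xK by simp
  qed
  have div: "g x = (\<Sum>j\<in>UNIV. f' j x (?e j))" if "x \<in> half_space" for x
  proof (cases "x \<in> target c")
    case True
    let ?q = "param c x"
    have q: "?q \<in> cdom c" "coords c ?q = x" using param_cdom[OF c True] coords_param[OF c True] by auto
    have eta: "\<eta> ?q (map (coord_vec \<A> c ?q) is') = local_form \<A> c \<eta> (map ?e is') x" for is'
      using local_form_coords[OF c q(1), of \<eta>] q(2) by (simp add: coord_vec_map del: map_map)
    have "(\<Sum>j\<in>UNIV. f' j x (?e j)) = (\<Sum>i<Suc k. f' (js ! i) x (?e (js ! i)))"
      by (rule sum.reindex_bij_betw[OF bij, symmetric])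
    also have "\<dots> = (\<Sum>i<Suc k. of_real (p ?q) * of_real (\<sigma> c ?q) * ((-1) ^ i * eta_deriv c (omit i (map ?e js)) x (?e (js ! i)))
       + of_real (\<sigma> c ?q) * ((-1) ^ i * of_real (dp c x (?e (js ! i))) * \<eta> ?q (map (coord_vec \<A> c ?q) (omit i js))))"
      using True pos(3) by (intro sum.cong refl) (simp add: f'_def sg_def vs_def dim eta map_omit[symmetric] algebra_simps)
    also have "\<dots> = of_real (p ?q) * of_real (\<sigma> c ?q) * (\<Sum>i<Suc k. (-1) ^ i * eta_deriv c (omit i (map ?e js)) x (?e (js ! i))) + wedge_density dp c ?q"
      unfolding wedge_density_def q(2) by (simp only: sum.distrib sum_distrib_left)
    also have "(\<Sum>i<Suc k. (-1) ^ i * eta_deriv c (omit i (map ?e js)) x (?e (js ! i))) = local_form \<A> c \<zeta> (map ?e js) x"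
      using dform[OF c True, of "map ?e js"] by (simp add: js(4) del: sum.lessThan_Suc)
    also have "\<dots> = \<zeta> ?q (map (coord_vec \<A> c ?q) js)"
      using local_form_coords[OF c q(1), of \<zeta>] q(2) by (simp add: coord_vec_map del: map_map)
    finally show ?thesis using True by (simp add: g_def top_density_def)
  next
    case False
    then show ?thesis by (simp add: g_def f'_def)
  qed
  have Ksub: "?K \<subseteq> target c" using S(2) by (auto simp: target_def)
  have cg: "continuous_on half_space g"
  proof -
    have un: "half_space = target c \<union> (half_space - ?K)" using Ksub target_half_space[OF c] by blast
    have "continuous_on (target c \<union> (half_space - ?K)) g"
    proof (rule continuous_on_Un_local_open)
      show "openin (top_of_set (target c \<union> (half_space - ?K))) (target c)"
        "openin (top_of_set (target c \<union> (half_space - ?K))) (half_space - ?K)"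
        unfolding un[symmetric] by (rule openin_target[OF c], rule oK)
      have "continuous_on (target c) (\<lambda>x. of_real (p (param c x)) * top_density c (param c x) + wedge_density dp c (param c x))"
        by (intro continuous_intros C1_continuous_param[OF p c] continuous_on_compose2[OF top_density_cont[OF c] continuous_param[OF c]]
            continuous_on_compose2[OF wedge_density_cont[OF c p] continuous_param[OF c]]) (use param_cdom[OF c] in auto)
      then show "continuous_on (target c) g" by (rule continuous_on_eq) (simp add: g_def)
      have "continuous_on (half_space - ?K) (\<lambda>x. 0 :: complex)" by (rule continuous_on_const)
      then show "continuous_on (half_space - ?K) g" by (rule continuous_on_eq) (use supp(2) in simp)
    qed
    then show ?thesis unfolding un[symmetric] .
  qed
  have main: "(LINT x:half_space|lborel. g x) = (LINT x:{x. x $ ?o = 0}|hyperplane_lborel. f ?o x)"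
    by (rule half_space_stokes[OF K der_f _ _ cg div]) (use supp in auto)
  have "(LINT x:half_space|lborel. g x) = (LINT x:target c|lborel. g x)"
    by (rule set_integral_support(1)[OF target_half_space[OF c]]) (simp add: g_def)
  also have "\<dots> = (LINT u:target c|lborel. of_real (p (param c u)) * top_density c (param c u) + wedge_density dp c (param c u))"
    unfolding set_lebesgue_integral_def
    by (rule Bochner_Integration.integral_cong[OF refl]) (simp add: g_def indicator_def)
  finally have 1: "(LINT x:half_space|lborel. g x) = (LINT u:target c|lborel. of_real (p (param c u)) * top_density c (param c u) + wedge_density dp c (param c u))" .
  have B: "coords c ` (cdom c \<inter> boundary \<A>) = {x. x $ ?o = 0} \<inter> target c"
    using boundary_chart[OF c] by (auto simp: target_def)
  have "(LINT x:{x. x $ ?o = 0}|hyperplane_lborel. f ?o x) = (LINT x:coords c ` (cdom c \<inter> boundary \<A>)|hyperplane_lborel. f ?o x)"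
    by (rule set_integral_support(1)) (auto simp: B f_def)
  also have "\<dots> = (LINT u:coords c ` (cdom c \<inter> boundary \<A>)|hyperplane_lborel. of_real (p (param c u)) * bd_density c (param c u))"
    unfolding set_lebesgue_integral_def
  proof (rule Bochner_Integration.integral_cong[OF refl])
    fix x
    \<comment> \<open>The outward coordinate comes first in \<open>js\<close>, so its component has
      sign 1.\<close>
    have "js ! 0 = ?o" unfolding js(1) by simp
    then have "pos ?o = 0" using pos(3)[of 0] by simp
    then have o: "vs ?o = map ?e js'" "sg ?o = 1" by (simp_all add: vs_def sg_def js(1) omit_def)
    show "indicator (coords c ` (cdom c \<inter> boundary \<A>)) x *\<^sub>R f ?o x
      = indicator (coords c ` (cdom c \<inter> boundary \<A>)) x *\<^sub>R (of_real (p (param c x)) * bd_density c (param c x))"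
    proof (cases "x \<in> coords c ` (cdom c \<inter> boundary \<A>)")
      case True
      then have x: "x \<in> target c" unfolding B by blast
      have "local_form \<A> c \<eta> (map ?e js') x = \<eta> (param c x) (map (coord_vec \<A> c (param c x)) js')"
        using local_form_coords[OF c param_cdom[OF c x], of \<eta>] coords_param[OF c x] by (simp add: coord_vec_map del: map_map)
      then show ?thesis using x by (simp add: f_def o bd_density_def)
    qed simp
  qed
  finally show "(LINT u:target c|lborel. of_real (p (param c u)) * top_density c (param c u) + wedge_density dp c (param c u))
     = (LINT u:coords c ` (cdom c \<inter> boundary \<A>)|hyperplane_lborel. of_real (p (param c u)) * bd_density c (param c u))"
    using main 1 by simp
qed

abbreviation "K0 \<equiv> form_support \<A> k \<eta>"

lemma zero_outside_support:
  assumes "c \<in> \<A>" "q \<in> cdom c" "q \<notin> form_support \<A> m \<phi>" "length vs = m" shows "\<phi> q (map (tv c q) vs) = 0"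
proof (rule ccontr)
  assume "\<phi> q (map (tv c q) vs) \<noteq> 0"
  then have "q \<in> {q. \<exists>ws. length ws = m \<and> set ws \<subseteq> tangent_space \<A> q \<and> \<phi> q ws \<noteq> 0}"
    using tv_tangent[OF assms(1,2)] assms(4) by (auto intro!: exI[of _ "map (tv c q) vs"])
  then have "q \<in> form_support \<A> m \<phi>" unfolding form_support_def by (rule subsetD[OF closure_subset])
  then show False using assms(3) by contradiction
qed

text \<open>The complement of the support is open, so the derivatives of \<open>\<eta>\<close>
  vanish there too. Hence a partition that sums to 1 on the support of \<open>\<eta>\<close> serves
  for both integrals.\<close>

lemma dform_support: "form_support \<A> (Suc k) \<zeta> \<subseteq> K0"
proof -
  have "\<zeta> q ws = 0" if q: "q \<notin> K0" and ws: "length ws = Suc k" "set ws \<subseteq> tangent_space \<A> q" for q ws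
  proof -
    obtain c where c: "c \<in> \<A>" "q \<in> cdom c" by (rule chart_at)
    let ?u = "coords c q" and ?W = "coords c ` (cdom c - K0)"
    have W: "openin (top_of_set half_space) ?W"
      by (rule openin_coords_image[OF c(1)]) (auto intro: open_Diff open_cdom[OF c(1)] simp: form_support_def)
    have u: "?u \<in> ?W" using c q by blast
    have De0: "eta_deriv c vs ?u = (\<lambda>_. 0)" if vs: "length vs = k" for vs
    proof -
      have "((\<lambda>u. 0) has_derivative (\<lambda>_. 0)) (at ?u within ?W)" by (rule has_derivative_const)
      then have "(local_form \<A> c \<eta> vs has_derivative (\<lambda>_. 0)) (at ?u within ?W)"
      proof (rule has_derivative_transform[OF u, rotated])
        fix x assume "x \<in> ?W"
        then obtain q' where q': "x = coords c q'" "q' \<in> cdom c" "q' \<notin> K0" by (elim imageE DiffE)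
        then show "local_form \<A> c \<eta> vs x = 0"
          using zero_outside_support[OF c(1) q'(2,3) vs] local_form_coords[OF c(1) q'(2)] by simp
      qed
      then have "(local_form \<A> c \<eta> vs has_derivative (\<lambda>_. 0)) (at ?u within half_space)"
        unfolding at_within_openin[OF W u] .
      then show ?thesis
        by (rule half_space_derivative_unique[OF coords_half_space[OF c] der[OF c(1) coords_target[OF c(2)] vs]])
    qed
    define vs where "vs = map (\<lambda>w. w c) ws"
    have "map (tv c q) vs = ws"
      unfolding vs_def using ws(2) tangent_eq_tv[OF c] by (auto intro!: map_idI)
    then have "\<zeta> q ws = local_form \<A> c \<zeta> vs ?u" using local_form_coords[OF c, of \<zeta> vs] by simp
    also have "\<dots> = (\<Sum>i<length vs. (-1) ^ i * eta_deriv c (omit i vs) ?u (vs ! i))"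
      by (rule dform[OF c(1) coords_target[OF c(2)]]) (simp add: vs_def ws)
    also have "\<dots> = 0"
      by (intro sum.neutral ballI) (simp add: De0 length_omit vs_def ws)
    finally show ?thesis .
  qed
  then have "{q. \<exists>ws. length ws = Suc k \<and> set ws \<subseteq> tangent_space \<A> q \<and> \<zeta> q ws \<noteq> 0} \<subseteq> K0" by blast
  then show ?thesis unfolding form_support_def[of \<A> "Suc k"] by (rule closure_minimal) (simp add: form_support_def)
qed

lemma wedge_density_outside_support:
  assumes "c \<in> \<A>" "q \<in> cdom c" "q \<notin> K0" shows "wedge_density dp c q = 0"
proof -
  have "\<eta> q (map (coord_vec \<A> c q) (omit i js)) = 0" if "i < Suc k" for i
    unfolding coord_vec_map by (rule zero_outside_support[OF assms]) (simp add: length_omit_js that)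
  then show ?thesis by (simp add: wedge_density_def del: sum.lessThan_Suc)
qed

text \<open>As \<open>K0\<close> need not be a neighbourhood of \<open>q\<close>, the identity
  \<open>(\<Sum>i<N. p i q) = 1\<close> cannot simply be differentiated. But where a value of
  \<open>\<eta>\<close> is nonzero it stays so nearby by continuity, so nearby points belong to
  \<open>K0\<close> and the derivative of the sum is 0; where the value is 0, the term vanishes
  anyway.\<close>

lemma sum_wedge_density_zero:
  assumes p: "\<And>i. i < N \<Longrightarrow> C1_deriv (p i) (dp i)" and one: "\<And>q. q \<in> K0 \<Longrightarrow> (\<Sum>i<N. p i q) = 1"
    and c: "c \<in> \<A>" "q \<in> cdom c"
  shows "(\<Sum>i<N. wedge_density (dp i) c q) = 0"
proof -
  let ?u = "coords c q"
  have *: "(\<Sum>i<N. dp i c ?u v) = 0 \<or> \<eta> q (map (tv c q) vs) = 0" if vs: "length vs = k" for v vs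
  proof (rule disjCI)
    assume nz: "\<eta> q (map (tv c q) vs) \<noteq> 0"
    define Z where "Z = {u \<in> target c. local_form \<A> c \<eta> vs u \<in> - {0}}"
    have "Z = target c \<inter> local_form \<A> c \<eta> vs -` (- {0})" by (auto simp: Z_def)
    then have "openin (top_of_set (target c)) Z"
      using continuous_openin_preimage_gen[OF continuous_on_local_eta[OF c(1) vs], of "- {0}"] by (simp add: open_Compl)
    then have Z: "openin (top_of_set half_space) Z" using openin_target[OF c(1)] openin_trans by blast
    have u: "?u \<in> Z" using nz c local_form_coords[OF c] by (simp add: Z_def)
    have "((\<lambda>u. 1 :: real) has_derivative (\<lambda>_. 0)) (at ?u within Z)" by (rule has_derivative_const)
    then have "((\<lambda>u. \<Sum>i<N. p i (param c u)) has_derivative (\<lambda>_. 0)) (at ?u within Z)"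
    proof (rule has_derivative_transform[OF u, rotated])
      fix x assume x: "x \<in> Z"
      then have xt: "x \<in> target c" by (simp add: Z_def)
      have "\<eta> (param c x) (map (tv c (param c x)) vs) \<noteq> 0" using x by (simp add: Z_def local_form_def)
      then have "param c x \<in> K0" using zero_outside_support[OF c(1) param_cdom[OF c(1) xt] _ vs] by blast
      then show "(\<Sum>i<N. p i (param c x)) = 1" by (rule one)
    qed
    then have "((\<lambda>u. \<Sum>i<N. p i (param c u)) has_derivative (\<lambda>_. 0)) (at ?u within half_space)"
      unfolding at_within_openin[OF Z u] .
    moreover have "((\<lambda>u. \<Sum>i<N. p i (param c u)) has_derivative (\<lambda>v. \<Sum>i<N. dp i c ?u v)) (at ?u within half_space)"
      using C1_derivD(1)[OF p c(1) coords_target[OF c(2)]] by (intro has_derivative_sum) simp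
    ultimately have "(\<lambda>v. \<Sum>i<N. dp i c ?u v) = (\<lambda>_. 0)"
      using half_space_derivative_unique[OF coords_half_space[OF c]] by blast
    then show "(\<Sum>i<N. dp i c ?u v) = 0" by (rule fun_cong)
  qed
  have "(\<Sum>i<N. wedge_density (dp i) c q) = of_real (\<sigma> c q) * (\<Sum>m<Suc k. \<Sum>i<N. (-1) ^ m * of_real (dp i c ?u (axis (js ! m) 1))
      * \<eta> q (map (coord_vec \<A> c q) (omit m js)))"
    unfolding wedge_density_def sum_distrib_left[symmetric] by (subst sum.swap) (rule refl)
  also have "(\<Sum>m<Suc k. \<Sum>i<N. (-1) ^ m * of_real (dp i c ?u (axis (js ! m) 1)) * \<eta> q (map (coord_vec \<A> c q) (omit m js)))
     = (\<Sum>m<Suc k. (-1) ^ m * of_real (\<Sum>i<N. dp i c ?u (axis (js ! m) 1)) * \<eta> q (map (coord_vec \<A> c q) (omit m js)))"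
    by (simp only: sum_distrib_left sum_distrib_right of_real_sum)
  also have "\<dots> = 0"
  proof (rule sum.neutral, rule ballI)
    fix m assume "m \<in> {..<Suc k}"
    then have "length (map (\<lambda>j. axis j 1 :: real^'n::_) (omit m js)) = k" by (simp add: length_omit_js)
    from *[OF this, of "axis (js ! m) 1"]
    show "(-1) ^ m * of_real (\<Sum>i<N. dp i c ?u (axis (js ! m) 1)) * \<eta> q (map (coord_vec \<A> c q) (omit m js)) = 0"
      unfolding coord_vec_map by (elim disjE) (simp_all only: of_real_0 mult_zero_right mult_zero_left)
  qed
  finally show ?thesis by simp
qed

text \<open>The terms \<open>dp\<^sub>i \<and> \<eta>\<close> live in different charts; a second insertion of the partition brings them
  into common charts, where they cancel because \<open>\<Sum>p\<^sub>i = 1\<close> on the support of \<open>\<eta>\<close>.\<close>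

lemma sum_integral_wedge_density_zero:
  assumes P: "chart_partition \<A> UNIV K0 N c p" and p: "\<And>i. i < N \<Longrightarrow> C1_deriv (p i) (dp i)"
  shows "(\<Sum>i<N. LINT u:target (c i)|lborel. wedge_density (dp i) (c i) (param (c i) u)) = 0"
proof -
  let ?S = "\<lambda>i. closure {q. p i q \<noteq> 0}"
  have ci: "c i \<in> \<A>" "compact (?S i)" "?S i \<subseteq> cdom (c i)" "continuous_on UNIV (p i)" if "i < N" for i
    using P that by (auto simp: chart_partition_def)
  have one: "(\<Sum>i<N. p i q) = 1" if "q \<in> K0" for q using P that by (simp add: chart_partition_def)
  have p0: "p i q = 0" if "q \<notin> ?S i" for i q using that closure_subset[of "{q. p i q \<noteq> 0}"] by blast
  \<comment> \<open>The \<open>i\<close>-th wedge density weighted with \<open>p j\<close>, which is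
    supported in the domains of both charts \<open>c i\<close> and \<open>c j\<close>.\<close>
  let ?D = "\<lambda>i j c q. of_real (p j q) * wedge_density (dp i) c q"
  have Dc: "continuous_on (cdom d) (?D i j d)" if "d \<in> \<A>" "i < N" "j < N" for d i j
    by (intro continuous_intros continuous_on_subset[OF ci(4)] wedge_density_cont[OF that(1) p]) (use that in auto)
  have 1: "set_integrable lborel (target (c i)) (\<lambda>u. ?D i j (c i) (param (c i) u))" if ij: "i < N" "j < N" for i j
  proof (rule density_integrable(1)[OF ci(1-3)[OF ij(1)]])
    show "continuous_on (?S i) (?D i j (c i))" by (rule continuous_on_subset[OF Dc[OF ci(1) ij] ci(3)]) fact+
    show "?D i j (c i) q = 0" if "q \<in> cdom (c i)" "q \<notin> ?S i" for q
      using wedge_density_zero[OF p[OF ij(1)] ci(1)[OF ij(1)] that] by simp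
  qed
  have 2: "set_integrable lborel (target (c j)) (\<lambda>u. ?D i j (c j) (param (c j) u))" if ij: "i < N" "j < N" for i j
  proof (rule density_integrable(1)[OF ci(1-3)[OF ij(2)]])
    show "continuous_on (?S j) (?D i j (c j))" by (rule continuous_on_subset[OF Dc[OF ci(1) ij] ci(3)]) fact+
    show "?D i j (c j) q = 0" if "q \<notin> ?S j" for q using p0[OF that] by simp
  qed
  have 3: "(LINT u:target (c i)|lborel. ?D i j (c i) (param (c i) u)) = (LINT u:target (c j)|lborel. ?D i j (c j) (param (c j) u))"
    if ij: "i < N" "j < N" for i j
  proof (rule density_chart_independent[OF ci(1)[OF ij(1)] ci(1)[OF ij(2)], of "?S i \<inter> ?S j"])
    show "compact (?S i \<inter> ?S j)" using ci(2)[OF ij(1)] by (rule compact_Int_closed) simp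
    show s: "?S i \<inter> ?S j \<subseteq> cdom (c i)" "?S i \<inter> ?S j \<subseteq> cdom (c j)" using ci(3)[OF ij(1)] ci(3)[OF ij(2)] by blast+
    show "continuous_on (?S i \<inter> ?S j) (?D i j (c i))" by (rule continuous_on_subset[OF Dc[OF ci(1) ij] s(1)]) fact
    show "continuous_on (?S i \<inter> ?S j) (?D i j (c j))" by (rule continuous_on_subset[OF Dc[OF ci(1) ij] s(2)]) fact
    show "?D i j (c i) q = 0" if "q \<in> cdom (c i)" "q \<notin> ?S i \<inter> ?S j" for q
      using wedge_density_zero[OF p[OF ij(1)] ci(1)[OF ij(1)] that(1)] p0[of q j] that(2) by auto
    show "?D i j (c j) q = 0" if "q \<in> cdom (c j)" "q \<notin> ?S i \<inter> ?S j" for q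
      using wedge_density_zero[OF p[OF ij(1)] ci(1)[OF ij(2)] that(1)] p0[of q j] that(2) by auto
    show "?D i j (c i) q = \<bar>det (matrix (T (c i) (c j) q))\<bar> *\<^sub>R ?D i j (c j) q" if "q \<in> ?S i \<inter> ?S j" for q
      using wedge_density_change[OF p[OF ij(1)] ci(1)[OF ij(1)] ci(1)[OF ij(2)], of q] subsetD[OF s(1) that] subsetD[OF s(2) that] by simp
  qed
  \<comment> \<open>On \<open>K0\<close> the weights \<open>p j\<close> sum to 1, and off
    \<open>K0\<close> the wedge density is 0.\<close>
  have 4: "(LINT u:target (c i)|lborel. wedge_density (dp i) (c i) (param (c i) u)) = (\<Sum>j<N. LINT u:target (c i)|lborel. ?D i j (c i) (param (c i) u))" if i: "i < N" for i
  proof -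
    have "(\<Sum>j<N. LINT u:target (c i)|lborel. ?D i j (c i) (param (c i) u))
      = (LINT u|lborel. (\<Sum>j<N. indicator (target (c i)) u *\<^sub>R ?D i j (c i) (param (c i) u)))"
      unfolding set_lebesgue_integral_def using 1[OF i]
      by (intro Bochner_Integration.integral_sum[symmetric]) (simp add: set_integrable_def)
    also have "\<dots> = (LINT u:target (c i)|lborel. wedge_density (dp i) (c i) (param (c i) u))"
      unfolding set_lebesgue_integral_def
    proof (rule Bochner_Integration.integral_cong[OF refl])
      fix u
      show "(\<Sum>j<N. indicator (target (c i)) u *\<^sub>R ?D i j (c i) (param (c i) u)) = indicator (target (c i)) u *\<^sub>R wedge_density (dp i) (c i) (param (c i) u)"
      proof (cases "u \<in> target (c i)")
        case True
        let ?q = "param (c i) u"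
        have "(\<Sum>j<N. ?D i j (c i) ?q) = of_real (\<Sum>j<N. p j ?q) * wedge_density (dp i) (c i) ?q" by (simp add: sum_distrib_right)
        also have "\<dots> = wedge_density (dp i) (c i) ?q"
          using one[of ?q] wedge_density_outside_support[OF ci(1)[OF i] param_cdom[OF ci(1)[OF i] True]] by (cases "?q \<in> K0") auto
        finally show ?thesis using True by simp
      qed simp
    qed
    finally show ?thesis ..
  qed
  have "(\<Sum>i<N. LINT u:target (c i)|lborel. wedge_density (dp i) (c i) (param (c i) u))
     = (\<Sum>i<N. \<Sum>j<N. LINT u:target (c j)|lborel. ?D i j (c j) (param (c j) u))"
  proof (intro sum.cong[OF refl])
    fix i assume "i \<in> {..<N}"
    then have i: "i < N" by simp
    show "(LINT u:target (c i)|lborel. wedge_density (dp i) (c i) (param (c i) u)) = (\<Sum>j<N. LINT u:target (c j)|lborel. ?D i j (c j) (param (c j) u))"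
      unfolding 4[OF i] by (rule sum.cong[OF refl], rule 3[OF i]) simp
  qed
  also have "\<dots> = (\<Sum>j<N. \<Sum>i<N. LINT u:target (c j)|lborel. ?D i j (c j) (param (c j) u))" by (rule sum.swap)
  also have "\<dots> = (\<Sum>j<N. 0)"
  proof (rule sum.cong[OF refl])
    fix j assume "j \<in> {..<N}"
    then have j: "j < N" by simp
    have "(\<Sum>i<N. LINT u:target (c j)|lborel. ?D i j (c j) (param (c j) u))
      = (LINT u|lborel. (\<Sum>i<N. indicator (target (c j)) u *\<^sub>R ?D i j (c j) (param (c j) u)))"
      unfolding set_lebesgue_integral_def using 2 j
      by (intro Bochner_Integration.integral_sum[symmetric]) (simp add: set_integrable_def)
    also have "\<dots> = (LINT u|(lborel :: (real^'n::_) measure). (0 :: complex))"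
    proof (rule Bochner_Integration.integral_cong[OF refl])
      fix u :: "real^'n::_"
      show "(\<Sum>i<N. indicator (target (c j)) u *\<^sub>R ?D i j (c j) (param (c j) u)) = 0"
      proof (cases "u \<in> target (c j)")
        case True
        have "(\<Sum>i<N. ?D i j (c j) (param (c j) u)) = of_real (p j (param (c j) u)) * (\<Sum>i<N. wedge_density (dp i) (c j) (param (c j) u))"
          by (simp add: sum_distrib_left)
        also have "\<dots> = 0" using sum_wedge_density_zero[OF p one ci(1)[OF j] param_cdom[OF ci(1)[OF j] True]] by simp
        finally show ?thesis using True by simp
      qed simp
    qed
    finally show "(\<Sum>i<N. LINT u:target (c j)|lborel. ?D i j (c j) (param (c j) u)) = 0" by simp
  qed
  finally show ?thesis by simp
qed

text \<open>One differentiable partition computes both integrals. The identities of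
  \<open>local_stokes\<close> are added up over it; the wedge terms cancel in the total and not
  chart by chart.\<close>

theorem stokes:
  assumes "compact K0"
  obtains I where "has_form_integral \<A> \<sigma> \<zeta> I" "has_boundary_integral \<A> \<sigma> \<eta> I"
proof -
  obtain N c p dp where P: "chart_partition \<A> UNIV K0 N c p" and p: "\<And>i. i < N \<Longrightarrow> C1_deriv (p i) (dp i)"
    using smooth_partition_exists[OF assms] by blast
  let ?S = "\<lambda>i. closure {q. p i q \<noteq> 0}"
  have ci: "c i \<in> \<A>" "compact (?S i)" "?S i \<subseteq> cdom (c i)" "continuous_on UNIV (p i)" "\<And>q. p i q \<ge> 0" if "i < N" for i
    using P that by (auto simp: chart_partition_def)
  have P1: "chart_partition \<A> UNIV (UNIV \<inter> form_support \<A> (length js) \<zeta>) N c p"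
    using P dform_support unfolding chart_partition_def js(4) by blast
  have P2: "chart_partition \<A> (boundary \<A>) (boundary \<A> \<inter> form_support \<A> (length js') \<eta>) N c p"
    unfolding chart_partition_def js(5)
  proof (intro conjI allI impI ballI)
    fix i assume i: "i < N"
    have sub: "closure {q \<in> boundary \<A>. p i q \<noteq> 0} \<subseteq> ?S i" by (intro closure_mono) auto
    show "c i \<in> \<A>" by (rule ci(1)[OF i])
    show "continuous_on (boundary \<A>) (p i)" by (rule continuous_on_subset[OF ci(4)[OF i]]) simp
    show "0 \<le> p i q" for q by (rule ci(5)[OF i])
    show "closure {q \<in> boundary \<A>. p i q \<noteq> 0} \<subseteq> cdom (c i)" using sub ci(3)[OF i] by blast
    show "compact (closure {q \<in> boundary \<A>. p i q \<noteq> 0})"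
      using compact_Int_closed[OF ci(2)[OF i], of "closure {q \<in> boundary \<A>. p i q \<noteq> 0}"] sub by (simp add: inf.absorb2)
  next
    fix q assume "q \<in> boundary \<A> \<inter> K0"
    then show "(\<Sum>i<N. p i q) = 1" using P by (simp add: chart_partition_def)
  qed
  have tg: "coords d ` (cdom d \<inter> UNIV) = target d" for d :: "('q, 'n) chart" by (simp add: target_def)
  let ?Iz = "\<Sum>i<N. LINT u:target (c i)|lborel. of_real (p i (param (c i) u)) * top_density (c i) (param (c i) u)"
  let ?Ib = "\<Sum>i<N. LINT u:coords (c i) ` (cdom (c i) \<inter> boundary \<A>)|hyperplane_lborel. of_real (p i (param (c i) u)) * bd_density (c i) (param (c i) u)"
  have "has_form_integral_over \<A> \<sigma> UNIV lborel js \<zeta>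
    (\<Sum>i<N. LINT u:coords (c i) ` (cdom (c i) \<inter> UNIV)|lborel. of_real (p i (param (c i) u)) * top_density (c i) (param (c i) u))"
  proof (rule has_form_integral_overI[where D = top_density])
    show "top_density d q = of_real (\<sigma> d q) * \<zeta> q (map (coord_vec \<A> d q) js)" for d q by (rule top_density_def)
    show "param d (coords d q) = q" if "d \<in> \<A>" "q \<in> cdom d" for d q by (rule param_coords[OF that])
    show "set_integrable lborel (coords d ` (cdom d \<inter> UNIV)) (\<lambda>u. of_real (f (param d u)) * top_density d (param d u))"
      if "d \<in> \<A>" "admissible UNIV d f" for d f
      unfolding tg by (rule admissible_integrable[OF that top_density_cont[OF that(1)]])
    show "(LINT u:coords d ` (cdom d \<inter> UNIV)|lborel. of_real (f (param d u)) * top_density d (param d u))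
      = (LINT u:coords d' ` (cdom d' \<inter> UNIV)|lborel. of_real (f (param d' u)) * top_density d' (param d' u))"
      if "d \<in> \<A>" "d' \<in> \<A>" "admissible UNIV d f" "admissible UNIV d' f" for d d' f
      unfolding tg by (rule admissible_chart_independent[OF that top_density_cont[OF that(1)] top_density_cont[OF that(2)] top_density_change[OF that(1,2)]])
    show "top_density d q = 0" if "d \<in> \<A>" "q \<in> cdom d" "q \<notin> form_support \<A> (length js) \<zeta>" for d q
      using zero_outside_support[OF that(1,2) that(3)[unfolded js(4)], of "map (\<lambda>j. axis j 1) js"]
      unfolding top_density_def coord_vec_map by (simp add: js(4))
  qed (rule P1)
  then have z: "has_form_integral \<A> \<sigma> \<zeta> ?Iz" unfolding tg has_form_integral_def js_def .
  have "has_form_integral_over \<A> \<sigma> (boundary \<A>) hyperplane_lborel js' \<eta> ?Ib"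
  proof (rule has_form_integral_overI[where D = bd_density])
    show "bd_density d q = of_real (\<sigma> d q) * \<eta> q (map (coord_vec \<A> d q) js')" for d q by (rule bd_density_def)
    show "param d (coords d q) = q" if "d \<in> \<A>" "q \<in> cdom d" for d q by (rule param_coords[OF that])
    show "set_integrable hyperplane_lborel (coords d ` (cdom d \<inter> boundary \<A>)) (\<lambda>u. of_real (f (param d u)) * bd_density d (param d u))"
      if "d \<in> \<A>" "admissible (boundary \<A>) d f" for d f
      by (rule boundary_admissible_integrable[OF that bd_density_cont[OF that(1)]])
    show "(LINT u:coords d ` (cdom d \<inter> boundary \<A>)|hyperplane_lborel. of_real (f (param d u)) * bd_density d (param d u))
      = (LINT u:coords d' ` (cdom d' \<inter> boundary \<A>)|hyperplane_lborel. of_real (f (param d' u)) * bd_density d' (param d' u))"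
      if "d \<in> \<A>" "d' \<in> \<A>" "admissible (boundary \<A>) d f" "admissible (boundary \<A>) d' f" for d d' f
      by (rule boundary_admissible_chart_independent[OF that bd_density_cont[OF that(1)] bd_density_cont[OF that(2)] bd_density_change[OF that(1,2)]])
    show "bd_density d q = 0" if "d \<in> \<A>" "q \<in> cdom d" "q \<notin> form_support \<A> (length js') \<eta>" for d q
      using zero_outside_support[OF that(1,2) that(3)[unfolded js(5)], of "map (\<lambda>j. axis j 1) js'"]
      unfolding bd_density_def coord_vec_map by (simp add: js(5))
  qed (rule P2)
  then have b: "has_boundary_integral \<A> \<sigma> \<eta> ?Ib" unfolding has_boundary_integral_def js'_def .
  have "?Ib = (\<Sum>i<N. LINT u:target (c i)|lborel. of_real (p i (param (c i) u)) * top_density (c i) (param (c i) u) + wedge_density (dp i) (c i) (param (c i) u))"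
    by (intro sum.cong refl local_stokes[symmetric] ci p) auto
  also have "\<dots> = (\<Sum>i<N. (LINT u:target (c i)|lborel. of_real (p i (param (c i) u)) * top_density (c i) (param (c i) u))
      + (LINT u:target (c i)|lborel. wedge_density (dp i) (c i) (param (c i) u)))"
  proof (intro sum.cong refl set_integral_add)
    fix i assume "i \<in> {..<N}"
    then have i: "i < N" by simp
    have ad: "admissible UNIV (c i) (p i)" using ci[OF i] by (simp add: admissible_def)
    show "set_integrable lborel (target (c i)) (\<lambda>u. of_real (p i (param (c i) u)) * top_density (c i) (param (c i) u))"
      by (rule admissible_integrable[OF ci(1)[OF i] ad top_density_cont[OF ci(1)[OF i]]])
    show "set_integrable lborel (target (c i)) (\<lambda>u. wedge_density (dp i) (c i) (param (c i) u))"
      by (rule density_integrable(1)[OF ci(1-3)[OF i] continuous_on_subset[OF wedge_density_cont[OF ci(1)[OF i] p[OF i]] ci(3)[OF i]]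
            wedge_density_zero[OF p[OF i] ci(1)[OF i]]])
  qed
  also have "\<dots> = ?Iz"
  proof -
    have "(\<Sum>i<N. LINT u:target (c i)|lborel. wedge_density (dp i) (c i) (param (c i) u)) = 0"
      by (rule sum_integral_wedge_density_zero[OF P p])
    then show ?thesis unfolding sum.distrib by simp
  qed
  finally have "?Ib = ?Iz" .
  with z b show ?thesis using that[of ?Iz] by simp
qed

end

section \<open>Values of the integrals, and the exterior derivative of the pullback\<close>

lemma has_form_integral_over_unique:
  assumes "has_form_integral_over \<A> \<sigma> M \<mu> js \<eta> I" "has_form_integral_over \<A> \<sigma> M \<mu> js \<eta> I'"
  shows "I = I'"
proof -
  obtain N c p where "chart_partition \<A> M (M \<inter> form_support \<A> (length js) \<eta>) N c p"
    using assms(1) unfolding has_form_integral_over_def Let_def by blast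
  then have P: "chart_partition \<A> M (M \<inter> form_support \<A> (length js) \<eta>) N c p" .
  note u = assms[unfolded has_form_integral_over_def Let_def, THEN conjunct2, THEN spec, THEN spec, THEN spec, THEN mp, OF P, THEN conjunct2]
  show ?thesis by (rule trans[OF u(1) u(2)[symmetric]])
qed

lemma form_integral_eqI: "has_form_integral \<A> \<sigma> \<eta> I \<Longrightarrow> form_integral \<A> \<sigma> \<eta> = I"
  unfolding form_integral_def has_form_integral_def by (blast intro: has_form_integral_over_unique)

lemma boundary_integral_eqI: "has_boundary_integral \<A> \<sigma> \<eta> I \<Longrightarrow> boundary_integral \<A> \<sigma> \<eta> = I"
  unfolding boundary_integral_def has_boundary_integral_def by (blast intro: has_form_integral_over_unique)

text \<open>The value found in a chart does not mention the chart, so all coordinate expressions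
  agree; as some chart contains \<open>q\<close>, the definite description in
  \<open>ext_deriv\<close> denotes this value.\<close>

lemma (in nonpure) pullback_ext_deriv:
  assumes w: "algebra_form k \<omega>" and ws: "length ws = Suc k" "set ws \<subseteq> tangent_space \<A> q"
  shows "ext_deriv \<A> (pullback \<tau> \<rho> V \<omega>) q ws = pullback \<tau> \<rho> V (ce_diff \<omega>) q ws"
proof -
  have *: "ext_deriv_in \<A> c (pullback \<tau> \<rho> V \<omega>) q ws = pullback \<tau> \<rho> V (ce_diff \<omega>) q ws" if c: "c \<in> \<A>" "q \<in> cdom c" for c
  proof -
    let ?u = "coords c q"
    note u = coords_target[OF c(2)]
    define vs where "vs = map (\<lambda>w. w c) ws"
    have vs: "length vs = Suc k" "map (tv c q) vs = ws"
      unfolding vs_def using ws tangent_eq_tv[OF c] by (auto intro!: map_idI)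
    have "ext_deriv_in \<A> c (pullback \<tau> \<rho> V \<omega>) q ws = (\<Sum>i<length vs. (-1) ^ i * pullback_deriv \<omega> c (omit i vs) ?u (vs ! i))"
      unfolding ext_deriv_in_def
    proof (rule sum.cong)
      fix i assume "i \<in> {..<length vs}"
      then have i: "i < Suc k" by (simp add: vs)
      have "frechet_derivative (local_form \<A> c (pullback \<tau> \<rho> V \<omega>) (omit i vs)) (at ?u within target c) = pullback_deriv \<omega> c (omit i vs) ?u"
        unfolding within_target[OF c(1) u]
        by (rule half_space_frechet_derivative[OF coords_half_space[OF c] pullback_has_derivative[OF c(1) u w]])
           (simp add: length_omit vs i)
      then show "(-1) ^ i * frechet_derivative (local_form \<A> c (pullback \<tau> \<rho> V \<omega>) (map (\<lambda>w. w c) (omit i ws))) (at ?u within target c) ((ws ! i) c)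
        = (-1) ^ i * pullback_deriv \<omega> c (omit i vs) ?u (vs ! i)"
        using i ws by (simp add: vs_def map_omit)
    qed (simp add: vs_def)
    also have "\<dots> = local_form \<A> c (pullback \<tau> \<rho> V (ce_diff \<omega>)) vs ?u"
      by (rule pullback_ce_diff[OF c(1) u w vs(1)])
    also have "\<dots> = pullback \<tau> \<rho> V (ce_diff \<omega>) q ws"
      using c vs(2) by (simp add: local_form_def)
    finally show ?thesis .
  qed
  obtain c where "c \<in> \<A>" "q \<in> cdom c" by (rule chart_at)
  then show ?thesis
    unfolding ext_deriv_def using * by (intro the_equality) auto
qed

theorem theorem7:
  fixes \<tau> :: "'a::cstar_algebra \<Rightarrow> ennreal"
    and \<A> :: "('q::{t2_space,second_countable_topology}, 'n::{finite,linorder}) chart set"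
    and \<sigma> :: "('q, 'n) chart \<Rightarrow> 'q \<Rightarrow> real"
    and \<rho> :: "'q \<Rightarrow> 'a"
    and V :: "'q \<Rightarrow> ('q, 'n) tvec \<Rightarrow> 'a"
    and \<omega> :: "'a list \<Rightarrow> 'a"
    and k :: nat
  assumes "faithful_trace \<tau>"
    and "manifold_atlas \<A>"
    and "orientation \<A> \<sigma>"
    and "nonpure_map \<tau> \<A> \<rho> V"
    and "algebra_form k \<omega>"
  shows "form_differentiable \<A> k (pullback \<tau> \<rho> V \<omega>) \<and>
    (\<forall>q ws. length ws = k + 1 \<longrightarrow> set ws \<subseteq> tangent_space \<A> q \<longrightarrow>
       pullback \<tau> \<rho> V (ce_diff \<omega>) q ws = ext_deriv \<A> (pullback \<tau> \<rho> V \<omega>) q ws) \<and>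
    (k + 1 = CARD('n) \<longrightarrow> compact (form_support \<A> k (pullback \<tau> \<rho> V \<omega>)) \<longrightarrow>
       (\<exists>I. has_form_integral \<A> \<sigma> (pullback \<tau> \<rho> V (ce_diff \<omega>)) I) \<and>
       (\<exists>I. has_boundary_integral \<A> \<sigma> (pullback \<tau> \<rho> V \<omega>) I) \<and>
       form_integral \<A> \<sigma> (pullback \<tau> \<rho> V (ce_diff \<omega>)) =
         boundary_integral \<A> \<sigma> (pullback \<tau> \<rho> V \<omega>))"
proof -
  interpret nonpure \<A> \<tau> \<rho> V
    by unfold_locales (rule assms)+
  note w = assms(5)
  have "form_differentiable \<A> k (pullback \<tau> \<rho> V \<omega>)"
    unfolding form_differentiable_def differentiable_on_def
  proof (intro ballI allI impI)
    fix c vs u assume "c \<in> \<A>" "length (vs :: (real^'n::_) list) = k" "u \<in> target c"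
    then show "local_form \<A> c (pullback \<tau> \<rho> V \<omega>) vs differentiable (at u within target c)"
      using pullback_has_derivative[OF _ _ w] within_target unfolding differentiable_def by metis
  qed
  moreover have "pullback \<tau> \<rho> V (ce_diff \<omega>) q ws = ext_deriv \<A> (pullback \<tau> \<rho> V \<omega>) q ws"
    if "length ws = k + 1" "set ws \<subseteq> tangent_space \<A> q" for q ws
    using pullback_ext_deriv[OF w _ that(2)] that(1) by simp
  moreover have "(\<exists>I. has_form_integral \<A> \<sigma> (pullback \<tau> \<rho> V (ce_diff \<omega>)) I) \<and>
       (\<exists>I. has_boundary_integral \<A> \<sigma> (pullback \<tau> \<rho> V \<omega>) I) \<and>
       form_integral \<A> \<sigma> (pullback \<tau> \<rho> V (ce_diff \<omega>)) = boundary_integral \<A> \<sigma> (pullback \<tau> \<rho> V \<omega>)"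
    if dim: "k + 1 = CARD('n)" and supp: "compact (form_support \<A> k (pullback \<tau> \<rho> V \<omega>))"
  proof -
    \<comment> \<open>In the role of \<open>\<zeta>\<close> stands the pullback of
      \<open>ce_diff \<omega>\<close>, whose coordinate formula and continuity are known, and not
      \<open>ext_deriv\<close> itself.\<close>
    interpret exact_form \<A> \<sigma> k "pullback \<tau> \<rho> V \<omega>" "pullback \<tau> \<rho> V (ce_diff \<omega>)" "pullback_deriv \<omega>"
    proof
      show "orientation \<A> \<sigma>" by (rule assms)
      show "Suc k = CARD('n)" using dim by simp
      show "alt_form k (\<lambda>vs. pullback \<tau> \<rho> V \<omega> q (map (tv c q) vs))" if "c \<in> \<A>" "q \<in> cdom c" for c q
        by (rule pullback_alt_form[OF that w])
      show "(local_form \<A> c (pullback \<tau> \<rho> V \<omega>) vs has_derivative pullback_deriv \<omega> c vs u) (at u within half_space)"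
        if "c \<in> \<A>" "u \<in> target c" "length vs = k" for c u vs
        by (rule pullback_has_derivative[OF that(1,2) w that(3)])
      show "local_form \<A> c (pullback \<tau> \<rho> V (ce_diff \<omega>)) ws u = (\<Sum>i<length ws. (-1) ^ i * pullback_deriv \<omega> c (omit i ws) u (ws ! i))"
        if "c \<in> \<A>" "u \<in> target c" "length ws = Suc k" for c u ws
        by (rule pullback_ce_diff[OF that(1,2) w that(3), symmetric])
      show "continuous_on (target c) (local_form \<A> c (pullback \<tau> \<rho> V (ce_diff \<omega>)) ws)"
        if "c \<in> \<A>" "length ws = Suc k" for c ws
        by (rule continuous_pullback_ce_diff[OF that(1) w that(2)])
    qed
    obtain I where "has_form_integral \<A> \<sigma> (pullback \<tau> \<rho> V (ce_diff \<omega>)) I" "has_boundary_integral \<A> \<sigma> (pullback \<tau> \<rho> V \<omega>) I"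
      by (rule stokes[OF supp])
    then show ?thesis using form_integral_eqI boundary_integral_eqI by metis
  qed
  ultimately show ?thesis by blast
qed

end
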